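(* Let $L$ be a nonabelian limit group and let $G$ be a compact group containing a subgroup $F$ which is (abstractly) a free group of rank $r$ with $2\le r\le d(L)$. Then $G$ contains a subgroup isomorphic to $L$ whose closure in $G$ contains $F$.
   Context: Topological groups are Hausdorff. A sequence of homomorphisms $f_i\in\mathrm{Hom}(\Gamma,F)$, with $\Gamma$ a finitely generated group and $F$ a free group, is stable if every $g\in\Gamma$ is either in $\ker f_i$ for all large $i$ or outside $\ker f_i$ for all large $i$. A finitely generated group $L$ is a limit group if $L=\Gamma/\lim_i\ker f_i$ for some finitely generated $\Gamma$ and some stable sequence $(f_i)$; equivalently (Sela), $L$ is finitely generated and fully residually free, i.e. for all finitely many nontrivial $g_1,\dots,g_n\in L$ there is a homomorphism $f$ from $L$ to a free group with $f(g_i)\ne1$ for all $i$. Generalized double: for a limit group $M$, a generalized double over $M$ is an epimorphism $\varphi:M'\to M$ where $M'=A*_CB$ is an amalgamated product or $M'=A*_C$ is an HNN extension, such that (1) the vertex groups $A$ and $B$ (resp. $A$) are finitely generated; (2) the edge homomorphisms are injective, and $C$ is a nontrivial abelian group whose images under both edge embeddings are maximal abelian subgroups of the corresponding vertex groups; (3) $\varphi$ is injective on each vertex group. The number $d(L)$: for every limit group $L$ there is a finite sequence of epimorphisms $L\to L_1\to\cdots\to L_n\to F$ of limit groups, in which each arrow is a generalized double over its target and $F$ is a finitely generated free group (the sequence may be trivial when $L$ itself is free). $d(L)$ is the maximal possible rank of a free group $F$ appearing at the end of such a sequence; for nonabelian $L$ it is a natural number with $d(L)\ge2$. *)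

theory Defs
  imports "HOL-Analysis.Analysis" "HOL-Algebra.Generated_Groups" "HOL-Algebra.Coset"
begin

section \<open>Compact topological groups\<close>

definition compact_group :: "('a, 'm) monoid_scheme \<Rightarrow> 'a topology \<Rightarrow> bool" where
  "compact_group G T \<longleftrightarrow>
     group G \<and> topspace T = carrier G \<and>
     continuous_map (prod_topology T T) T (\<lambda>(x, y). x \<otimes>\<^bsub>G\<^esub> y) \<and>
     continuous_map T T (\<lambda>x. inv\<^bsub>G\<^esub> x) \<and>
     Hausdorff_space T \<and> compact_space T"

section \<open>Group presentations\<close>

text \<open>A letter \<open>(True, x)\<close> stands for the generator \<open>x\<close>, and \<open>(False, x)\<close> for its formal inverse.\<close>

type_synonym 'x word = "(bool \<times> 'x) list"

definition words :: "'x set \<Rightarrow> 'x word set" where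
  "words X = lists (UNIV \<times> X)"

inductive_set pres_cong :: "'x set \<Rightarrow> 'x word set \<Rightarrow> ('x word \<times> 'x word) set"
  for X :: "'x set" and R :: "'x word set" where
  refl: "u \<in> words X \<Longrightarrow> (u, u) \<in> pres_cong X R"
| sym: "(u, v) \<in> pres_cong X R \<Longrightarrow> (v, u) \<in> pres_cong X R"
| trans: "(u, v) \<in> pres_cong X R \<Longrightarrow> (v, w) \<in> pres_cong X R \<Longrightarrow> (u, w) \<in> pres_cong X R"
| append: "(u, v) \<in> pres_cong X R \<Longrightarrow> (u', v') \<in> pres_cong X R \<Longrightarrow> (u @ u', v @ v') \<in> pres_cong X R"
| cancel: "x \<in> X \<Longrightarrow> ([(b, x), (\<not> b, x)], []) \<in> pres_cong X R"
| relator: "r \<in> R \<Longrightarrow> r \<in> words X \<Longrightarrow> (r, []) \<in> pres_cong X R"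

text \<open>The group \<open>\<langle>X | R\<rangle>\<close>; its elements are the classes of words over \<open>X\<close>.\<close>

definition presented_group :: "'x set \<Rightarrow> 'x word set \<Rightarrow> 'x word set monoid" where
  "presented_group X R =
     \<lparr>carrier = words X // pres_cong X R,
      mult = (\<lambda>P Q. \<Union>u\<in>P. \<Union>v\<in>Q. pres_cong X R `` {u @ v}),
      one = pres_cong X R `` {[]}\<rparr>"

definition pres_gen :: "'x set \<Rightarrow> 'x word set \<Rightarrow> 'x \<Rightarrow> 'x word set" where
  "pres_gen X R x = pres_cong X R `` {[(True, x)]}"

lemma equiv_pres_cong: "equiv (words X) (pres_cong X R)"
proof (rule equivI)
  have *: "u \<in> words X \<and> v \<in> words X" if "(u,v) \<in> pres_cong X R" for u v
    using that by induction (auto simp: words_def)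
  then show "pres_cong X R \<subseteq> words X \<times> words X" by auto
  show "refl_on (words X) (pres_cong X R)"
    using * by (auto simp: refl_on_def intro: pres_cong.refl)
  show "sym (pres_cong X R)" by (auto simp: sym_def intro: pres_cong.sym)
  show "trans (pres_cong X R)" by (auto simp: trans_def intro: pres_cong.trans)
qed

definition word_inv :: "'x word \<Rightarrow> 'x word" where
  "word_inv u = rev (map (\<lambda>(b,x). (\<not> b, x)) u)"

lemma word_inv_left: "u \<in> words X \<Longrightarrow> (word_inv u @ u, []) \<in> pres_cong X R"
proof (induction u)
  case Nil then show ?case by (auto simp: word_inv_def words_def intro!: pres_cong.refl)
next
  case (Cons p u)
  obtain b x where p: "p = (b,x)" by force
  have w: "x \<in> X" "u \<in> words X" "word_inv u \<in> words X"
    using Cons.prems p by (auto simp: words_def word_inv_def in_lists_conv_set)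
  have "([(\<not> b, x), (\<not> \<not> b, x)] @ u, [] @ u) \<in> pres_cong X R"
    using w by (intro pres_cong.append pres_cong.cancel pres_cong.refl)
  then have "(word_inv u @ ([(\<not> b, x), (b, x)] @ u), word_inv u @ u) \<in> pres_cong X R"
    using w by (intro pres_cong.append) (auto intro: pres_cong.refl)
  moreover have "word_inv (p # u) @ (p # u) = word_inv u @ ([(\<not> b, x), (b, x)] @ u)"
    by (simp add: word_inv_def p)
  ultimately show ?case using Cons.IH w pres_cong.trans by metis
qed

lemma pres_mult: 
  assumes "u \<in> words X" "v \<in> words X"
  shows "(pres_cong X R `` {u}) \<otimes>\<^bsub>presented_group X R\<^esub> (pres_cong X R `` {v}) = pres_cong X R `` {u @ v}"
proof -
  let ?r = "pres_cong X R"
  have "?r `` {u' @ v'} = ?r `` {u @ v}" if "(u,u') \<in> ?r" "(v,v') \<in> ?r" for u' v'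
    using equiv_class_eq[OF equiv_pres_cong pres_cong.append[OF that]] by simp
  then show ?thesis using assms by (force simp: presented_group_def intro: pres_cong.refl)
qed

lemma group_presented_group: "group (presented_group X R)"
proof -
  let ?G = "presented_group X R"
  have c: "carrier ?G = (\<lambda>u. pres_cong X R `` {u}) ` words X"
    by (auto simp: presented_group_def quotient_def)
  have o: "\<one>\<^bsub>?G\<^esub> = pres_cong X R `` {[]}" by (simp add: presented_group_def)
  have w: "[] \<in> words X" "\<And>u v. u \<in> words X \<Longrightarrow> v \<in> words X \<Longrightarrow> u @ v \<in> words X"
    "\<And>u. u \<in> words X \<Longrightarrow> word_inv u \<in> words X"
    by (auto simp: words_def word_inv_def in_lists_conv_set)
  show ?thesis
  proof (rule groupI)
    fix x y z assume "x \<in> carrier ?G" "y \<in> carrier ?G" "z \<in> carrier ?G"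
    then show "x \<otimes>\<^bsub>?G\<^esub> y \<otimes>\<^bsub>?G\<^esub> z = x \<otimes>\<^bsub>?G\<^esub> (y \<otimes>\<^bsub>?G\<^esub> z)"
      unfolding c using w by (auto simp: pres_mult)
  next
    fix x assume "x \<in> carrier ?G"
    then obtain u where u: "u \<in> words X" "x = pres_cong X R `` {u}" unfolding c by auto
    have "(pres_cong X R `` {word_inv u}) \<otimes>\<^bsub>?G\<^esub> x = \<one>\<^bsub>?G\<^esub>"
      using u w equiv_class_eq[OF equiv_pres_cong word_inv_left[OF u(1)]] by (simp add: pres_mult o)
    then show "\<exists>y\<in>carrier ?G. y \<otimes>\<^bsub>?G\<^esub> x = \<one>\<^bsub>?G\<^esub>" unfolding c using u w by blast
  qed (use w in \<open>auto simp: c o pres_mult\<close>)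
qed

text \<open>\<open>word_eval H h\<close> evaluates words in \<open>H\<close>, sending the generator \<open>x\<close> to \<open>h x\<close>.\<close>

definition letter_eval where "letter_eval H h = (\<lambda>(b,x). if b then h x else inv\<^bsub>H\<^esub> h x)"
definition word_eval where "word_eval H h u = foldr (\<lambda>p y. letter_eval H h p \<otimes>\<^bsub>H\<^esub> y) u \<one>\<^bsub>H\<^esub>"

lemma pres_universal:
  assumes "group H" "h \<in> X \<rightarrow> carrier H" "\<And>r. r \<in> R \<Longrightarrow> word_eval H h r = \<one>\<^bsub>H\<^esub>"
  shows "\<exists>k\<in>hom (presented_group X R) H. \<forall>x\<in>X. k (pres_gen X R x) = h x"
proof -
  interpret H: group H by fact
  let ?e = "word_eval H h"
  have l: "letter_eval H h p \<in> carrier H" if "snd p \<in> X" for p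
    using that assms(2) by (auto simp: letter_eval_def split: prod.splits)
  have cl: "?e u \<in> carrier H" if "u \<in> words X" for u
    using that by (induction u) (auto simp: word_eval_def words_def intro!: H.m_closed l)
  have ap: "?e (u @ v) = ?e u \<otimes>\<^bsub>H\<^esub> ?e v" if "u \<in> words X" "v \<in> words X" for u v
    using that
  proof (induction u)
    case Nil then show ?case using cl by (simp add: word_eval_def)
  next
    case (Cons p u)
    then have "snd p \<in> X" "u \<in> words X" by (auto simp: words_def)
    then show ?case using Cons cl[of u] cl[of v] l[of p] by (simp add: word_eval_def H.m_assoc)
  qed
  have e: "?e u = ?e v \<and> u \<in> words X \<and> v \<in> words X" if "(u,v) \<in> pres_cong X R" for u v
    using that
  proof induction
    case (cancel x b)
    then have "h x \<in> carrier H" using assms(2) by auto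
    then show ?case using cancel by (auto simp: word_eval_def letter_eval_def words_def)
  qed (auto simp: ap assms(3) word_eval_def[of _ _ "[]"] words_def[of X] dest: ap)
  let ?k = "\<lambda>P. ?e (SOME u. u \<in> P)"
  have k: "?k (pres_cong X R `` {u}) = ?e u" if "u \<in> words X" for u
  proof -
    have "\<exists>v. v \<in> pres_cong X R `` {u}" using that by (auto intro: pres_cong.refl)
    then have "(SOME v. v \<in> pres_cong X R `` {u}) \<in> pres_cong X R `` {u}" by (rule someI_ex)
    then show ?thesis using e by fastforce
  qed
  have "?k \<in> hom (presented_group X R) H"
  proof (rule homI)
    fix x y assume "x \<in> carrier (presented_group X R)" "y \<in> carrier (presented_group X R)"
    then obtain u v where uv: "u \<in> words X" "v \<in> words X" "x = pres_cong X R `` {u}" "y = pres_cong X R `` {v}"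
      by (auto simp: presented_group_def quotient_def)
    then have "u @ v \<in> words X" by (auto simp: words_def)
    with uv show "?k (x \<otimes>\<^bsub>presented_group X R\<^esub> y) = ?k x \<otimes>\<^bsub>H\<^esub> ?k y"
      by (simp only: pres_mult k ap)
    show "?k x \<in> carrier H" using uv by (simp only: k cl)
  qed
  moreover have "\<forall>x\<in>X. ?k (pres_gen X R x) = h x"
    using k assms(2) by (force simp: pres_gen_def words_def word_eval_def letter_eval_def)
  ultimately show ?thesis by (intro bexI[of _ ?k])
qed

definition free_group :: "'x set \<Rightarrow> 'x word set monoid" where
  "free_group X = presented_group X {}"

definition free_of_rank :: "('a, 'm) monoid_scheme \<Rightarrow> nat \<Rightarrow> bool" where
  "free_of_rank G r \<longleftrightarrow> group G \<and> G \<cong> free_group {..<r}"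

text \<open>\<open>mult_relators e G\<close> is the multiplication table of \<open>G\<close>, written in the letters \<open>e g\<close>.\<close>

definition mult_relators :: "('a \<Rightarrow> 'x) \<Rightarrow> ('a, 'm) monoid_scheme \<Rightarrow> 'x word set" where
  "mult_relators e G =
     {[(True, e g), (True, e h), (False, e (g \<otimes>\<^bsub>G\<^esub> h))] | g h. g \<in> carrier G \<and> h \<in> carrier G}"

section \<open>Amalgamated products and HNN extensions\<close>

definition amalgam_gens :: "('a, 'm) monoid_scheme \<Rightarrow> ('b, 'n) monoid_scheme \<Rightarrow> ('a + 'b) set" where
  "amalgam_gens A B = carrier A <+> carrier B"

definition amalgam_rels ::
    "('a, 'm) monoid_scheme \<Rightarrow> ('b, 'n) monoid_scheme \<Rightarrow> ('c, 'k) monoid_scheme \<Rightarrow>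
     ('c \<Rightarrow> 'a) \<Rightarrow> ('c \<Rightarrow> 'b) \<Rightarrow> ('a + 'b) word set" where
  "amalgam_rels A B C i j =
     mult_relators Inl A \<union> mult_relators Inr B \<union>
     {[(True, Inl (i c)), (False, Inr (j c))] | c. c \<in> carrier C}"

definition amalgam where
  "amalgam A B C i j = presented_group (amalgam_gens A B) (amalgam_rels A B C i j)"

definition amalgam_inl where
  "amalgam_inl A B C i j a = pres_gen (amalgam_gens A B) (amalgam_rels A B C i j) (Inl a)"

definition amalgam_inr where
  "amalgam_inr A B C i j b = pres_gen (amalgam_gens A B) (amalgam_rels A B C i j) (Inr b)"

text \<open>In the HNN extension the letter \<open>None\<close> is the stable letter \<open>t\<close>, and
  \<open>t i(c) t\<inverse> = j(c)\<close> for \<open>c \<in> C\<close>.\<close>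

definition HNN_gens :: "('a, 'm) monoid_scheme \<Rightarrow> 'a option set" where
  "HNN_gens A = insert None (Some ` carrier A)"

definition HNN_rels ::
    "('a, 'm) monoid_scheme \<Rightarrow> ('c, 'k) monoid_scheme \<Rightarrow> ('c \<Rightarrow> 'a) \<Rightarrow> ('c \<Rightarrow> 'a) \<Rightarrow>
     'a option word set" where
  "HNN_rels A C i j =
     mult_relators Some A \<union>
     {[(True, None), (True, Some (i c)), (False, None), (False, Some (j c))] | c. c \<in> carrier C}"

definition HNN where
  "HNN A C i j = presented_group (HNN_gens A) (HNN_rels A C i j)"

definition HNN_vertex where
  "HNN_vertex A C i j a = pres_gen (HNN_gens A) (HNN_rels A C i j) (Some a)"

section \<open>Limit groups\<close>

definition finitely_generated :: "('a, 'm) monoid_scheme \<Rightarrow> bool" where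
  "finitely_generated G \<longleftrightarrow>
     group G \<and> (\<exists>S. finite S \<and> S \<subseteq> carrier G \<and> generate G S = carrier G)"

definition stable_sequence ::
    "('a, 'm) monoid_scheme \<Rightarrow> ('b, 'n) monoid_scheme \<Rightarrow> (nat \<Rightarrow> 'a \<Rightarrow> 'b) \<Rightarrow> bool" where
  "stable_sequence \<Gamma> F f \<longleftrightarrow>
     (\<forall>i. f i \<in> hom \<Gamma> F) \<and>
     (\<forall>g\<in>carrier \<Gamma>.
        (\<forall>\<^sub>F i in sequentially. g \<in> kernel \<Gamma> F (f i)) \<or>
        (\<forall>\<^sub>F i in sequentially. g \<notin> kernel \<Gamma> F (f i)))"

definition limit_kernel ::
    "('a, 'm) monoid_scheme \<Rightarrow> ('b, 'n) monoid_scheme \<Rightarrow> (nat \<Rightarrow> 'a \<Rightarrow> 'b) \<Rightarrow> 'a set" where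
  "limit_kernel \<Gamma> F f =
     {g \<in> carrier \<Gamma>. \<forall>\<^sub>F i in sequentially. g \<in> kernel \<Gamma> F (f i)}"

text \<open>Finitely generated groups are countable, so \<open>\<Gamma>\<close> may be taken to live on \<^typ>\<open>nat\<close>. Countably
  many homomorphisms out of \<open>\<Gamma>\<close> only involve countably many basis elements of the free group, so
  a basis contained in \<^typ>\<open>nat\<close> (of any rank up to countable) is general as well.\<close>

definition limit_group :: "('a, 'm) monoid_scheme \<Rightarrow> bool" where
  "limit_group L \<longleftrightarrow>
     finitely_generated L \<and>
     (\<exists>(\<Gamma> :: nat monoid) (X :: nat set) f.
        finitely_generated \<Gamma> \<and> stable_sequence \<Gamma> (free_group X) f \<and>
        L \<cong> \<Gamma> Mod limit_kernel \<Gamma> (free_group X) f)"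

section \<open>Generalized doubles\<close>

definition maximal_abelian_subgroup :: "'a set \<Rightarrow> ('a, 'm) monoid_scheme \<Rightarrow> bool" where
  "maximal_abelian_subgroup H G \<longleftrightarrow>
     subgroup H G \<and> comm_group (G\<lparr>carrier := H\<rparr>) \<and>
     (\<forall>K. subgroup K G \<and> comm_group (G\<lparr>carrier := K\<rparr>) \<and> H \<subseteq> K \<longrightarrow> K = H)"

definition double_edge ::
    "('c, 'k) monoid_scheme \<Rightarrow> ('a, 'm) monoid_scheme \<Rightarrow> ('c \<Rightarrow> 'a) \<Rightarrow> bool" where
  "double_edge C A i \<longleftrightarrow> i \<in> mon C A \<and> maximal_abelian_subgroup (i ` carrier C) A"

text \<open>The vertex groups are finitely generated and the edge group embeds in them, so all of them are
  countable and may be taken to live on \<^typ>\<open>nat\<close>. The isomorphism \<open>\<psi>\<close> identifies \<open>M'\<close> with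
  the amalgamated product, respectively the HNN extension.\<close>

definition generalized_double ::
    "('p, 'm) monoid_scheme \<Rightarrow> ('q, 'n) monoid_scheme \<Rightarrow> ('p \<Rightarrow> 'q) \<Rightarrow> bool" where
  "generalized_double M' M \<phi> \<longleftrightarrow>
     group M' \<and> limit_group M \<and> \<phi> \<in> epi M' M \<and>
     ((\<exists>(A :: nat monoid) (B :: nat monoid) (C :: nat monoid) i j.
         finitely_generated A \<and> finitely_generated B \<and>
         comm_group C \<and> carrier C \<noteq> {\<one>\<^bsub>C\<^esub>} \<and>
         double_edge C A i \<and> double_edge C B j \<and>
         (\<exists>\<psi> \<in> iso (amalgam A B C i j) M'.
            inj_on (\<phi> \<circ> \<psi> \<circ> amalgam_inl A B C i j) (carrier A) \<and>
            inj_on (\<phi> \<circ> \<psi> \<circ> amalgam_inr A B C i j) (carrier B))) \<or>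
      (\<exists>(A :: nat monoid) (C :: nat monoid) i j.
         finitely_generated A \<and>
         comm_group C \<and> carrier C \<noteq> {\<one>\<^bsub>C\<^esub>} \<and>
         double_edge C A i \<and> double_edge C A j \<and>
         (\<exists>\<psi> \<in> iso (HNN A C i j) M'.
            inj_on (\<phi> \<circ> \<psi> \<circ> HNN_vertex A C i j) (carrier A))))"

definition double_arrow :: "nat monoid \<Rightarrow> nat monoid \<Rightarrow> bool" where
  "double_arrow M' M \<longleftrightarrow> limit_group M' \<and> limit_group M \<and> (\<exists>\<phi>. generalized_double M' M \<phi>)"

text \<open>The ranks of the finitely generated free groups in which a sequence of generalized doubles
  starting at \<open>L\<close> can end. The sequence starts at a copy \<open>L'\<close> of \<open>L\<close> with carrier in \<^typ>\<open>nat\<close>.\<close>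

definition double_ranks :: "('a, 'm) monoid_scheme \<Rightarrow> nat set" where
  "double_ranks L =
     {r. \<exists>L' F. group L' \<and> L \<cong> L' \<and> double_arrow\<^sup>*\<^sup>* L' F \<and> free_of_rank F r}"

text \<open>For a limit group \<open>L\<close>, \<open>double_ranks L\<close> is nonempty and is bounded by the
  number of generators of \<open>L\<close>, so that this supremum is a maximum.\<close>

definition double_rank :: "('a, 'm) monoid_scheme \<Rightarrow> nat" where
  "double_rank L = Sup (double_ranks L)"

end

theory Submission
  imports Defs
begin

text \<open>
  Say that \<open>M\<close> \<^emph>\<open>embeds densely\<close> if \<open>G\<close> has a subgroup isomorphic to \<open>M\<close> whose closure contains \<open>F\<close>.
  The rank \<open>double_rank L\<close> is attained (\<open>double_rank_attained\<close>), so there is a sequence of generalized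
  doubles \<open>L \<rightarrow> \<dots> \<rightarrow> E\<close> with \<open>E\<close> free of that rank. The proof shows that \<open>E\<close> embeds densely and lifts
  dense embeddings along doubles, from the target \<open>M\<close> to the double \<open>M'\<close>.

  Let \<open>M' \<rightarrow> M\<close> be a double with edge group \<open>C\<close>, and let \<open>M\<close> be a subgroup of \<open>G\<close>. Write \<open>D\<close> for the
  image of \<open>C\<close> in \<open>M\<close> and \<open>Z\<close> for the closure of \<open>D\<close> in \<open>G\<close>. Every \<open>z \<in> Z\<close> centralizes \<open>D\<close>, so the map
  \<open>M' \<rightarrow> M\<close> can be twisted by \<open>z\<close>: conjugate the second vertex group by \<open>z\<close>, or multiply the stable
  letter by \<open>z\<close>. This gives a homomorphism \<open>f\<^sub>z : M' \<rightarrow> G\<close>. Its image contains \<open>D\<close>, so the closure of the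
  image contains \<open>z\<close>; undoing the twist there, it contains \<open>M\<close>, and with it \<open>F\<close>. What is needed is one
  \<open>z\<close> for which \<open>f\<^sub>z\<close> is injective, and a generic \<open>z\<close> does it (\<open>generic_embedding\<close>): by the Baire category
  theorem it suffices that for \<open>x \<noteq> 1\<close> the closed set of all \<open>z \<in> Z\<close> with \<open>f\<^sub>z x = 1\<close> has empty interior. An
  open subset of \<open>Z\<close> meets \<open>D\<close> in some \<open>y\<close>, and for every \<open>c \<in> D\<close> it contains \<open>y c\<^sup>n\<close> for infinitely many
  \<open>n\<close>, because powers in a compact group recur (\<open>powers_recur\<close>). On the other hand \<open>f\<^sub>z x\<close> at \<open>z = y c\<^sup>n\<close>
  is a word in \<open>M\<close> in which neighbouring powers \<open>c\<^sup>n\<close> and \<open>c\<^sup>-\<^sup>n\<close> of opposite sign are separated by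
  elements that do not commute with \<open>c\<close>: this is what it means for \<open>x\<close> to be written in reduced form, since \<open>C\<close> is maximal abelian and
  commutation is a transitive relation on the nontrivial elements of \<open>M\<close>
  (\<open>maximal_abelian_separates\<close>). Such a word is trivial for only finitely many \<open>n\<close>; this property of
  limit groups is called \<open>power_separated\<close> below.

  To see that limit groups have this property, represent them approximately in \<open>SL\<^sub>2(\<real>)\<close>. A free group
  has, for each finite set of its nontrivial elements, a representation making all of them hyperbolic
  (\<open>free_group_hyperbolic_hom\<close>). Hence if \<open>L = \<Gamma> / K\<close> is a limit group, every finite subset of \<open>\<Gamma>\<close> has
  a representation of \<open>\<Gamma>\<close> that kills its elements from \<open>K\<close> and makes the others hyperbolic
  (\<open>limit_group_hyperbolic_cover\<close>). For a hyperbolic matrix \<open>c\<close> with eigenvalues \<open>l, 1/l\<close> one has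
  \<open>c\<^sup>n = l\<^sup>n P + l\<^sup>-\<^sup>n (1 - P)\<close> with a projection \<open>P\<close> of rank one. Up to a power of \<open>l\<^sup>n\<close>, a word with
  \<open>k\<close> powers of \<open>c\<close> is a polynomial in \<open>l\<^sup>-\<^sup>n\<close> of degree at most \<open>2k\<close>, whose constant term is nonzero as
  soon as neighbouring powers do not cancel. So it takes a given value at most \<open>2k\<close> times. It is important
  that this bound depends on \<open>k\<close> alone: the representation changes with the finite set, hence with the
  exponents \<open>n\<close> under consideration, and only a uniform bound passes to the limit.

  Finally, a free subgroup of rank \<open>m \<ge> 2\<close> can be enlarged to one of rank \<open>m + 1\<close> with the same argument
  (\<open>free_rank_step\<close>), a generic element of its closure being the new generator. This leads from the
  given \<open>F\<close> of rank \<open>r\<close> to a dense embedding of \<open>E\<close>.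
\<close>

section \<open>Two by two real matrices\<close>

text \<open>The matrices form a type of their own because they are then an instance of \<^class>\<open>real_algebra_1\<close>,
  so that ring normalization and powers apply to matrix products.\<close>

datatype m2 = M2 (e11: real) (e12: real) (e21: real) (e22: real)

instantiation m2 :: real_algebra_1
begin
definition "0 = M2 0 0 0 0"
definition "1 = M2 1 0 0 1"
definition "A + B = M2 (e11 A + e11 B) (e12 A + e12 B) (e21 A + e21 B) (e22 A + e22 B)" for A B :: m2
definition "A - B = M2 (e11 A - e11 B) (e12 A - e12 B) (e21 A - e21 B) (e22 A - e22 B)" for A B :: m2
definition "- A = M2 (- e11 A) (- e12 A) (- e21 A) (- e22 A)" for A :: m2
definition "A * B = M2 (e11 A * e11 B + e12 A * e21 B) (e11 A * e12 B + e12 A * e22 B)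
                       (e21 A * e11 B + e22 A * e21 B) (e21 A * e12 B + e22 A * e22 B)" for A B :: m2
definition "c *\<^sub>R A = M2 (c * e11 A) (c * e12 A) (c * e21 A) (c * e22 A)" for A :: m2
lemmas m2_defs = zero_m2_def one_m2_def plus_m2_def minus_m2_def uminus_m2_def times_m2_def
  scaleR_m2_def
instance by standard (auto simp: m2_defs m2.expand algebra_simps intro!: m2.expand)
end

lemma m2_entries [simp]:
  "e11 0 = 0" "e12 0 = 0" "e21 0 = 0" "e22 0 = 0"
  "e11 1 = 1" "e12 1 = 0" "e21 1 = 0" "e22 1 = 1"
  "e11 (A + B) = e11 A + e11 B" "e12 (A + B) = e12 A + e12 B"
  "e21 (A + B) = e21 A + e21 B" "e22 (A + B) = e22 A + e22 B"
  "e11 (A - B) = e11 A - e11 B" "e12 (A - B) = e12 A - e12 B"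
  "e21 (A - B) = e21 A - e21 B" "e22 (A - B) = e22 A - e22 B"
  "e11 (A * B) = e11 A * e11 B + e12 A * e21 B" "e12 (A * B) = e11 A * e12 B + e12 A * e22 B"
  "e21 (A * B) = e21 A * e11 B + e22 A * e21 B" "e22 (A * B) = e21 A * e12 B + e22 A * e22 B"
  "e11 (c *\<^sub>R A) = c * e11 A" "e12 (c *\<^sub>R A) = c * e12 A"
  "e21 (c *\<^sub>R A) = c * e21 A" "e22 (c *\<^sub>R A) = c * e22 A"
  by (simp_all add: m2_defs)

lemma m2_eqI: "e11 A = e11 B \<Longrightarrow> e12 A = e12 B \<Longrightarrow> e21 A = e21 B \<Longrightarrow> e22 A = e22 B \<Longrightarrow> A = B"
  by (rule m2.expand) auto

definition tr2 :: "m2 \<Rightarrow> real" where "tr2 A = e11 A + e22 A"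
definition det2 :: "m2 \<Rightarrow> real" where "det2 A = e11 A * e22 A - e12 A * e21 A"
definition adj2 :: "m2 \<Rightarrow> m2" where "adj2 A = M2 (e22 A) (- e12 A) (- e21 A) (e11 A)"

lemma tr2_linear [simp]:
  "tr2 (A + B) = tr2 A + tr2 B" "tr2 (A - B) = tr2 A - tr2 B" "tr2 (c *\<^sub>R A) = c * tr2 A"
  "tr2 0 = 0" "tr2 1 = 2"
  by (simp_all add: tr2_def algebra_simps)

lemma tr2_mult_commute: "tr2 (A * B) = tr2 (B * A)"
  by (simp add: tr2_def algebra_simps)

lemma det2_mult: "det2 (A * B) = det2 A * det2 B"
  by (simp add: det2_def algebra_simps)

lemma det2_one [simp]: "det2 1 = 1" by (simp add: det2_def)

lemma adj2_inverse: "det2 A = 1 \<Longrightarrow> A * adj2 A = 1" "det2 A = 1 \<Longrightarrow> adj2 A * A = 1"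
  by (auto simp: det2_def adj2_def algebra_simps intro!: m2_eqI)

lemma det2_adj2 [simp]: "det2 (adj2 A) = det2 A"
  by (simp add: det2_def adj2_def)

definition SL2 :: "m2 monoid" where
  "SL2 = \<lparr>carrier = {A. det2 A = 1}, mult = (*), one = 1\<rparr>"

lemma SL2_simps [simp]:
  "x \<in> carrier SL2 \<longleftrightarrow> det2 x = 1" "x \<otimes>\<^bsub>SL2\<^esub> y = x * y" "\<one>\<^bsub>SL2\<^esub> = 1"
  by (simp_all add: SL2_def)

lemma group_SL2: "group SL2"
  by (rule groupI) (auto simp: det2_mult mult.assoc intro: exI[of _ "adj2 _"] adj2_inverse)

lemma inv_SL2: "det2 A = 1 \<Longrightarrow> inv\<^bsub>SL2\<^esub> A = adj2 A"
  using group.inv_equality[OF group_SL2, of "adj2 A" A] by (simp add: adj2_inverse)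

lemma tr2_conjugate: "det2 A = 1 \<Longrightarrow> tr2 (A * B * adj2 A) = tr2 B"
  by (metis adj2_inverse(2) mult.assoc mult_1 tr2_mult_commute)

text \<open>A singular \<open>P\<close> has the form \<open>u v\<^sup>T\<close>, and \<open>A P B = (A u) (v\<^sup>T B)\<close> is then the outer product of two
  nonzero vectors.\<close>

lemma singular_product_nonzero:
  assumes "det2 P = 0" "A * P \<noteq> 0" "P * B \<noteq> 0"
  shows "A * P * B \<noteq> 0"
proof -
  obtain a b c d where P: "P = M2 (a*c) (a*d) (b*c) (b*d)"
  proof (cases "e11 P = 0 \<and> e12 P = 0")
    case True
    show ?thesis by (rule that[where a = 0 and b = 1 and c = "e21 P" and d = "e22 P"]) (use True in \<open>auto intro!: m2_eqI\<close>)
  next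
    case False
    show ?thesis
    proof (cases "e11 P = 0")
      case True
      with False assms(1) have "e21 P = 0" by (auto simp: det2_def)
      with True show ?thesis by (intro that[where a = "e12 P" and b = "e22 P" and c = 0 and d = 1]) (auto intro!: m2_eqI)
    next
      case False
      with assms(1) show ?thesis
        by (intro that[where a = "e11 P" and b = "e21 P" and c = 1 and d = "e12 P / e11 P"])
          (auto intro!: m2_eqI simp: det2_def field_simps)
    qed
  qed
  define x y z w where "x = e11 A * a + e12 A * b" "y = e21 A * a + e22 A * b"
    "z = c * e11 B + d * e21 B" "w = c * e12 B + d * e22 B"
  have AP: "A * P = M2 (x*c) (x*d) (y*c) (y*d)" and PB: "P * B = M2 (a*z) (a*w) (b*z) (b*w)"
    and APB: "A * P * B = M2 (x*z) (x*w) (y*z) (y*w)"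
    by (auto intro!: m2_eqI simp: P x_y_z_w_def algebra_simps)
  have "x \<noteq> 0 \<or> y \<noteq> 0" using assms(2) unfolding AP zero_m2_def by auto
  moreover have "z \<noteq> 0 \<or> w \<noteq> 0" using assms(3) unfolding PB zero_m2_def by auto
  ultimately show ?thesis unfolding APB zero_m2_def by auto
qed

text \<open>The entries are polynomial functions of degree at most \<open>d\<close>. A common bound, instead of the exact
  degree, is what products and the count of roots need.\<close>

definition poly_mat :: "nat \<Rightarrow> (real \<Rightarrow> m2) \<Rightarrow> bool" where
  "poly_mat d F \<longleftrightarrow> (\<forall>e \<in> {e11, e12, e21, e22}. \<exists>p. degree p \<le> d \<and> (\<forall>x. e (F x) = poly p x))"

lemma poly_mat_const: "poly_mat d (\<lambda>_. A)"
  unfolding poly_mat_def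
proof
  fix e assume "e \<in> {e11, e12, e21, e22}"
  show "\<exists>p. degree p \<le> d \<and> (\<forall>x. e A = poly p x)" by (rule exI[of _ "[:e A:]"]) auto
qed

lemma poly_mat_mult:
  assumes "poly_mat d F" "poly_mat d' G"
  shows "poly_mat (d + d') (\<lambda>x. F x * G x)"
proof -
  have *: "\<exists>p. degree p \<le> d + d' \<and> (\<forall>x. e (F x) * f (G x) + e' (F x) * f' (G x) = poly p x)"
    if mem: "e \<in> {e11, e12, e21, e22}" "e' \<in> {e11, e12, e21, e22}"
      "f \<in> {e11, e12, e21, e22}" "f' \<in> {e11, e12, e21, e22}" for e e' f f'
  proof -
    obtain p p' q q' where
      "degree p \<le> d \<and> (\<forall>x. e (F x) = poly p x)" "degree p' \<le> d \<and> (\<forall>x. e' (F x) = poly p' x)"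
      "degree q \<le> d' \<and> (\<forall>x. f (G x) = poly q x)" "degree q' \<le> d' \<and> (\<forall>x. f' (G x) = poly q' x)"
      using assms mem unfolding poly_mat_def by meson
    then show ?thesis
      by (intro exI[of _ "p * q + p' * q'"])
        (auto intro!: degree_add_le order_trans[OF degree_mult_le])
  qed
  show ?thesis unfolding poly_mat_def using *[of e11 e12 e11 e21] *[of e11 e12 e12 e22]
      *[of e21 e22 e11 e21] *[of e21 e22 e12 e22] by auto
qed

text \<open>If \<open>c = l P + (1/l) (1 - P)\<close> for a projection \<open>P\<close>, then \<open>c\<^sup>n = l\<^sup>n\<close> times the pencil of \<open>P\<close> at
  \<open>x = l\<^sup>-\<^sup>n\<close>. In the limit \<open>x = 0\<close> only the projection remains.\<close>

definition pencil :: "m2 \<Rightarrow> real \<Rightarrow> m2" where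
  "pencil P x = P + x\<^sup>2 *\<^sub>R (1 - P)"

lemma pencil_zero [simp]: "pencil P 0 = P" by (simp add: pencil_def)

lemma poly_mat_pencil: "poly_mat 2 (pencil P)"
proof -
  have *: "\<exists>p. degree p \<le> 2 \<and> (\<forall>x. a + x\<^sup>2 * b = poly p x)" for a b :: real
    by (rule exI[of _ "[:a, 0, b:]"]) (auto simp: power2_eq_square)
  show ?thesis using *[of _ "1 - _"] *[of _ "- _"] by (auto simp: poly_mat_def pencil_def)
qed

lemma poly_mat_tendsto_tr2:
  assumes "poly_mat d F"
  shows "((\<lambda>x. tr2 (F x)) \<longlongrightarrow> tr2 (F 0)) (at_right 0)"
proof -
  obtain p q where "\<And>x. e11 (F x) = poly p x" "\<And>x. e22 (F x) = poly q x"
    using assms unfolding poly_mat_def by blast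
  then show ?thesis by (auto simp: tr2_def intro!: tendsto_intros)
qed

text \<open>Since \<open>k > 0\<close>, the right-hand side vanishes at \<open>x = 0\<close>, where the left-hand side does not. So some
  entry of the equation is a nonzero polynomial of degree at most \<open>d\<close>.\<close>

lemma poly_mat_roots:
  assumes F: "poly_mat d F" and h: "F 0 \<noteq> 0" and "0 < k" "k \<le> d"
  shows "finite {x. F x = x^k *\<^sub>R H} \<and> card {x. F x = x^k *\<^sub>R H} \<le> d"
proof -
  from h obtain e where e: "e \<in> {e11, e12, e21, e22}" "e (F 0) \<noteq> 0"
    using m2_eqI[of "F 0" 0] by auto
  then obtain p where p: "degree p \<le> d" "\<And>x. e (F x) = poly p x"
    using F unfolding poly_mat_def by blast
  define q where "q = p - monom (e H) k"
  have "poly q 0 = e (F 0)" using \<open>0 < k\<close> by (simp add: q_def p poly_monom)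
  then have q: "q \<noteq> 0" using e by auto
  have sub: "{x. F x = x^k *\<^sub>R H} \<subseteq> {x. poly q x = 0}"
    using e(1) by (auto simp: q_def poly_monom simp flip: p(2))
  have "degree q \<le> d" unfolding q_def
    using p(1) \<open>k \<le> d\<close> by (intro degree_diff_le) (auto intro: order_trans[OF degree_monom_le])
  moreover have "card {x. F x = x^k *\<^sub>R H} \<le> card {x. poly q x = 0}"
    using sub poly_roots_finite[OF q] by (rule card_mono[rotated])
  moreover note card_poly_roots_bound[OF q]
  ultimately show ?thesis using finite_subset[OF sub poly_roots_finite[OF q]] by linarith
qed

section \<open>Words in powers of a hyperbolic matrix\<close>

text \<open>A sign, as in the letters of words over a presentation, stands for an exponent \<open>1\<close> or \<open>-1\<close>.\<close>

definition zpow :: "('a, 'm) monoid_scheme \<Rightarrow> 'a \<Rightarrow> bool \<Rightarrow> 'a" where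
  "zpow H z e = (if e then z else inv\<^bsub>H\<^esub> z)"

text \<open>Words in a variable \<open>z\<close> with coefficients in a group: the triple \<open>(\<alpha>, e, \<beta>)\<close> stands for
  \<open>\<alpha> z\<^sup>e \<beta>\<close>. Two coefficients per occurrence of \<open>z\<close> make the substitution \<open>z \<mapsto> y z\<close> a
  letterwise operation, for both signs. Between neighbouring letters \<open>(\<alpha>, e, \<beta>)\<close> and \<open>(\<alpha>', e', \<beta>')\<close>
  stands \<open>\<beta> \<alpha>'\<close>, and conditions against cancellation concern this product.\<close>

definition zeval :: "('a, 'm) monoid_scheme \<Rightarrow> 'a \<Rightarrow> ('a \<times> bool \<times> 'a) list \<Rightarrow> 'a" where
  "zeval H z ws =
     foldr (\<lambda>(\<alpha>, e, \<beta>) y. \<alpha> \<otimes>\<^bsub>H\<^esub> zpow H z e \<otimes>\<^bsub>H\<^esub> \<beta> \<otimes>\<^bsub>H\<^esub> y) ws \<one>\<^bsub>H\<^esub>"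

lemma zeval_Nil [simp]: "zeval H z [] = \<one>\<^bsub>H\<^esub>"
  and zeval_Cons [simp]: "zeval H z ((\<alpha>, e, \<beta>) # ws) =
     \<alpha> \<otimes>\<^bsub>H\<^esub> zpow H z e \<otimes>\<^bsub>H\<^esub> \<beta> \<otimes>\<^bsub>H\<^esub> zeval H z ws"
  by (simp_all add: zeval_def)

text \<open>The two eigenprojections of a hyperbolic matrix, for the eigenvalues \<open>l\<close> and \<open>1/l\<close>. Inverting the
  matrix swaps them.\<close>

definition proj_sign :: "m2 \<Rightarrow> bool \<Rightarrow> m2" where
  "proj_sign P e = (if e then P else 1 - P)"

lemma tr_one_singular:
  assumes "det2 P = 0" "tr2 P = 1"
  shows "P * P = P" "det2 (1 - P) = 0" "tr2 (1 - P) = 1" "P * A * P = tr2 (P * A) *\<^sub>R P"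
proof -
  have s: "e22 P = 1 - e11 P" using assms by (simp add: tr2_def)
  have d: "e12 P * e21 P = e11 P * (1 - e11 P)" using assms(1) by (simp add: det2_def s)
  show "P * P = P" using d by (intro m2_eqI) (simp_all add: s algebra_simps)
  show "det2 (1 - P) = 0" using d by (simp add: det2_def s algebra_simps)
  show "tr2 (1 - P) = 1" using assms by simp
  have "x * (e12 P * e21 P) = x * (e11 P * (1 - e11 P))" for x
    using d by simp
  from this[of "e11 A"] this[of "e12 A"] this[of "e21 A"] this[of "e22 A"]
  show "P * A * P = tr2 (P * A) *\<^sub>R P"
    by (intro m2_eqI) (simp_all add: tr2_def s algebra_simps)
qed

lemma hyperbolic_split:
  assumes "det2 C = 1" "\<bar>tr2 C\<bar> > 2"
  obtains l P where "\<bar>l\<bar> > 1" "det2 P = 0" "tr2 P = 1" "C = l *\<^sub>R P + (1/l) *\<^sub>R (1 - P)"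
proof -
  define t where "t = tr2 C"
  have t4: "t\<^sup>2 > 4"
    using power_strict_mono[OF assms(2), of 2] by (simp add: t_def)
  define s where "s = sqrt (t\<^sup>2 - 4)"
  have s: "s > 0" "s\<^sup>2 = t\<^sup>2 - 4" using t4 by (auto simp: s_def)
  \<comment> \<open>The root of \<open>l\<^sup>2 - t l + 1\<close> outside the unit interval.\<close>
  define l where "l = (if t > 0 then (t + s) / 2 else (t - s) / 2)"
  have l1: "\<bar>l\<bar> > 1" using s(1) assms(2) by (auto simp: l_def t_def[symmetric] abs_if split: if_splits)
  have "l\<^sup>2 - t * l + 1 = 0"
    using s(2) by (auto simp: l_def power2_eq_square field_simps)
  then have lt: "l + 1/l = t" using l1 by (auto simp: field_simps power2_eq_square)
  define m where "m = 1/l"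
  have lm: "l * m = 1" "l + m = t" "l - m \<noteq> 0"
  proof -
    show lm1: "l * m = 1" using l1 by (auto simp: m_def)
    show "l + m = t" using lt m_def by simp
    show "l - m \<noteq> 0"
    proof
      assume "l - m = 0"
      then have "\<bar>l\<bar> * \<bar>l\<bar> = 1" using lm1 by simp
      then show False using l1 less_1_mult[of "\<bar>l\<bar>" "\<bar>l\<bar>"] by linarith
    qed
  qed
  define D where "D = 1 / (l - m)"
  have D: "D * (l - m) = 1" using lm by (simp add: D_def)
  define P where "P = D *\<^sub>R (C - m *\<^sub>R 1)"
  have dC: "e11 C * e22 C - e12 C * e21 C = 1" using assms by (simp add: det2_def)
  have tC: "e11 C + e22 C = l + m" using lm by (simp add: t_def tr2_def)
  have "det2 P = D * D * (e11 C * e22 C - e12 C * e21 C - m * (e11 C + e22 C) + m * m)"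
    by (simp add: P_def det2_def algebra_simps)
  also have "\<dots> = D * D * (1 - l * m)" unfolding dC tC by (simp add: algebra_simps)
  finally have "det2 P = 0" using lm(1) by simp
  moreover have "tr2 P = D * (e11 C + e22 C - 2 * m)" by (simp add: P_def tr2_def algebra_simps)
  then have "tr2 P = 1" using D unfolding tC by (simp add: algebra_simps)
  moreover have "C = l *\<^sub>R P + m *\<^sub>R (1 - P)"
  proof -
    have "l *\<^sub>R P + m *\<^sub>R (1 - P) = (l - m) *\<^sub>R P + m *\<^sub>R 1" by (simp add: algebra_simps)
    also have "(l - m) *\<^sub>R P = C - m *\<^sub>R 1" using D by (simp add: P_def mult.commute)
    finally show ?thesis by simp
  qed
  ultimately show ?thesis using that[OF l1] by (simp add: m_def)
qed

definition sgn_pow :: "m2 \<Rightarrow> bool \<Rightarrow> m2" where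
  "sgn_pow C e = (if e then C else adj2 C)"

lemma zpow_SL2: "det2 C = 1 \<Longrightarrow> zpow SL2 C e = sgn_pow C e"
  by (simp add: zpow_def sgn_pow_def inv_SL2)

lemma adj2_tr_one:
  assumes "tr2 P = 1"
  shows "adj2 (a *\<^sub>R P + b *\<^sub>R (1 - P)) = a *\<^sub>R (1 - P) + b *\<^sub>R P"
proof -
  have s: "e22 P = 1 - e11 P" using assms by (simp add: tr2_def)
  show ?thesis by (intro m2_eqI) (simp_all add: s adj2_def algebra_simps)
qed

lemma sgn_pow_split:
  assumes "tr2 P = 1"
  shows "sgn_pow (a *\<^sub>R P + b *\<^sub>R (1 - P)) e
    = a *\<^sub>R proj_sign P e + b *\<^sub>R (1 - proj_sign P e)"
  using assms by (auto simp: sgn_pow_def proj_sign_def adj2_tr_one add.commute)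

lemma split_power:
  assumes "det2 P = 0" "tr2 P = 1"
  shows "(a *\<^sub>R P + b *\<^sub>R (1 - P)) ^ n = (a ^ n) *\<^sub>R P + (b ^ n) *\<^sub>R (1 - P)"
proof (induction n)
  case (Suc n)
  have "(1 - P) * P = 0" "P * (1 - P) = 0" "(1 - P) * (1 - P) = 1 - P"
    using tr_one_singular(1)[OF assms] by (auto simp: algebra_simps)
  then show ?case using tr_one_singular(1)[OF assms]
    by (simp only: power_Suc Suc ring_distribs mult_scaleR_left mult_scaleR_right)
      (simp add: algebra_simps)
qed simp

text \<open>If the leading terms of \<open>c\<^sup>e\<close> and \<open>c\<^sup>e\<^sup>'\<close> annihilate each other across \<open>g\<close>, then \<open>g\<close> carries an
  eigenline of \<open>c\<^sup>e\<^sup>'\<close> to one of \<open>c\<^sup>-\<^sup>e\<close> with the same eigenvalue. So \<open>g c\<^sup>e\<^sup>' g\<^sup>-\<^sup>1 c\<^sup>e\<close> has the eigenvalue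
  \<open>1\<close>, which shows in its trace. In a group where only the identity has trace \<open>2\<close>, this happens only
  for the obvious reason \<open>g c\<^sup>e\<^sup>' g\<^sup>-\<^sup>1 = c\<^sup>-\<^sup>e\<close>.\<close>

lemma singular_junction_trace:
  assumes P: "det2 P = 0" "tr2 P = 1" and C: "C = l *\<^sub>R P + (1/l) *\<^sub>R (1 - P)" "l \<noteq> 0"
    and g: "det2 g = 1" and z: "proj_sign P e * g * proj_sign P e' = 0"
  shows "tr2 (g * sgn_pow C e' * adj2 g * sgn_pow C e) = 2"
proof -
  define Q Q' where "Q = proj_sign P e" and "Q' = proj_sign P e'"
  have tQ: "tr2 Q = 1" "tr2 Q' = 1" using P by (auto simp: Q_def Q'_def proj_sign_def)
  define E where "E = g * Q' * adj2 g"
  have "Q * E = 0" using z by (simp add: E_def Q_def Q'_def flip: mult.assoc)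
  then have EQ: "tr2 (E * Q) = 0" by (simp add: tr2_mult_commute[of E Q])
  have tE: "tr2 E = 1" unfolding E_def using tr2_conjugate[OF g] tQ by simp
  have s: "sgn_pow C e = l *\<^sub>R Q + (1/l) *\<^sub>R (1 - Q)" "sgn_pow C e' = l *\<^sub>R Q' + (1/l) *\<^sub>R (1 - Q')"
    using sgn_pow_split[OF P(2)] by (auto simp: C Q_def Q'_def)
  have "g * (1 - Q') * adj2 g = 1 - E"
    using adj2_inverse[OF g] by (simp add: E_def algebra_simps)
  then have "g * sgn_pow C e' * adj2 g = l *\<^sub>R E + (1/l) *\<^sub>R (1 - E)"
    unfolding s E_def by (simp add: distrib_left distrib_right)
  then have "g * sgn_pow C e' * adj2 g * sgn_pow C e
     = (l *\<^sub>R E + (1/l) *\<^sub>R (1 - E)) * (l *\<^sub>R Q + (1/l) *\<^sub>R (1 - Q))" by (simp only: s)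
  also have "tr2 \<dots> = l * l * tr2 (E * Q) + tr2 (E * (1 - Q)) + tr2 ((1 - E) * Q)
     + (1/l) * (1/l) * tr2 ((1 - E) * (1 - Q))"
    using C(2) by (simp add: distrib_left distrib_right)
  also have "\<dots> = 2" using EQ tE tQ by (simp add: algebra_simps)
  finally show ?thesis .
qed

text \<open>The word \<open>ws\<close> at the \<open>n\<close>-th power of a hyperbolic matrix, rescaled by \<open>l\<^sup>-\<^sup>n\<close> for each letter and
  seen as a function of \<open>x = l\<^sup>-\<^sup>n\<close>.\<close>

definition pencil_product :: "m2 \<Rightarrow> (m2 \<times> bool \<times> m2) list \<Rightarrow> real \<Rightarrow> m2" where
  "pencil_product P ws x = foldr (\<lambda>(\<alpha>, e, \<beta>) y. \<alpha> * pencil (proj_sign P e) x * \<beta> * y) ws 1"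

lemma poly_mat_pencil_product: "poly_mat (2 * length ws) (pencil_product P ws)"
proof (induction ws)
  case Nil then show ?case using poly_mat_const[of 0 1] by (simp add: pencil_product_def)
next
  case (Cons w ws)
  obtain \<alpha> e \<beta> where w: "w = (\<alpha>, e, \<beta>)" by (metis prod_cases3)
  have "poly_mat (0 + 2 + 0 + 2 * length ws)
     (\<lambda>x. \<alpha> * pencil (proj_sign P e) x * \<beta> * pencil_product P ws x)"
    by (intro poly_mat_mult Cons poly_mat_pencil poly_mat_const)
  then show ?case by (simp add: pencil_product_def w)
qed

text \<open>At \<open>x = 0\<close> the product consists of rank one projections separated by invertible matrices. It is
  nonzero if consecutive projections do not annihilate each other, by \<open>singular_product_nonzero\<close>.\<close>

lemma pencil_product_nonzero:
  assumes P: "det2 P = 0" "tr2 P = 1" "C = l *\<^sub>R P + (1/l) *\<^sub>R (1 - P)" "l \<noteq> 0"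
    and "ws \<noteq> []" and "\<forall>(\<alpha>, e, \<beta>) \<in> set ws. det2 \<alpha> = 1 \<and> det2 \<beta> = 1"
    and "successively (\<lambda>(\<alpha>, e, \<beta>) (\<alpha>', e', \<beta>').
        tr2 (\<beta> * \<alpha>' * sgn_pow C e' * adj2 (\<beta> * \<alpha>') * sgn_pow C e) \<noteq> 2) ws"
  shows "pencil_product P ws 0 \<noteq> 0"
proof -
  have unit: "A = 0" if "det2 B = 1" "A * B = 0 \<or> B * A = 0" for A B
    using adj2_inverse[OF that(1)] that(2)
    by (metis mult.assoc mult.right_neutral mult_1 mult_zero_left mult_zero_right)
  have sgn: "det2 (proj_sign P e) = 0" "tr2 (proj_sign P e) = 1" for e
    using tr_one_singular[OF P(1,2)] P by (auto simp: proj_sign_def)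
  have "proj_sign P (fst (snd w)) * (snd (snd w) * pencil_product P ws 0) \<noteq> 0"
    if "\<forall>(\<alpha>, e, \<beta>) \<in> set (w # ws). det2 \<alpha> = 1 \<and> det2 \<beta> = 1"
    "successively (\<lambda>(\<alpha>, e, \<beta>) (\<alpha>', e', \<beta>').
        tr2 (\<beta> * \<alpha>' * sgn_pow C e' * adj2 (\<beta> * \<alpha>') * sgn_pow C e) \<noteq> 2) (w # ws)" for w ws
    using that
  proof (induction ws arbitrary: w)
    case Nil
    have "proj_sign P (fst (snd w)) \<noteq> 0" using sgn(2) by (metis tr2_linear(4) zero_neq_one)
    then show ?case using unit Nil by (auto simp: pencil_product_def split: prod.splits)
  next
    case (Cons w' ws)
    obtain \<alpha> e \<beta> \<alpha>' e' \<beta>' where w: "w = (\<alpha>, e, \<beta>)" "w' = (\<alpha>', e', \<beta>')" by (metis prod_cases3)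
    have IH: "proj_sign P e' * (\<beta>' * pencil_product P ws 0) \<noteq> 0"
      using Cons.IH[of w'] Cons.prems w by auto
    have "proj_sign P e * (\<beta> * \<alpha>') * proj_sign P e' \<noteq> 0"
      using singular_junction_trace[OF P(1,2,3,4), of "\<beta> * \<alpha>'" e e'] Cons.prems w
      by (auto simp: det2_mult)
    from singular_product_nonzero[OF sgn(1) this IH] show ?case
      by (simp add: w pencil_product_def mult.assoc)
  qed
  moreover obtain \<alpha> e \<beta> ws' where ws: "ws = (\<alpha>, e, \<beta>) # ws'"
    using \<open>ws \<noteq> []\<close> by (metis list.exhaust prod_cases3)
  ultimately have "proj_sign P e * (\<beta> * pencil_product P ws' 0) \<noteq> 0" using assms(6,7) by fastforce
  moreover have "det2 \<alpha> = 1" using assms(6) ws by auto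
  moreover have "pencil_product P ws 0 = \<alpha> * (proj_sign P e * (\<beta> * pencil_product P ws' 0))"
    by (simp add: ws pencil_product_def mult.assoc)
  ultimately show ?thesis using unit by metis
qed

lemma zeval_SL2_power:
  assumes P: "det2 P = 0" "tr2 P = 1" "C = l *\<^sub>R P + (1/l) *\<^sub>R (1 - P)" "l \<noteq> 0" "det2 C = 1"
  shows "zeval SL2 (C ^ n) ws = (l ^ n) ^ length ws *\<^sub>R pencil_product P ws ((1/l) ^ n)"
proof -
  have d: "det2 (C ^ n) = 1" using P(5) by (induction n) (auto simp: det2_mult)
  have C: "C ^ n = (l ^ n) *\<^sub>R P + ((1/l) ^ n) *\<^sub>R (1 - P)" 
    unfolding P(3) by (rule split_power[OF P(1,2)])
  have p: "zpow SL2 (C ^ n) e = (l ^ n) *\<^sub>R pencil (proj_sign P e) ((1/l) ^ n)" for e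
  proof -
    have "l ^ n * ((1/l) ^ n)\<^sup>2 = (1/l) ^ n" using P(4) by (simp add: power2_eq_square field_simps)
    then show ?thesis unfolding zpow_SL2[OF d] pencil_def scaleR_add_right scaleR_scaleR
      by (simp add: C sgn_pow_split[OF P(2)])
  qed
  show ?thesis by (induction ws) (auto simp: pencil_product_def p mult.assoc)
qed

text \<open>The powers \<open>l\<^sup>-\<^sup>n\<close> are distinct, so the exponents inject into the roots of a nonzero polynomial of
  degree at most \<open>2 * length ws\<close>.\<close>

theorem power_word_bound_SL2:
  assumes C: "det2 C = 1" "\<bar>tr2 C\<bar> > 2" and ws: "ws \<noteq> []"
    "\<forall>(\<alpha>, e, \<beta>) \<in> set ws. det2 \<alpha> = 1 \<and> det2 \<beta> = 1"
    "successively (\<lambda>(\<alpha>, e, \<beta>) (\<alpha>', e', \<beta>').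
        tr2 (\<beta> * \<alpha>' * sgn_pow C e' * adj2 (\<beta> * \<alpha>') * sgn_pow C e) \<noteq> 2) ws"
  shows "finite {n. zeval SL2 (C ^ n) ws = H} \<and> card {n. zeval SL2 (C ^ n) ws = H} \<le> 2 * length ws"
proof -
  obtain l P where l: "\<bar>l\<bar> > 1" and P: "det2 P = 0" "tr2 P = 1" "C = l *\<^sub>R P + (1/l) *\<^sub>R (1 - P)"
    using hyperbolic_split[OF C] .
  then have l0: "l \<noteq> 0" by auto
  let ?k = "length ws" and ?F = "pencil_product P ws"
  let ?R = "{x. ?F x = x ^ ?k *\<^sub>R H}"
  have R: "finite ?R \<and> card ?R \<le> 2 * ?k"
    by (rule poly_mat_roots[OF poly_mat_pencil_product
          pencil_product_nonzero[OF P(1,2,3) l0 ws]]) (use ws in auto)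
  have inj: "inj (\<lambda>n. (1/l) ^ n)"
  proof (rule injI)
    fix m n assume "(1/l) ^ m = (1/l) ^ n"
    then have "\<bar>l\<bar> ^ m = \<bar>l\<bar> ^ n" using l0 by (simp add: field_simps flip: power_abs)
    then show "m = n" using power_inject_exp[of "\<bar>l\<bar>"] l by blast
  qed
  have "(1/l) ^ n \<in> ?R" if "zeval SL2 (C ^ n) ws = H" for n
  proof -
    have H: "H = (l ^ n) ^ ?k *\<^sub>R ?F ((1/l) ^ n)"
      using that zeval_SL2_power[OF P l0 C(1), of n ws] by metis
    have "((1/l) ^ n) ^ ?k *\<^sub>R H = (((1/l) ^ n) ^ ?k * (l ^ n) ^ ?k) *\<^sub>R ?F ((1/l) ^ n)"
      by (subst H) simp
    also have "((1/l) ^ n) ^ ?k * (l ^ n) ^ ?k = 1" using l0 by (simp flip: power_mult_distrib)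
    finally show ?thesis by simp
  qed
  then have sub: "(\<lambda>n. (1/l) ^ n) ` {n. zeval SL2 (C ^ n) ws = H} \<subseteq> ?R" by auto
  have fin: "finite {n. zeval SL2 (C ^ n) ws = H}"
    using finite_imageD[OF finite_subset[OF sub] inj_on_subset[OF inj subset_UNIV]] R by blast
  have "card {n. zeval SL2 (C ^ n) ws = H} \<le> card ?R"
    using card_mono[OF _ sub] R card_image[OF inj_on_subset[OF inj subset_UNIV]] by fastforce
  then show ?thesis using R fin by linarith
qed

text \<open>A matrix commuting with \<open>C\<close> commutes with its eigenprojection \<open>P\<close>, hence is a combination of \<open>P\<close>
  and \<open>1 - P\<close>; such combinations commute.\<close>

lemma hyperbolic_centralizer_commutes:
  assumes C: "det2 C = 1" "\<bar>tr2 C\<bar> > 2" and "A * C = C * A" "B * C = C * B"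
  shows "A * B = B * A"
proof -
  obtain l P where l: "\<bar>l\<bar> > 1" and P: "det2 P = 0" "tr2 P = 1" "C = l *\<^sub>R P + (1/l) *\<^sub>R (1 - P)"
    using hyperbolic_split[OF C] .
  have l2: "l - 1/l \<noteq> 0"
  proof
    assume "l - 1/l = 0"
    then have "l * l = 1" using l by (auto simp: field_simps)
    then show False using less_1_mult[OF l l] by simp
  qed
  have CP: "C = (l - 1/l) *\<^sub>R P + (1/l) *\<^sub>R 1" using P(3) by (simp add: algebra_simps)
  have *: "\<exists>x y. X = x *\<^sub>R P + y *\<^sub>R 1" if X: "X * C = C * X" for X
  proof -
    have "(l - 1/l) *\<^sub>R (X * P) = (l - 1/l) *\<^sub>R (P * X)" using X unfolding CP
      by (simp add: distrib_left distrib_right)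
    then have XP: "X * P = P * X" using l2 by simp
    have "P * X * P = P * X" using XP tr_one_singular(1)[OF P(1,2)] by (metis mult.assoc)
    then have "X = P * X * P + (1 - P) * X * (1 - P)"
      using XP by (simp add: algebra_simps flip: mult.assoc)
    also have "\<dots> = tr2 (P * X) *\<^sub>R P + tr2 ((1 - P) * X) *\<^sub>R (1 - P)"
      using tr_one_singular(4)[OF P(1,2)] tr_one_singular(4)[OF tr_one_singular(2,3)[OF P(1,2)]] by simp
    also have "\<dots> = (tr2 (P * X) - tr2 ((1 - P) * X)) *\<^sub>R P + tr2 ((1 - P) * X) *\<^sub>R 1"
      by (simp add: scaleR_diff_right scaleR_diff_left)
    finally show ?thesis by blast
  qed
  obtain x y z w where "A = x *\<^sub>R P + y *\<^sub>R 1" "B = z *\<^sub>R P + w *\<^sub>R 1"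
    using *[OF assms(3)] *[OF assms(4)] by blast
  then show ?thesis
    by (simp add: distrib_left distrib_right scaleR_add_right mult.commute add.commute add.left_commute)
qed

text \<open>The hypothesis says that \<open>g\<close> conjugates \<open>C\<close> to its inverse. Then it swaps the two eigenlines of \<open>C\<close>.
  The proof derives the vanishing of the trace from the Cayley-Hamilton identity.\<close>

lemma inverted_hyperbolic_trace:
  assumes C: "det2 C = 1" "\<bar>tr2 C\<bar> > 2" and g: "C * g * C = g"
  shows "tr2 g = 0"
proof -
  let ?t = "tr2 C"
  have CC: "C * C = ?t *\<^sub>R C - 1"
    using C(1) by (intro m2_eqI) (auto simp: tr2_def det2_def algebra_simps)
  have 1: "tr2 g = ?t * tr2 (C * g) - tr2 g"
  proof -
    have "tr2 g = tr2 (C * C * g)" using g by (metis mult.assoc tr2_mult_commute)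
    then show ?thesis by (simp add: CC left_diff_distrib)
  qed
  have 2: "2 * tr2 (C * g) = ?t * tr2 g"
  proof -
    have "C * g = g * adj2 C" using g adj2_inverse[OF C(1)] by (metis mult.assoc mult_1_right)
    moreover have "adj2 C = ?t *\<^sub>R 1 - C" by (intro m2_eqI) (auto simp: adj2_def tr2_def)
    ultimately have "tr2 (C * g) = ?t * tr2 g - tr2 (g * C)" by (simp add: right_diff_distrib)
    then show ?thesis by (simp add: tr2_mult_commute)
  qed
  have "(?t\<^sup>2 - 4) * tr2 g = 0" using 1 2 by (simp add: power2_eq_square) algebra
  moreover have "?t\<^sup>2 > 2\<^sup>2" using C(2) by (metis abs_numeral abs_le_square_iff not_le)
  ultimately show ?thesis by auto
qed

section \<open>Evaluating words in presented groups\<close>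

lemma word_eval_Nil [simp]: "word_eval H h [] = \<one>\<^bsub>H\<^esub>"
  and word_eval_Cons [simp]: "word_eval H h (p # u) = letter_eval H h p \<otimes>\<^bsub>H\<^esub> word_eval H h u"
  by (simp_all add: word_eval_def)

lemma (in group) letter_eval_closed:
  "h \<in> X \<rightarrow> carrier G \<Longrightarrow> snd p \<in> X \<Longrightarrow> letter_eval G h p \<in> carrier G"
  by (auto simp: letter_eval_def split: prod.splits)

lemma (in group) word_eval_closed:
  assumes "h \<in> X \<rightarrow> carrier G" "u \<in> words X"
  shows "word_eval G h u \<in> carrier G"
  using assms(2) by (induction u) (auto simp: words_def intro!: letter_eval_closed[OF assms(1)])

lemma (in group) word_eval_append:
  assumes "h \<in> X \<rightarrow> carrier G" "u \<in> words X" "v \<in> words X"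
  shows "word_eval G h (u @ v) = word_eval G h u \<otimes> word_eval G h v"
  using assms(2)
proof (induction u)
  case Nil then show ?case using word_eval_closed[OF assms(1,3)] by simp
next
  case (Cons p u)
  then have "snd p \<in> X" "u \<in> words X" by (auto simp: words_def)
  then show ?case using Cons letter_eval_closed[OF assms(1)] word_eval_closed[OF assms(1)] assms(3)
    by (simp add: m_assoc)
qed

lemma word_eval_cong:
  assumes "\<And>x. x \<in> X \<Longrightarrow> h x = h' x" "u \<in> words X"
  shows "word_eval H h u = word_eval H h' u"
  using assms(2) by (induction u) (auto simp: words_def letter_eval_def assms(1))

lemma words_simps [simp]:
  "[] \<in> words X" "p # u \<in> words X \<longleftrightarrow> snd p \<in> X \<and> u \<in> words X"
  "u @ v \<in> words X \<longleftrightarrow> u \<in> words X \<and> v \<in> words X"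
  by (auto simp: words_def mem_Times_iff)

lemma carrier_presented_group:
  "carrier (presented_group X R) = (\<lambda>u. pres_cong X R `` {u}) ` words X"
  by (auto simp: presented_group_def quotient_def)

lemma one_presented_group: "\<one>\<^bsub>presented_group X R\<^esub> = pres_cong X R `` {[]}"
  by (simp add: presented_group_def)

lemma pres_class_eq:
  "u \<in> words X \<Longrightarrow> v \<in> words X \<Longrightarrow>
    pres_cong X R `` {u} = pres_cong X R `` {v} \<longleftrightarrow> (u, v) \<in> pres_cong X R"
  using eq_equiv_class_iff[OF equiv_pres_cong] by blast

lemma pres_gen_closed: "x \<in> X \<Longrightarrow> pres_gen X R x \<in> carrier (presented_group X R)"
  unfolding carrier_presented_group pres_gen_def by (rule imageI) simp

lemma pres_class_letter:
  assumes "x \<in> X"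
  shows "pres_cong X R `` {[(b, x)]} = letter_eval (presented_group X R) (pres_gen X R) (b, x)"
proof (cases b)
  case False
  interpret P: group "presented_group X R" by (rule group_presented_group)
  let ?c = "\<lambda>u. pres_cong X R `` {u}"
  have c: "?c [(False, x)] \<in> carrier (presented_group X R)"
    unfolding carrier_presented_group using assms by (intro imageI) simp
  have "?c [(False, x)] \<otimes>\<^bsub>presented_group X R\<^esub> pres_gen X R x = ?c [(False, x), (True, x)]"
    unfolding pres_gen_def using assms by (subst pres_mult) auto
  also have "\<dots> = ?c []"
    using pres_cong.cancel[OF assms, of False R] assms by (subst pres_class_eq) auto
  finally have "?c [(False, x)] = inv\<^bsub>presented_group X R\<^esub> pres_gen X R x"
    using P.inv_equality[OF _ pres_gen_closed[OF assms] c] by (simp add: one_presented_group)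
  then show ?thesis using False by (simp add: letter_eval_def)
qed (simp add: letter_eval_def pres_gen_def)

lemma hom_pres_class:
  assumes "group H" "k \<in> hom (presented_group X R) H" "u \<in> words X"
  shows "k (pres_cong X R `` {u}) = word_eval H (\<lambda>x. k (pres_gen X R x)) u"
  using assms(3)
proof (induction u)
  case Nil
  then show ?case
    using hom_one[OF assms(2) group_presented_group assms(1)] by (simp add: one_presented_group)
next
  case (Cons p u)
  interpret K: group_hom "presented_group X R" H k
    using assms by (simp add: group_hom_def group_hom_axioms_def group_presented_group)
  obtain b x where p: "p = (b, x)" by force
  have x: "x \<in> X" and u: "u \<in> words X" using Cons.prems p by auto
  have "k (pres_cong X R `` {[p] @ u})
      = k (pres_cong X R `` {[p]} \<otimes>\<^bsub>presented_group X R\<^esub> pres_cong X R `` {u})"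
    using x u p by (subst pres_mult) auto
  also have "\<dots> = k (pres_cong X R `` {[p]}) \<otimes>\<^bsub>H\<^esub> k (pres_cong X R `` {u})"
    using x u p by (intro K.hom_mult) (auto simp: carrier_presented_group)
  also have "k (pres_cong X R `` {[p]}) = letter_eval H (\<lambda>x. k (pres_gen X R x)) p"
    unfolding p pres_class_letter[OF x]
    using x pres_gen_closed[OF x] by (auto simp: letter_eval_def K.hom_inv)
  finally show ?case using Cons.IH u by simp
qed

lemma pres_universal_class:
  assumes "group H" "h \<in> X \<rightarrow> carrier H" "\<And>r. r \<in> R \<Longrightarrow> word_eval H h r = \<one>\<^bsub>H\<^esub>"
  obtains k where "k \<in> hom (presented_group X R) H" "\<And>x. x \<in> X \<Longrightarrow> k (pres_gen X R x) = h x"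
    "\<And>u. u \<in> words X \<Longrightarrow> k (pres_cong X R `` {u}) = word_eval H h u"
proof -
  obtain k where k: "k \<in> hom (presented_group X R) H" "\<forall>x\<in>X. k (pres_gen X R x) = h x"
    using pres_universal[OF assms] by blast
  show ?thesis
    using that[OF k(1)] k(2) hom_pres_class[OF assms(1) k(1)] word_eval_cong[of X _ h _ H] by metis
qed

section \<open>Hyperbolic representations of free groups\<close>

text \<open>For \<open>a \<noteq> r\<close>, a multiple of the projection with image spanned by \<open>(a, 1)\<close> and kernel spanned by
  \<open>(r, 1)\<close>. As a Moebius transformation it sends everything except the point \<open>r\<close> to \<open>a\<close>.\<close>

definition rank_one :: "real \<Rightarrow> real \<Rightarrow> m2" where
  "rank_one a r = M2 a (- a * r) 1 (- r)"

lemma rank_one_mult: "rank_one a r * rank_one a' r' = (a' - r) *\<^sub>R rank_one a r'"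
  by (intro m2_eqI) (simp_all add: rank_one_def algebra_simps)

lemma rank_one_complement: "a = r + 1 \<Longrightarrow> 1 - rank_one a r = - rank_one r a"
  by (simp only: rank_one_def m2_defs m2.sel m2.inject) (simp add: algebra_simps)

lemma tr2_rank_one: "tr2 (rank_one a r) = a - r"
  by (simp add: rank_one_def tr2_def)

lemma det2_rank_one: "det2 (rank_one a r) = 0"
  by (simp add: rank_one_def det2_def)

text \<open>The generator \<open>x\<close> gets the attracting point \<open>2x + 1\<close> and the repelling point \<open>2x\<close>. They
  differ by \<open>1\<close>, so that \<open>rank_one\<close> gives a projection, and different letters get different points.\<close>

definition gen_proj :: "nat \<Rightarrow> m2" where
  "gen_proj x = rank_one (2 * real x + 1) (2 * real x)"

text \<open>The hyperbolic matrix with eigenvalues \<open>q\<close> and \<open>1/q\<close> and the fixed points chosen above. The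
  parameter \<open>q\<close> will tend to infinity.\<close>

definition schottky_gen :: "real \<Rightarrow> nat \<Rightarrow> m2" where
  "schottky_gen q x = q *\<^sub>R gen_proj x + (1/q) *\<^sub>R (1 - gen_proj x)"

text \<open>The attracting fixed point of a letter. The repelling one is that of the inverse letter.\<close>

definition attract :: "bool \<times> nat \<Rightarrow> real" where
  "attract p = 2 * real (snd p) + of_bool (fst p)"

definition flip :: "bool \<times> 'x \<Rightarrow> bool \<times> 'x" where
  "flip p = (\<not> fst p, snd p)"

lemma attract_eq_iff: "attract p = attract p' \<longleftrightarrow> p = p'"
proof
  assume "attract p = attract p'"
  then have "real (2 * snd p + of_bool (fst p)) = real (2 * snd p' + of_bool (fst p'))"
    by (simp add: attract_def)
  then have *: "2 * snd p + of_bool (fst p) = 2 * snd p' + of_bool (fst p')" by (simp only: of_nat_eq_iff)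
  then have "fst p = fst p'" by (cases "fst p"; cases "fst p'"; simp; presburger)
  then show "p = p'" using * by (simp add: prod_eq_iff)
qed simp

lemma proj_sign_gen_proj:
  "proj_sign (gen_proj x) b = (if b then 1 else - 1) *\<^sub>R rank_one (attract (b, x)) (attract (flip (b, x)))"
  proof (cases b)
  case True
  then have "attract (b, x) = 2 * real x + 1" "attract (flip (b, x)) = 2 * real x"
    by (simp_all add: attract_def flip_def)
  then show ?thesis using True by (simp only: proj_sign_def gen_proj_def if_True scaleR_one)
next
  case False
  have "1 - rank_one (2 * real x + 1) (2 * real x) = - rank_one (2 * real x) (2 * real x + 1)"
    by (rule rank_one_complement) simp
  moreover have "attract (b, x) = 2 * real x" "attract (flip (b, x)) = 2 * real x + 1"
    using False by (simp_all add: attract_def flip_def)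
  ultimately show ?thesis using False by (simp only: proj_sign_def gen_proj_def if_False scaleR_minus1_left)
qed

lemma gen_proj_singular: "det2 (gen_proj x) = 0" "tr2 (gen_proj x) = 1"
  by (simp_all only: gen_proj_def det2_rank_one tr2_rank_one)

lemma det2_schottky_gen: "q \<noteq> 0 \<Longrightarrow> det2 (schottky_gen q x) = 1"
  by (simp add: schottky_gen_def gen_proj_def rank_one_def det2_def field_simps)

definition word_pencil :: "(bool \<times> nat) list \<Rightarrow> real \<Rightarrow> m2" where
  "word_pencil u x = foldr (\<lambda>(b, y) acc. pencil (proj_sign (gen_proj y) b) x * acc) u 1"

lemma poly_mat_word_pencil: "poly_mat (2 * length u) (word_pencil u)"
proof (induction u)
  case Nil then show ?case using poly_mat_const[of 0 1] by (simp add: word_pencil_def)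
next
  case (Cons p u)
  obtain b y where p: "p = (b, y)" by force
  have "poly_mat (2 + 2 * length u) (\<lambda>x. pencil (proj_sign (gen_proj y) b) x * word_pencil u x)"
    by (intro poly_mat_mult Cons poly_mat_pencil)
  then show ?case by (simp add: word_pencil_def p)
qed

lemma word_eval_schottky:
  assumes "q \<noteq> 0"
  shows "word_eval SL2 (schottky_gen q) u = q ^ length u *\<^sub>R word_pencil u (1/q)"
proof (induction u)
  case Nil then show ?case by (simp add: word_pencil_def)
next
  case (Cons p u)
  obtain b y where p: "p = (b, y)" by force
  have "letter_eval SL2 (schottky_gen q) p = sgn_pow (schottky_gen q y) b"
    using det2_schottky_gen[OF assms] by (simp add: p letter_eval_def sgn_pow_def inv_SL2)
  also have "\<dots> = q *\<^sub>R pencil (proj_sign (gen_proj y) b) (1/q)"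
  proof -
    have "q * (1/q)\<^sup>2 = 1/q" using assms by (simp add: power2_eq_square)
    then show ?thesis unfolding schottky_gen_def sgn_pow_split[OF gen_proj_singular(2)] pencil_def
        scaleR_add_right scaleR_scaleR by simp
  qed
  finally show ?case by (simp add: Cons p word_pencil_def)
qed

text \<open>In a reduced word the attracting point of a letter is never the repelling point of the letter before
  it, so the product of the limiting rank one matrices is nonzero.\<close>

lemma word_pencil_zero:
  assumes "u \<noteq> []" "successively (\<lambda>p p'. p' \<noteq> flip p) u"
  shows "\<exists>\<kappa>. \<kappa> \<noteq> 0 \<and> word_pencil u 0 = \<kappa> *\<^sub>R rank_one (attract (hd u)) (attract (flip (last u)))"
  using assms
proof (induction u)
  case (Cons p u)
  obtain b y where p: "p = (b, y)" by force
  show ?case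
  proof (cases "u = []")
    case True
    then show ?thesis by (auto simp: p word_pencil_def proj_sign_gen_proj intro!: exI[of _ "if b then 1 else -1"])
  next
    case False
    then have s: "hd u \<noteq> flip p" "successively (\<lambda>p p'. p' \<noteq> flip p) u"
      using Cons.prems by (auto simp: successively_Cons)
    obtain \<kappa> where \<kappa>: "\<kappa> \<noteq> 0" "word_pencil u 0 = \<kappa> *\<^sub>R rank_one (attract (hd u)) (attract (flip (last u)))"
      using Cons.IH[OF False s(2)] by blast
    define \<kappa>' where "\<kappa>' = (if b then 1 else -1) * \<kappa> * (attract (hd u) - attract (flip p))"
    have "word_pencil (p # u) 0 = \<kappa>' *\<^sub>R rank_one (attract p) (attract (flip (last u)))"
      unfolding \<kappa>'_def using \<kappa>(2) by (simp add: word_pencil_def p proj_sign_gen_proj rank_one_mult)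
    moreover have "last (p # u) = last u" using False by simp
    moreover have "\<kappa>' \<noteq> 0"
      unfolding \<kappa>'_def using \<kappa>(1) s(1) by (simp add: attract_eq_iff)
    ultimately have "\<kappa>' \<noteq> 0 \<and>
        word_pencil (p # u) 0 = \<kappa>' *\<^sub>R rank_one (attract (hd (p # u))) (attract (flip (last (p # u))))"
      by (simp only: list.sel simp_thms)
    then show ?thesis by (rule exI)
  qed
qed simp

definition cyc_reduced :: "(bool \<times> 'x) list \<Rightarrow> bool" where
  "cyc_reduced u \<longleftrightarrow> u \<noteq> [] \<and> successively (\<lambda>p p'. p' \<noteq> flip p) u \<and> hd u \<noteq> flip (last u)"

text \<open>Rescaled by \<open>q\<^sup>-\<^sup>m\<close>, where \<open>m > 0\<close> is the length of the word, the trace converges to the trace of a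
  product of rank one matrices. Cyclic reducedness makes this limit nonzero, so the trace itself tends
  to infinity in absolute value.\<close>

lemma cyc_reduced_trace:
  assumes "cyc_reduced u"
  shows "\<forall>\<^sub>F q in at_top. \<bar>tr2 (word_eval SL2 (schottky_gen q) u)\<bar> > 2"
proof -
  let ?T = "\<lambda>x. tr2 (word_pencil u x)"
  have u: "length u \<ge> 1" using assms by (cases u) (auto simp: cyc_reduced_def)
  have T0: "?T 0 \<noteq> 0"
    using word_pencil_zero[of u] assms by (auto simp: cyc_reduced_def tr2_rank_one attract_eq_iff)
  have "((\<lambda>q. \<bar>?T (inverse q)\<bar>) \<longlongrightarrow> \<bar>?T 0\<bar>) at_top"
    using filterlim_compose[OF poly_mat_tendsto_tr2[OF poly_mat_word_pencil] filterlim_inverse_at_right_top]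
    by (rule tendsto_rabs)
  then have "\<forall>\<^sub>F q in at_top. \<bar>?T (inverse q)\<bar> > \<bar>?T 0\<bar> / 2"
    by (rule order_tendstoD) (use T0 in auto)
  moreover have "\<forall>\<^sub>F q::real in at_top. q > 1 + 4 / \<bar>?T 0\<bar>" by (rule eventually_gt_at_top)
  ultimately show ?thesis
  proof eventually_elim
    case (elim q)
    have T0': "\<bar>?T 0\<bar> > 0" using T0 by simp
    have "4 / \<bar>?T 0\<bar> > 0" by (rule divide_pos_pos[OF _ T0']) simp
    then have q1: "q > 1" using elim(2) by linarith
    define y where "y = \<bar>?T (inverse q)\<bar>"
    have "q > 4 / \<bar>?T 0\<bar>" using elim(2) by linarith
    then have "q * \<bar>?T 0\<bar> > 4" using T0' by (simp only: pos_divide_less_eq)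
    moreover have "q * (\<bar>?T 0\<bar> / 2) \<le> q * y"
      unfolding y_def by (rule mult_left_mono) (use elim(1) q1 in linarith)+
    moreover have "q * y \<le> q ^ length u * y"
    proof (rule mult_right_mono)
      have "q ^ 1 \<le> q ^ length u" by (rule power_increasing[OF u]) (use q1 in linarith)
      then show "q \<le> q ^ length u" by (simp only: power_one_right)
      show "0 \<le> y" unfolding y_def by (rule abs_ge_zero)
    qed
    moreover have "\<bar>tr2 (word_eval SL2 (schottky_gen q) u)\<bar> = q ^ length u * y"
    proof -
      have "word_eval SL2 (schottky_gen q) u = q ^ length u *\<^sub>R word_pencil u (1/q)"
        by (rule word_eval_schottky) (use q1 in linarith)
      moreover have "0 \<le> q ^ length u" using q1 by simp
      ultimately show ?thesis
        unfolding y_def inverse_eq_divide by (simp only: tr2_linear abs_mult abs_of_nonneg)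
    qed
    ultimately show ?case by linarith
  qed
qed

text \<open>The words \<open>u\<close> and \<open>v\<close> represent conjugate elements. What is recorded of this is that they have the same
  traces and that \<open>u\<close> is trivial if \<open>v\<close> is empty.\<close>

lemma cyclic_reduction:
  assumes "u \<in> words X"
  shows "\<exists>v\<in>words X. (v = [] \<and> (u, []) \<in> pres_cong X {} \<or> cyc_reduced v) \<and>
    (\<forall>h. h \<in> X \<rightarrow> carrier SL2 \<longrightarrow> tr2 (word_eval SL2 h u) = tr2 (word_eval SL2 h v))"
  using assms
proof (induction "length u" arbitrary: u rule: less_induct)
  case less
  interpret S: group SL2 by (rule group_SL2)
  have shorten: ?case if w: "w \<in> words X" "length w < length u"
    "(w, []) \<in> pres_cong X {} \<Longrightarrow> (u, []) \<in> pres_cong X {}"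
    "\<And>h. h \<in> X \<rightarrow> carrier SL2 \<Longrightarrow> tr2 (word_eval SL2 h u) = tr2 (word_eval SL2 h w)" for w
    using less.hyps[OF w(2,1)] w(3,4) by auto
  have letter: "letter_eval SL2 h p * letter_eval SL2 h (flip p) = 1"
    "letter_eval SL2 h (flip p) * letter_eval SL2 h p = 1"
    if "snd p \<in> X" "h \<in> X \<rightarrow> carrier SL2" for h p
    using that by (cases p; auto simp: letter_eval_def flip_def inv_SL2 adj2_inverse Pi_def)+
  have cong: "([p, flip p], []) \<in> pres_cong X {}" if "snd p \<in> X" for p
    using that pres_cong.cancel[of "snd p" X "fst p"] by (simp add: flip_def)
  show ?case
  proof (cases "u = [] \<or> cyc_reduced u")
    case True
    then show ?thesis
      by (intro bexI[of _ u]) (use less.prems in \<open>auto intro: pres_cong.refl\<close>)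
  next
    case False
    then consider "\<not> successively (\<lambda>p p'. p' \<noteq> flip p) u" | "u \<noteq> []" "hd u = flip (last u)"
      by (auto simp: cyc_reduced_def)
    then show ?thesis
    proof cases
      case 1
      have "\<exists>a p b. u = a @ p # flip p # b"
        using 1
      proof (induction u rule: induct_list012)
        case (3 x y zs)
        then show ?case
        proof (cases "y = flip x")
          case True then show ?thesis by (metis append_Nil)
        next
          case False
          then obtain a p b where "y # zs = a @ p # flip p # b" using 3 by auto
          then show ?thesis by (metis append_Cons)
        qed
      qed auto
      then obtain a p b where u: "u = a @ p # flip p # b" by blast
      then have m: "a \<in> words X" "b \<in> words X" "snd p \<in> X" using less.prems by auto
      have "(a @ ([p, flip p] @ b), a @ ([] @ b)) \<in> pres_cong X {}"
        using m cong by (intro pres_cong.append) (auto intro: pres_cong.refl)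
      then have c: "(u, a @ b) \<in> pres_cong X {}" by (simp add: u)
      show ?thesis
      proof (rule shorten[of "a @ b"])
        fix h assume h: "h \<in> X \<rightarrow> carrier SL2"
        have "word_eval SL2 h u = word_eval SL2 h (a @ b)"
          unfolding u using m letter[OF m(3) h]
          by (simp add: S.word_eval_append[OF h] flip_def mult.assoc[symmetric])
        then show "tr2 (word_eval SL2 h u) = tr2 (word_eval SL2 h (a @ b))" by simp
      next
        assume "(a @ b, []) \<in> pres_cong X {}"
        with c show "(u, []) \<in> pres_cong X {}" by (rule pres_cong.trans)
      qed (use m u in auto)
    next
      case 2
      define q where "q = last u"
      have qq: "flip q \<noteq> q" by (auto simp: flip_def prod_eq_iff)
      define w where "w = butlast (tl u)"
      have "tl u \<noteq> []"
      proof
        assume "tl u = []"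
        then have "last u = hd u" using 2(1) by (metis last.simps list.collapse)
        with 2(2) qq show False unfolding q_def by metis
      qed
      then have u0: "u = [hd u] @ butlast (tl u) @ [last (tl u)]" using 2(1) by simp
      have h: "hd u = flip q" using 2(2) by (simp only: q_def)
      have l: "last (tl u) = q" unfolding q_def using \<open>tl u \<noteq> []\<close> by (rule last_tl[OF disjI2])
      have u: "u = [flip q] @ w @ [q]" using u0 unfolding h l w_def[symmetric] .
      then have m: "w \<in> words X" "snd q \<in> X" using less.prems by auto
      show ?thesis
      proof (rule shorten[of w])
        assume w: "(w, []) \<in> pres_cong X {}"
        have "([flip q] @ (w @ [q]), [flip q] @ ([] @ [q])) \<in> pres_cong X {}"
          using m w by (intro pres_cong.append) (auto intro!: pres_cong.refl simp: flip_def)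
        moreover have "([flip q, q], []) \<in> pres_cong X {}"
          using cong[of "flip q"] m by (simp add: flip_def)
        ultimately show "(u, []) \<in> pres_cong X {}"
          by (subst u) (auto intro: pres_cong.trans[of _ "[flip q, q]"])
      next
        fix h assume h: "h \<in> X \<rightarrow> carrier SL2"
        have "word_eval SL2 h u = letter_eval SL2 h (flip q) * (word_eval SL2 h w * letter_eval SL2 h q)"
          by (subst u) (use m in \<open>simp add: S.word_eval_append[OF h]\<close>)
        then have "tr2 (word_eval SL2 h u)
          = tr2 (word_eval SL2 h w * (letter_eval SL2 h q * letter_eval SL2 h (flip q)))"
          by (metis mult.assoc tr2_mult_commute)
        then show "tr2 (word_eval SL2 h u) = tr2 (word_eval SL2 h w)"
          using letter[OF m(2) h] by simp
      qed (use m in \<open>simp_all add: arg_cong[OF u, of length]\<close>)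
    qed
  qed
qed

text \<open>Each nontrivial element of \<open>S\<close> is conjugate to a cyclically reduced nonempty word, whose trace under
  \<open>schottky_gen q\<close> exceeds \<open>2\<close> for all large \<open>q\<close>. As \<open>S\<close> is finite, one \<open>q\<close> serves all of its elements.\<close>

theorem free_group_hyperbolic_hom:
  fixes X :: "nat set"
  assumes "finite S" "S \<subseteq> carrier (free_group X)"
  obtains \<rho> where "\<rho> \<in> hom (free_group X) SL2"
    "\<And>g. g \<in> S \<Longrightarrow> g \<noteq> \<one>\<^bsub>free_group X\<^esub> \<Longrightarrow> \<bar>tr2 (\<rho> g)\<bar> > 2"
proof -
  let ?c = "\<lambda>u. pres_cong X {} `` {u}"
  have word: "\<exists>u\<in>words X. g = ?c u" if "g \<in> S" for g
    using assms(2) that by (auto simp: free_group_def carrier_presented_group)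
  have ev: "\<forall>\<^sub>F q in at_top. \<forall>u\<in>words X. g = ?c u \<longrightarrow> g \<noteq> \<one>\<^bsub>free_group X\<^esub> \<longrightarrow>
      \<bar>tr2 (word_eval SL2 (schottky_gen q) u)\<bar> > 2" if g: "g \<in> S" for g
  proof (cases "g = \<one>\<^bsub>free_group X\<^esub>")
    case False
    obtain u where u: "u \<in> words X" "g = ?c u" using word[OF g] by blast
    obtain v where v: "v \<in> words X" "v = [] \<and> (u, []) \<in> pres_cong X {} \<or> cyc_reduced v"
      "\<forall>h. h \<in> X \<rightarrow> carrier SL2 \<longrightarrow> tr2 (word_eval SL2 h u) = tr2 (word_eval SL2 h v)"
      using cyclic_reduction[OF u(1)] by blast
    have "cyc_reduced v"
      using v(2) False u pres_class_eq[OF u(1), of "[]" "{}"]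
      by (auto simp: free_group_def one_presented_group)
    have "\<forall>\<^sub>F q::real in at_top. q > 0" by (rule eventually_gt_at_top)
    then show ?thesis using cyc_reduced_trace[OF \<open>cyc_reduced v\<close>]
    proof eventually_elim
      case (elim q)
      have h: "schottky_gen q \<in> X \<rightarrow> carrier SL2" using elim(1) by (auto simp: det2_schottky_gen)
      obtain k where k: "\<And>u. u \<in> words X \<Longrightarrow> k (?c u) = word_eval SL2 (schottky_gen q) u"
        by (rule pres_universal_class[OF group_SL2 h, of "{}"]) auto
      show ?case
      proof (intro ballI impI)
        fix u' assume u': "u' \<in> words X" "g = ?c u'"
        have "word_eval SL2 (schottky_gen q) u' = k g" using k[OF u'(1)] u'(2) by simp
        also have "\<dots> = word_eval SL2 (schottky_gen q) u" using k[OF u(1)] u(2) by simp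
        finally show "\<bar>tr2 (word_eval SL2 (schottky_gen q) u')\<bar> > 2"
          using elim(2) v(3)[rule_format, OF h] by simp
      qed
    qed
  qed simp
  have "\<forall>\<^sub>F q::real in at_top. q > 0" by (rule eventually_gt_at_top)
  moreover have "\<forall>\<^sub>F q in at_top. \<forall>g\<in>S. \<forall>u\<in>words X. g = ?c u \<longrightarrow> g \<noteq> \<one>\<^bsub>free_group X\<^esub> \<longrightarrow>
      \<bar>tr2 (word_eval SL2 (schottky_gen q) u)\<bar> > 2"
    using ev by (rule eventually_ball_finite[OF assms(1), rule_format])
  ultimately have "\<forall>\<^sub>F q in at_top. q > 0 \<and> (\<forall>g\<in>S. \<forall>u\<in>words X. g = ?c u \<longrightarrow> g \<noteq> \<one>\<^bsub>free_group X\<^esub> \<longrightarrow>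
      \<bar>tr2 (word_eval SL2 (schottky_gen q) u)\<bar> > 2)" by (rule eventually_conj)
  then obtain q where q: "q > 0" "\<forall>g\<in>S. \<forall>u\<in>words X. g = ?c u \<longrightarrow> g \<noteq> \<one>\<^bsub>free_group X\<^esub> \<longrightarrow>
      \<bar>tr2 (word_eval SL2 (schottky_gen q) u)\<bar> > 2"
    using eventually_happens'[OF trivial_limit_at_top_linorder] by blast
  have h: "schottky_gen q \<in> X \<rightarrow> carrier SL2" using q(1) by (auto simp: det2_schottky_gen)
  obtain \<rho> where \<rho>: "\<rho> \<in> hom (free_group X) SL2"
    "\<And>u. u \<in> words X \<Longrightarrow> \<rho> (?c u) = word_eval SL2 (schottky_gen q) u"
    by (rule pres_universal_class[OF group_SL2 h, of "{}", folded free_group_def]) auto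
  show ?thesis
  proof (rule that[OF \<rho>(1)])
    fix g assume g: "g \<in> S" "g \<noteq> \<one>\<^bsub>free_group X\<^esub>"
    obtain u where u: "u \<in> words X" "g = ?c u" using word[OF g(1)] by blast
    have "\<bar>tr2 (word_eval SL2 (schottky_gen q) u)\<bar> > 2" using q(2) g u by blast
    moreover have "\<rho> g = word_eval SL2 (schottky_gen q) u" unfolding u(2) by (rule \<rho>(2)[OF u(1)])
    ultimately show "\<bar>tr2 (\<rho> g)\<bar> > 2" by (simp only:)
  qed
qed

section \<open>Limit groups: commutative transitivity and separation of powers\<close>

lemma (in group) zpow_closed: "z \<in> carrier G \<Longrightarrow> zpow G z e \<in> carrier G"
  by (simp add: zpow_def)

lemma (in group) zeval_closed:
  "z \<in> carrier G \<Longrightarrow> \<forall>(\<alpha>, e, \<beta>) \<in> set ws. \<alpha> \<in> carrier G \<and> \<beta> \<in> carrier G \<Longrightarrow> zeval G z ws \<in> carrier G"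
  by (induction ws) (auto simp: zpow_closed)

definition map_word :: "('a \<Rightarrow> 'b) \<Rightarrow> ('a \<times> bool \<times> 'a) list \<Rightarrow> ('b \<times> bool \<times> 'b) list" where
  "map_word k = map (\<lambda>(\<alpha>, e, \<beta>). (k \<alpha>, e, k \<beta>))"

lemma map_word_simps [simp]:
  "map_word k [] = []" "map_word k ((\<alpha>, e, \<beta>) # ws) = (k \<alpha>, e, k \<beta>) # map_word k ws"
  by (simp_all add: map_word_def)

lemma (in group_hom) hom_zpow: "z \<in> carrier G \<Longrightarrow> h (zpow G z e) = zpow H (h z) e"
  by (simp add: zpow_def)

lemma (in group_hom) hom_zeval:
  assumes "z \<in> carrier G" "\<forall>(\<alpha>, e, \<beta>) \<in> set ws. \<alpha> \<in> carrier G \<and> \<beta> \<in> carrier G"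
  shows "h (zeval G z ws) = zeval H (h z) (map_word h ws)"
  using assms(2)
proof (induction ws)
  case (Cons w ws)
  obtain \<alpha> e \<beta> where w: "w = (\<alpha>, e, \<beta>)" by (metis prod_cases3)
  have "\<alpha> \<in> carrier G" "\<beta> \<in> carrier G" "zpow G z e \<in> carrier G" "zeval G z ws \<in> carrier G"
    using Cons.prems w assms(1) by (auto intro: G.zpow_closed G.zeval_closed)
  then show ?case using Cons w assms(1) by (simp add: hom_zpow)
qed simp

text \<open>On each finite set, \<open>M\<close> looks like a group of matrices in which every nontrivial element is hyperbolic.
  The representations are defined on the cover \<open>\<Gamma>\<close> and not on \<open>M\<close>: a homomorphism
  occurring in a stable sequence need not factor through the limit group.\<close>

definition hyperbolic_cover ::
    "('a, 'k) monoid_scheme \<Rightarrow> ('b, 'm) monoid_scheme \<Rightarrow> ('a \<Rightarrow> 'b) \<Rightarrow> bool" where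
  "hyperbolic_cover \<Gamma> M \<pi> \<longleftrightarrow> group \<Gamma> \<and> group M \<and> \<pi> \<in> hom \<Gamma> M \<and> \<pi> ` carrier \<Gamma> = carrier M \<and>
     (\<forall>S. finite S \<longrightarrow> S \<subseteq> carrier \<Gamma> \<longrightarrow>
        (\<exists>\<rho>\<in>hom \<Gamma> SL2. \<forall>g\<in>S. if \<pi> g = \<one>\<^bsub>M\<^esub> then \<rho> g = 1 else \<bar>tr2 (\<rho> g)\<bar> > 2))"

definition commutative_transitive :: "('a, 'm) monoid_scheme \<Rightarrow> bool" where
  "commutative_transitive M \<longleftrightarrow> (\<forall>a\<in>carrier M. \<forall>b\<in>carrier M. \<forall>c\<in>carrier M. c \<noteq> \<one>\<^bsub>M\<^esub> \<longrightarrow>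
     a \<otimes>\<^bsub>M\<^esub> c = c \<otimes>\<^bsub>M\<^esub> a \<longrightarrow> b \<otimes>\<^bsub>M\<^esub> c = c \<otimes>\<^bsub>M\<^esub> b \<longrightarrow> a \<otimes>\<^bsub>M\<^esub> b = b \<otimes>\<^bsub>M\<^esub> a)"

text \<open>A form of Baumslag's lemma. Cancellation between \<open>c\<^sup>n\<close> and a neighbouring \<open>c\<^sup>-\<^sup>n\<close> is excluded by the
  hypothesis on the element between them. Full cancellation between powers of the same sign would conjugate
  \<open>c\<close> to its inverse, which is impossible in a limit group.\<close>

definition power_separated :: "('a, 'm) monoid_scheme \<Rightarrow> bool" where
  "power_separated M \<longleftrightarrow> (\<forall>c ws h. c \<in> carrier M \<longrightarrow> c \<noteq> \<one>\<^bsub>M\<^esub> \<longrightarrow> ws \<noteq> [] \<longrightarrow> h \<in> carrier M \<longrightarrow>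
     (\<forall>(\<alpha>, e, \<beta>) \<in> set ws. \<alpha> \<in> carrier M \<and> \<beta> \<in> carrier M) \<longrightarrow>
     successively (\<lambda>(\<alpha>, e, \<beta>) (\<alpha>', e', \<beta>').
        e \<noteq> e' \<longrightarrow> (\<beta> \<otimes>\<^bsub>M\<^esub> \<alpha>') \<otimes>\<^bsub>M\<^esub> c \<noteq> c \<otimes>\<^bsub>M\<^esub> (\<beta> \<otimes>\<^bsub>M\<^esub> \<alpha>')) ws \<longrightarrow>
     finite {n::nat. zeval M (c [^]\<^bsub>M\<^esub> n) ws = h})"

lemma power_separatedD:
  assumes "power_separated M" "c \<in> carrier M" "c \<noteq> \<one>\<^bsub>M\<^esub>" "ws \<noteq> []" "h \<in> carrier M"
    "\<forall>(\<alpha>, e, \<beta>) \<in> set ws. \<alpha> \<in> carrier M \<and> \<beta> \<in> carrier M"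
    "successively (\<lambda>(\<alpha>, e, \<beta>) (\<alpha>', e', \<beta>').
        e \<noteq> e' \<longrightarrow> (\<beta> \<otimes>\<^bsub>M\<^esub> \<alpha>') \<otimes>\<^bsub>M\<^esub> c \<noteq> c \<otimes>\<^bsub>M\<^esub> (\<beta> \<otimes>\<^bsub>M\<^esub> \<alpha>')) ws"
  shows "finite {n::nat. zeval M (c [^]\<^bsub>M\<^esub> n) ws = h}"
  by (rule assms(1)[unfolded power_separated_def, THEN spec, THEN spec, THEN spec,
        THEN mp, THEN mp, THEN mp, THEN mp, THEN mp, THEN mp]) (rule assms(2-))+

lemma hyperbolic_coverE:
  assumes "hyperbolic_cover \<Gamma> M \<pi>" "finite S" "S \<subseteq> carrier \<Gamma>"
  obtains \<rho> where "group_hom \<Gamma> SL2 \<rho>" "\<And>g. g \<in> S \<Longrightarrow> \<pi> g = \<one>\<^bsub>M\<^esub> \<Longrightarrow> \<rho> g = 1"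
    "\<And>g. g \<in> S \<Longrightarrow> \<pi> g \<noteq> \<one>\<^bsub>M\<^esub> \<Longrightarrow> \<bar>tr2 (\<rho> g)\<bar> > 2"
proof -
  obtain \<rho> where \<rho>: "\<rho> \<in> hom \<Gamma> SL2" "\<forall>g\<in>S. if \<pi> g = \<one>\<^bsub>M\<^esub> then \<rho> g = 1 else \<bar>tr2 (\<rho> g)\<bar> > 2"
    using assms unfolding hyperbolic_cover_def by meson
  show ?thesis
  proof (rule that)
    show "group_hom \<Gamma> SL2 \<rho>" using assms(1) \<rho>(1) group_SL2
      by (simp add: hyperbolic_cover_def group_hom_def group_hom_axioms_def)
  qed (use \<rho>(2) in \<open>simp_all split: if_splits\<close>)
qed

lemma (in group) commute_iff:
  "x \<in> carrier G \<Longrightarrow> y \<in> carrier G \<Longrightarrow> x \<otimes> y = y \<otimes> x \<longleftrightarrow> x \<otimes> y \<otimes> inv (y \<otimes> x) = \<one>"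
  by (metis inv_closed m_closed inv_equality inv_inv r_inv)

lemma (in group) commute_inv_imp:
  assumes "y \<in> carrier G" "g \<in> carrier G" "y \<otimes> g = g \<otimes> y"
  shows "inv y \<otimes> g = g \<otimes> inv y"
proof -
  have "inv y \<otimes> (y \<otimes> g) \<otimes> inv y = inv y \<otimes> (g \<otimes> y) \<otimes> inv y" by (simp only: assms(3))
  moreover have "inv y \<otimes> (y \<otimes> g) \<otimes> inv y = g \<otimes> inv y"
    using assms(1,2) by (simp add: m_assoc[symmetric])
  moreover have "inv y \<otimes> (g \<otimes> y) \<otimes> inv y = inv y \<otimes> g" using assms(1,2) by (simp add: m_assoc)
  ultimately show ?thesis by simp
qed

lemma (in group) commute_inv:
  assumes "y \<in> carrier G" "g \<in> carrier G"
  shows "inv y \<otimes> g = g \<otimes> inv y \<longleftrightarrow> y \<otimes> g = g \<otimes> y"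
  using commute_inv_imp[of y g] commute_inv_imp[of "inv y" g] assms by auto

lemma (in group) commute_of_commutator:
  assumes "g \<in> carrier G" "y \<in> carrier G" "g \<otimes> inv y \<otimes> inv g \<otimes> y = \<one>"
  shows "y \<otimes> g = g \<otimes> y"
proof -
  have "inv y = g \<otimes> inv y \<otimes> inv g"
    using inv_equality[OF assms(3)] assms(1,2) by simp
  then have "inv y \<otimes> g = g \<otimes> inv y \<otimes> inv g \<otimes> g" by simp
  also have "\<dots> = g \<otimes> inv y" using assms(1,2) by (simp add: m_assoc)
  finally show ?thesis using commute_inv assms by simp
qed

text \<open>A representation that is faithful on the commutators involved and makes \<open>c\<close> hyperbolic reduces this to
  \<open>hyperbolic_centralizer_commutes\<close>.\<close>

lemma hyperbolic_cover_commutative_transitive: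
  assumes "hyperbolic_cover \<Gamma> M \<pi>"
  shows "commutative_transitive M"
  unfolding commutative_transitive_def
proof (intro ballI impI)
  interpret P: group_hom \<Gamma> M \<pi> using assms
    by (simp add: hyperbolic_cover_def group_hom_def group_hom_axioms_def)
  have im: "\<pi> ` carrier \<Gamma> = carrier M" using assms unfolding hyperbolic_cover_def by (elim conjE)
  have surj: "\<exists>x\<in>carrier \<Gamma>. \<pi> x = y" if "y \<in> carrier M" for y
    using that unfolding im[symmetric] by auto
  fix a b c assume abc: "a \<in> carrier M" "b \<in> carrier M" "c \<in> carrier M" "c \<noteq> \<one>\<^bsub>M\<^esub>"
    "a \<otimes>\<^bsub>M\<^esub> c = c \<otimes>\<^bsub>M\<^esub> a" "b \<otimes>\<^bsub>M\<^esub> c = c \<otimes>\<^bsub>M\<^esub> b"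
  obtain x y z where xyz: "x \<in> carrier \<Gamma>" "y \<in> carrier \<Gamma>" "z \<in> carrier \<Gamma>" "\<pi> x = a" "\<pi> y = b" "\<pi> z = c"
    using surj abc by metis
  define k where "k u v = u \<otimes>\<^bsub>\<Gamma>\<^esub> v \<otimes>\<^bsub>\<Gamma>\<^esub> inv\<^bsub>\<Gamma>\<^esub> (v \<otimes>\<^bsub>\<Gamma>\<^esub> u)" for u v
  have k: "k u v \<in> carrier \<Gamma>" "\<pi> (k u v) = \<one>\<^bsub>M\<^esub> \<longleftrightarrow> \<pi> u \<otimes>\<^bsub>M\<^esub> \<pi> v = \<pi> v \<otimes>\<^bsub>M\<^esub> \<pi> u"
    if "u \<in> carrier \<Gamma>" "v \<in> carrier \<Gamma>" for u v
    using that P.H.commute_iff[of "\<pi> u" "\<pi> v"] by (simp_all add: k_def)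
  obtain \<rho> where \<rho>: "group_hom \<Gamma> SL2 \<rho>"
    "\<And>g. g \<in> {z, k x z, k y z, k x y} \<Longrightarrow> \<pi> g = \<one>\<^bsub>M\<^esub> \<Longrightarrow> \<rho> g = 1"
    "\<And>g. g \<in> {z, k x z, k y z, k x y} \<Longrightarrow> \<pi> g \<noteq> \<one>\<^bsub>M\<^esub> \<Longrightarrow> \<bar>tr2 (\<rho> g)\<bar> > 2"
    by (rule hyperbolic_coverE[OF assms, of "{z, k x z, k y z, k x y}"]) (use k xyz in auto)
  interpret R: group_hom \<Gamma> SL2 \<rho> by fact
  have kr: "\<rho> (k u v) = 1 \<longleftrightarrow> \<rho> u * \<rho> v = \<rho> v * \<rho> u" if "u \<in> carrier \<Gamma>" "v \<in> carrier \<Gamma>" for u v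
    using that R.H.commute_iff[of "\<rho> u" "\<rho> v"] R.hom_closed[OF that(1)] R.hom_closed[OF that(2)]
    by (simp add: k_def R.hom_mult)
  have com: "\<rho> x * \<rho> z = \<rho> z * \<rho> x" "\<rho> y * \<rho> z = \<rho> z * \<rho> y"
    using \<rho>(2)[of "k x z"] \<rho>(2)[of "k y z"] kr k(2) xyz abc by simp_all
  have "\<bar>tr2 (\<rho> z)\<bar> > 2" using \<rho>(3)[of z] xyz abc by simp
  moreover have "det2 (\<rho> z) = 1" using R.hom_closed[OF xyz(3)] by simp
  ultimately have "\<rho> x * \<rho> y = \<rho> y * \<rho> x"
    by (rule hyperbolic_centralizer_commutes[OF _ _ com, rotated])
  then have one: "\<rho> (k x y) = 1" by (rule iffD2[OF kr[OF xyz(1,2)]])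
  have "\<pi> (k x y) = \<one>\<^bsub>M\<^esub>"
  proof (rule ccontr)
    assume "\<pi> (k x y) \<noteq> \<one>\<^bsub>M\<^esub>"
    then have "\<bar>tr2 (\<rho> (k x y))\<bar> > 2" by (intro \<rho>(3)) auto
    then show False unfolding one by simp
  qed
  from iffD1[OF k(2)[OF xyz(1,2)] this] show "a \<otimes>\<^bsub>M\<^esub> b = b \<otimes>\<^bsub>M\<^esub> a" unfolding xyz .
qed

lemma nat_pow_SL2: "x [^]\<^bsub>SL2\<^esub> (n::nat) = x ^ n"
  by (induction n) (simp_all add: nat_pow_def SL2_def flip: power_Suc2)

lemma tr2_sgn_pow: "tr2 (sgn_pow C e) = tr2 C" "det2 (sgn_pow C e) = det2 C"
  by (simp_all add: sgn_pow_def adj2_def tr2_def det2_def)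

text \<open>Suppose a word with \<open>k\<close> letters takes the value \<open>h\<close> for \<open>2k + 1\<close> exponents. These finitely many
  equations, together with the nontriviality of \<open>c\<close> and of the junctions, concern finitely many elements
  of \<open>\<Gamma>\<close>, so they hold in some representation, against \<open>power_word_bound_SL2\<close>.\<close>

lemma hyperbolic_cover_power_separated:
  fixes M :: "('b, 'm) monoid_scheme"
  assumes cov: "hyperbolic_cover \<Gamma> M \<pi>"
  shows "power_separated M"
  unfolding power_separated_def
proof (intro allI impI)
  interpret P: group_hom \<Gamma> M \<pi> using assms
    by (simp add: hyperbolic_cover_def group_hom_def group_hom_axioms_def)
  have im: "\<pi> ` carrier \<Gamma> = carrier M" using assms unfolding hyperbolic_cover_def by (elim conjE)
  have "\<forall>y\<in>carrier M. \<exists>x\<in>carrier \<Gamma>. \<pi> x = y" unfolding im[symmetric] by auto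
  then obtain s where s: "\<And>y. y \<in> carrier M \<Longrightarrow> s y \<in> carrier \<Gamma>" "\<And>y. y \<in> carrier M \<Longrightarrow> \<pi> (s y) = y"
    by metis
  fix c h :: 'b and ws :: "('b \<times> bool \<times> 'b) list"
  assume c: "c \<in> carrier M" "c \<noteq> \<one>\<^bsub>M\<^esub>" and ws: "ws \<noteq> []" and h: "h \<in> carrier M"
    and mem: "\<forall>(\<alpha>, e, \<beta>) \<in> set ws. \<alpha> \<in> carrier M \<and> \<beta> \<in> carrier M"
    and sep: "successively (\<lambda>(\<alpha>, e, \<beta>) (\<alpha>', e', \<beta>').
        e \<noteq> e' \<longrightarrow> (\<beta> \<otimes>\<^bsub>M\<^esub> \<alpha>') \<otimes>\<^bsub>M\<^esub> c \<noteq> c \<otimes>\<^bsub>M\<^esub> (\<beta> \<otimes>\<^bsub>M\<^esub> \<alpha>')) ws"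
  show "finite {n::nat. zeval M (c [^]\<^bsub>M\<^esub> n) ws = h}"
  proof (rule ccontr)
    assume "infinite {n::nat. zeval M (c [^]\<^bsub>M\<^esub> n) ws = h}"
    then obtain B where B: "finite B" "card B = 2 * length ws + 1" "B \<subseteq> {n::nat. zeval M (c [^]\<^bsub>M\<^esub> n) ws = h}"
      using infinite_arbitrarily_large by blast
    define d where "d = s c"
    define us where "us = map_word s ws"
    have us: "\<forall>(\<alpha>, e, \<beta>) \<in> set us. \<alpha> \<in> carrier \<Gamma> \<and> \<beta> \<in> carrier \<Gamma>"
      using mem s(1) by (auto simp: us_def map_word_def)
    have d: "d \<in> carrier \<Gamma>" "\<pi> d = c" using c s by (auto simp: d_def)
    have pus: "map_word \<pi> us = ws"
      using mem s(2) unfolding us_def map_word_def map_map by (intro map_idI) (auto split: prod.splits)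
    define v where "v n = zeval \<Gamma> (d [^]\<^bsub>\<Gamma>\<^esub> n) us \<otimes>\<^bsub>\<Gamma>\<^esub> inv\<^bsub>\<Gamma>\<^esub> s h" for n :: nat
    have z: "zeval \<Gamma> (d [^]\<^bsub>\<Gamma>\<^esub> n) us \<in> carrier \<Gamma>" for n :: nat
      using us d by (intro P.G.zeval_closed) auto
    have v: "v n \<in> carrier \<Gamma>" for n using z s(1)[OF h] by (simp add: v_def)
    have pv: "\<pi> (v n) = \<one>\<^bsub>M\<^esub>" if "n \<in> B" for n
    proof -
      have "\<pi> (zeval \<Gamma> (d [^]\<^bsub>\<Gamma>\<^esub> n) us) = zeval M (c [^]\<^bsub>M\<^esub> n) ws"
        using P.hom_zeval[OF _ us, of "d [^]\<^bsub>\<Gamma>\<^esub> n"] d pus by (simp add: P.hom_nat_pow)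
      then have "\<pi> (zeval \<Gamma> (d [^]\<^bsub>\<Gamma>\<^esub> n) us) = h" using B(3) that by auto
      then show ?thesis using z s[OF h] h by (simp add: v_def)
    qed
    \<comment> \<open>\<open>J\<close> contains the coefficients between neighbouring letters, and \<open>K\<close> the elements
      \<open>g c\<^sup>e\<^sup>' g\<^sup>-\<^sup>1 c\<^sup>e\<close> whose traces decide whether the powers around \<open>g\<close> cancel.\<close>
    define J where "J = (\<lambda>(w, w'). snd (snd w) \<otimes>\<^bsub>\<Gamma>\<^esub> fst w') ` (set us \<times> set us)"
    define K where "K = (\<lambda>(g, e, e'). g \<otimes>\<^bsub>\<Gamma>\<^esub> zpow \<Gamma> d e' \<otimes>\<^bsub>\<Gamma>\<^esub> inv\<^bsub>\<Gamma>\<^esub> g \<otimes>\<^bsub>\<Gamma>\<^esub> zpow \<Gamma> d e) ` (J \<times> UNIV)"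
    have us': "fst w \<in> carrier \<Gamma>" "snd (snd w) \<in> carrier \<Gamma>" if "w \<in> set us" for w
      using bspec[OF us that] by (simp_all add: case_prod_unfold)
    have J: "finite J" by (simp add: J_def)
    have J': "J \<subseteq> carrier \<Gamma>" unfolding J_def using us' by (auto simp del: split_paired_All)
    have K: "finite K" using J by (simp add: K_def)
    have K': "K \<subseteq> carrier \<Gamma>"
      unfolding K_def using subsetD[OF J'] P.G.zpow_closed[OF d(1)] by auto
    obtain \<rho> where \<rho>: "group_hom \<Gamma> SL2 \<rho>"
      "\<And>g. g \<in> {d} \<union> v ` B \<union> J \<union> K \<Longrightarrow> \<pi> g = \<one>\<^bsub>M\<^esub> \<Longrightarrow> \<rho> g = 1"
      "\<And>g. g \<in> {d} \<union> v ` B \<union> J \<union> K \<Longrightarrow> \<pi> g \<noteq> \<one>\<^bsub>M\<^esub> \<Longrightarrow> \<bar>tr2 (\<rho> g)\<bar> > 2"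
      by (rule hyperbolic_coverE[OF assms, of "{d} \<union> v ` B \<union> J \<union> K"]) (use B d v J K J' K' in auto)
    interpret R: group_hom \<Gamma> SL2 \<rho> by fact
    define C where "C = \<rho> d"
    have rdet: "det2 (\<rho> g) = 1" if "g \<in> carrier \<Gamma>" for g using R.hom_closed[OF that] by simp
    have C: "det2 C = 1" "\<bar>tr2 C\<bar> > 2" using \<rho>(3)[of d] d c rdet by (auto simp: C_def)
    have rz: "\<rho> (zpow \<Gamma> d e) = sgn_pow C e" for e
      using R.hom_zpow[OF d(1)] C by (simp add: C_def zpow_SL2)
    have junction: "tr2 (\<rho> \<beta> * \<rho> \<alpha>' * sgn_pow C e' * adj2 (\<rho> \<beta> * \<rho> \<alpha>') * sgn_pow C e) \<noteq> 2"
      if w: "(\<alpha>, e, \<beta>) \<in> set us" "(\<alpha>', e', \<beta>') \<in> set us"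
        and ne: "e \<noteq> e' \<longrightarrow> (\<pi> \<beta> \<otimes>\<^bsub>M\<^esub> \<pi> \<alpha>') \<otimes>\<^bsub>M\<^esub> c \<noteq> c \<otimes>\<^bsub>M\<^esub> (\<pi> \<beta> \<otimes>\<^bsub>M\<^esub> \<pi> \<alpha>')" for \<alpha> e \<beta> \<alpha>' e' \<beta>'
    proof -
      define g where "g = \<beta> \<otimes>\<^bsub>\<Gamma>\<^esub> \<alpha>'"
      have ab: "\<beta> \<in> carrier \<Gamma>" "\<alpha>' \<in> carrier \<Gamma>" using us w by auto
      then have g: "g \<in> carrier \<Gamma>" by (simp add: g_def)
      have gJ: "g \<in> J" unfolding J_def g_def
        using w by (intro image_eqI[of _ _ "((\<alpha>, e, \<beta>), (\<alpha>', e', \<beta>'))"]) auto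
      define x where "x = g \<otimes>\<^bsub>\<Gamma>\<^esub> zpow \<Gamma> d e' \<otimes>\<^bsub>\<Gamma>\<^esub> inv\<^bsub>\<Gamma>\<^esub> g \<otimes>\<^bsub>\<Gamma>\<^esub> zpow \<Gamma> d e"
      have xK: "x \<in> K" unfolding K_def x_def using gJ by (intro image_eqI[of _ _ "(g, e, e')"]) auto
      have rg: "\<rho> g = \<rho> \<beta> * \<rho> \<alpha>'" using ab by (simp add: g_def R.hom_mult)
      have rx: "\<rho> x = \<rho> g * sgn_pow C e' * adj2 (\<rho> g) * sgn_pow C e"
        using g d P.G.zpow_closed[OF d(1)] rdet[OF g] by (simp add: x_def R.hom_mult rz R.hom_inv inv_SL2)
      have "tr2 (\<rho> x) \<noteq> 2"
      proof (cases "\<pi> x = \<one>\<^bsub>M\<^esub>")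
        case False
        then show ?thesis using \<rho>(3)[of x] xK by auto
      next
        case True
        have px: "\<pi> x = \<pi> g \<otimes>\<^bsub>M\<^esub> zpow M c e' \<otimes>\<^bsub>M\<^esub> inv\<^bsub>M\<^esub> \<pi> g \<otimes>\<^bsub>M\<^esub> zpow M c e"
          using g d P.G.zpow_closed[OF d(1)] by (simp add: x_def P.hom_zpow)
        have pg: "\<pi> g = \<pi> \<beta> \<otimes>\<^bsub>M\<^esub> \<pi> \<alpha>'" "\<pi> g \<in> carrier M" using ab by (simp_all add: g_def)
        \<comment> \<open>A trivial junction means \<open>g c\<^sup>e\<^sup>' g\<^sup>-\<^sup>1 = c\<^sup>-\<^sup>e\<close>. For opposite signs \<open>g\<close> would commute with \<open>c\<close>.
          For equal signs \<open>g\<close> inverts \<open>c\<close>, so its image has trace \<open>0\<close>, which neither the identity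
          nor a hyperbolic matrix has.\<close>
        have same: "e = e'"
        proof (rule ccontr)
          assume ee: "e \<noteq> e'"
          then have neq: "\<pi> g \<otimes>\<^bsub>M\<^esub> c \<noteq> c \<otimes>\<^bsub>M\<^esub> \<pi> g" using ne pg by simp
          have y: "zpow M c e \<in> carrier M" "zpow M c e' = inv\<^bsub>M\<^esub> zpow M c e"
            using c ee by (auto simp: zpow_def)
          have "\<pi> g \<otimes>\<^bsub>M\<^esub> inv\<^bsub>M\<^esub> zpow M c e \<otimes>\<^bsub>M\<^esub> inv\<^bsub>M\<^esub> \<pi> g \<otimes>\<^bsub>M\<^esub> zpow M c e = \<one>\<^bsub>M\<^esub>"
            using True px y by simp
          from P.H.commute_of_commutator[OF pg(2) y(1) this]
          have com: "zpow M c e \<otimes>\<^bsub>M\<^esub> \<pi> g = \<pi> g \<otimes>\<^bsub>M\<^esub> zpow M c e" .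
          have "c \<otimes>\<^bsub>M\<^esub> \<pi> g = \<pi> g \<otimes>\<^bsub>M\<^esub> c"
            using com P.H.commute_inv[OF c(1) pg(2)] by (cases e) (simp_all add: zpow_def)
          then show False using neq by simp
        qed
        have "\<rho> x = 1" using \<rho>(2)[of x] xK True by auto
        then have "(\<rho> g * sgn_pow C e * adj2 (\<rho> g)) * sgn_pow C e = 1" using rx same by simp
        then have "sgn_pow C e * ((\<rho> g * sgn_pow C e * adj2 (\<rho> g))) = 1"
          using C adj2_inverse[of "sgn_pow C e"] tr2_sgn_pow(2)[of C e]
          by (metis mult.assoc mult.right_neutral mult_1)
        then have "(sgn_pow C e * \<rho> g * sgn_pow C e) * (adj2 (\<rho> g) * \<rho> g) = \<rho> g"
          by (metis mult.assoc mult_1)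
        then have "sgn_pow C e * \<rho> g * sgn_pow C e = \<rho> g" using adj2_inverse[OF rdet[OF g]] by simp
        then have "tr2 (\<rho> g) = 0"
          using C by (intro inverted_hyperbolic_trace[of "sgn_pow C e"]) (simp_all add: tr2_sgn_pow)
        moreover have "\<rho> g = 1 \<or> \<bar>tr2 (\<rho> g)\<bar> > 2" using \<rho>(2,3)[of g] gJ by blast
        ultimately show ?thesis by auto
      qed
      then show ?thesis unfolding rx rg .
    qed
    define vs where "vs = map_word \<rho> us"
    have sep': "successively (\<lambda>(\<alpha>, e, \<beta>) (\<alpha>', e', \<beta>').
        e \<noteq> e' \<longrightarrow> (\<pi> \<beta> \<otimes>\<^bsub>M\<^esub> \<pi> \<alpha>') \<otimes>\<^bsub>M\<^esub> c \<noteq> c \<otimes>\<^bsub>M\<^esub> (\<pi> \<beta> \<otimes>\<^bsub>M\<^esub> \<pi> \<alpha>')) us"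
      using sep unfolding pus[symmetric] map_word_def successively_map by (simp add: case_prod_unfold)
    have "successively (\<lambda>(\<alpha>, e, \<beta>) (\<alpha>', e', \<beta>').
        tr2 (\<beta> * \<alpha>' * sgn_pow C e' * adj2 (\<beta> * \<alpha>') * sgn_pow C e) \<noteq> 2) vs"
      unfolding vs_def map_word_def successively_map
      by (rule successively_mono[OF sep']) (use junction in \<open>auto split: prod.splits\<close>)
    moreover have "\<forall>(\<alpha>, e, \<beta>) \<in> set vs. det2 \<alpha> = 1 \<and> det2 \<beta> = 1"
      using us rdet by (auto simp: vs_def map_word_def)
    moreover have "vs \<noteq> []" using ws by (simp add: vs_def us_def map_word_def)
    ultimately have bound: "finite {n. zeval SL2 (C ^ n) vs = \<rho> (s h)}"
      "card {n. zeval SL2 (C ^ n) vs = \<rho> (s h)} \<le> 2 * length vs"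
      using power_word_bound_SL2[OF C, of vs "\<rho> (s h)"] by blast+
    have sub: "B \<subseteq> {n. zeval SL2 (C ^ n) vs = \<rho> (s h)}"
    proof
      fix n assume n: "n \<in> B"
      have "\<rho> (v n) = 1" using \<rho>(2)[of "v n"] n pv by blast
      then have "\<rho> (zeval \<Gamma> (d [^]\<^bsub>\<Gamma>\<^esub> n) us) * adj2 (\<rho> (s h)) = 1"
        using z s(1)[OF h] rdet by (simp add: v_def R.hom_mult R.hom_inv inv_SL2)
      then have "\<rho> (zeval \<Gamma> (d [^]\<^bsub>\<Gamma>\<^esub> n) us) = \<rho> (s h)"
        using adj2_inverse[OF rdet[OF s(1)[OF h]]] by (metis mult.assoc mult.right_neutral mult_1)
      moreover have "\<rho> (zeval \<Gamma> (d [^]\<^bsub>\<Gamma>\<^esub> n) us) = zeval SL2 (C ^ n) vs"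
        using R.hom_zeval[OF _ us, of "d [^]\<^bsub>\<Gamma>\<^esub> n"] d(1)
        by (simp add: R.hom_nat_pow nat_pow_SL2 C_def vs_def)
      ultimately show "n \<in> {n. zeval SL2 (C ^ n) vs = \<rho> (s h)}" by simp
    qed
    have "card B \<le> 2 * length vs" by (rule order_trans[OF card_mono[OF bound(1) sub] bound(2)])
    then show False using B(2) by (simp add: vs_def us_def map_word_def)
  qed
qed

lemma hyperbolic_cover_iso:
  assumes "hyperbolic_cover \<Gamma> M \<pi>" "\<phi> \<in> iso M M'" "group M'"
  shows "hyperbolic_cover \<Gamma> M' (\<phi> \<circ> \<pi>)"
proof -
  have grp: "group \<Gamma>" "group M" and hom: "\<pi> \<in> hom \<Gamma> M" and surj: "\<pi> ` carrier \<Gamma> = carrier M"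
    using assms(1) by (simp_all add: hyperbolic_cover_def)
  have \<phi>: "\<phi> \<in> hom M M'" using assms(2) by (simp add: iso_def)
  interpret F: group_hom M M' \<phi>
    using grp(2) assms(3) \<phi> by (simp add: group_hom_def group_hom_axioms_def)
  have inj: "inj_on \<phi> (carrier M)" "\<phi> ` carrier M = carrier M'"
    using assms(2) by (auto simp: iso_def bij_betw_def)
  have p: "\<pi> g \<in> carrier M" if "g \<in> carrier \<Gamma>" for g
    using assms(1) that unfolding hyperbolic_cover_def by blast
  have "\<phi> x = \<one>\<^bsub>M'\<^esub> \<longleftrightarrow> x = \<one>\<^bsub>M\<^esub>" if "x \<in> carrier M" for x
    using inj_onD[OF inj(1), of x "\<one>\<^bsub>M\<^esub>"] that by auto
  then have one: "(\<phi> \<circ> \<pi>) g = \<one>\<^bsub>M'\<^esub> \<longleftrightarrow> \<pi> g = \<one>\<^bsub>M\<^esub>" if "g \<in> carrier \<Gamma>" for g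
    using p[OF that] by simp
  have "\<phi> \<circ> \<pi> \<in> hom \<Gamma> M'" using hom \<phi> by (rule hom_compose)
  moreover have "(\<phi> \<circ> \<pi>) ` carrier \<Gamma> = carrier M'"
    unfolding image_comp[symmetric] surj inj(2) ..
  moreover have "\<exists>\<rho>\<in>hom \<Gamma> SL2. \<forall>g\<in>S. if (\<phi> \<circ> \<pi>) g = \<one>\<^bsub>M'\<^esub> then \<rho> g = 1 else \<bar>tr2 (\<rho> g)\<bar> > 2"
    if S: "finite S" "S \<subseteq> carrier \<Gamma>" for S
  proof -
    obtain \<rho> where \<rho>: "\<rho> \<in> hom \<Gamma> SL2" "\<forall>g\<in>S. if \<pi> g = \<one>\<^bsub>M\<^esub> then \<rho> g = 1 else \<bar>tr2 (\<rho> g)\<bar> > 2"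
      using assms(1) S unfolding hyperbolic_cover_def by meson
    have "\<forall>g\<in>S. if (\<phi> \<circ> \<pi>) g = \<one>\<^bsub>M'\<^esub> then \<rho> g = 1 else \<bar>tr2 (\<rho> g)\<bar> > 2"
    proof
      fix g assume g: "g \<in> S"
      then show "if (\<phi> \<circ> \<pi>) g = \<one>\<^bsub>M'\<^esub> then \<rho> g = 1 else \<bar>tr2 (\<rho> g)\<bar> > 2"
        using \<rho>(2)[rule_format, OF g] one[OF subsetD[OF S(2) g]] by (simp only:)
    qed
    then show ?thesis using \<rho>(1) by (rule bexI)
  qed
  ultimately show ?thesis using assms(3) grp(1) unfolding hyperbolic_cover_def by (intro conjI allI impI)
qed

lemma hyperbolic_cover_free_group:
  fixes X :: "nat set"
  shows "hyperbolic_cover (free_group X) (free_group X) id"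
proof -
  have g: "group (free_group X)" by (simp add: free_group_def group_presented_group)
  have "\<exists>\<rho>\<in>hom (free_group X) SL2. \<forall>g\<in>S.
      if id g = \<one>\<^bsub>free_group X\<^esub> then \<rho> g = 1 else \<bar>tr2 (\<rho> g)\<bar> > 2"
    if S: "finite S" "S \<subseteq> carrier (free_group X)" for S
  proof -
    obtain \<rho> where \<rho>: "\<rho> \<in> hom (free_group X) SL2"
      "\<And>g. g \<in> S \<Longrightarrow> g \<noteq> \<one>\<^bsub>free_group X\<^esub> \<Longrightarrow> \<bar>tr2 (\<rho> g)\<bar> > 2"
      by (rule free_group_hyperbolic_hom[OF S]) auto
    moreover have "\<rho> \<one>\<^bsub>free_group X\<^esub> = 1" using hom_one[OF \<rho>(1) g group_SL2] by simp
    ultimately show ?thesis by (intro bexI[of _ \<rho>]) auto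
  qed
  then show ?thesis using g by (auto simp: hyperbolic_cover_def hom_def)
qed

lemma normal_limit_kernel:
  assumes "group \<Gamma>" "group F" "stable_sequence \<Gamma> F f"
  shows "limit_kernel \<Gamma> F f \<lhd> \<Gamma>"
proof -
  interpret G: group \<Gamma> by fact
  have h: "group_hom \<Gamma> F (f i)" for i
    using assms by (simp add: stable_sequence_def group_hom_def group_hom_axioms_def)
  then have k: "kernel \<Gamma> F (f i) \<lhd> \<Gamma>" for i by (rule group_hom.normal_kernel)
  have sub: "subgroup (kernel \<Gamma> F (f i)) \<Gamma>" for i using k by (rule normal_imp_subgroup)
  note op = subgroup.m_closed[OF sub] subgroup.m_inv_closed[OF sub] subgroup.one_closed[OF sub]
  have "subgroup (limit_kernel \<Gamma> F f) \<Gamma>"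
  proof (rule G.subgroupI)
    have "\<one>\<^bsub>\<Gamma>\<^esub> \<in> limit_kernel \<Gamma> F f" by (simp add: limit_kernel_def op)
    then show "limit_kernel \<Gamma> F f \<noteq> {}" by blast
  next
    fix a assume "a \<in> limit_kernel \<Gamma> F f"
    then show "inv\<^bsub>\<Gamma>\<^esub> a \<in> limit_kernel \<Gamma> F f"
      by (auto simp: limit_kernel_def elim!: eventually_mono intro: op)
  next
    fix a b assume "a \<in> limit_kernel \<Gamma> F f" "b \<in> limit_kernel \<Gamma> F f"
    then show "a \<otimes>\<^bsub>\<Gamma>\<^esub> b \<in> limit_kernel \<Gamma> F f"
      by (auto simp: limit_kernel_def elim: eventually_elim2 intro: op)
  qed (auto simp: limit_kernel_def)
  moreover have "x \<otimes>\<^bsub>\<Gamma>\<^esub> a \<otimes>\<^bsub>\<Gamma>\<^esub> inv\<^bsub>\<Gamma>\<^esub> x \<in> limit_kernel \<Gamma> F f"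
    if "x \<in> carrier \<Gamma>" "a \<in> limit_kernel \<Gamma> F f" for x a
    using that normal.inv_op_closed2[OF k] 
    by (auto simp: limit_kernel_def elim!: eventually_mono)
  ultimately show ?thesis by (simp add: G.normal_inv_iff)
qed

text \<open>For a finite \<open>S\<close>, stability provides a term of the sequence whose kernel agrees with the limit kernel
  on \<open>S\<close>. Compose it with a representation of the free group that is hyperbolic on the image of \<open>S\<close>.\<close>

theorem limit_group_hyperbolic_cover:
  assumes "limit_group L"
  obtains \<Gamma> :: "nat monoid" and \<pi> where "hyperbolic_cover \<Gamma> L \<pi>"
proof -
  obtain \<Gamma> :: "nat monoid" and X :: "nat set" and f where f: "finitely_generated \<Gamma>"
    "stable_sequence \<Gamma> (free_group X) f" "L \<cong> \<Gamma> Mod limit_kernel \<Gamma> (free_group X) f"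
    using assms unfolding limit_group_def by (elim conjE exE) (rule that)
  have L: "group L" using assms by (simp add: limit_group_def finitely_generated_def)
  have grp: "group \<Gamma>" using f(1) by (simp add: finitely_generated_def)
  have fr: "group (free_group X)" by (simp add: free_group_def group_presented_group)
  interpret G: group \<Gamma> by (rule grp)
  define K where "K = limit_kernel \<Gamma> (free_group X) f"
  interpret K: normal K \<Gamma> unfolding K_def by (rule normal_limit_kernel[OF grp fr f(2)])
  have "\<Gamma> Mod K \<cong> L" using group.iso_sym[OF L f(3)] by (simp only: K_def)
  then obtain \<psi> where \<psi>: "\<psi> \<in> iso (\<Gamma> Mod K) L" unfolding is_iso_def by blast
  have "hyperbolic_cover \<Gamma> (\<Gamma> Mod K) (\<lambda>g. K #>\<^bsub>\<Gamma>\<^esub> g)"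
    unfolding hyperbolic_cover_def
  proof (intro conjI allI impI)
    show "(\<lambda>g. K #>\<^bsub>\<Gamma>\<^esub> g) \<in> hom \<Gamma> (\<Gamma> Mod K)" by (rule K.r_coset_hom_Mod)
    show "(\<lambda>g. K #>\<^bsub>\<Gamma>\<^esub> g) ` carrier \<Gamma> = carrier (\<Gamma> Mod K)"
      by (auto simp: FactGroup_def RCOSETS_def)
    fix S assume S: "finite S" "S \<subseteq> carrier \<Gamma>"
    have coset: "K #>\<^bsub>\<Gamma>\<^esub> g = \<one>\<^bsub>\<Gamma> Mod K\<^esub> \<longleftrightarrow> g \<in> K" if "g \<in> carrier \<Gamma>" for g
      using G.coset_join1[OF _ that K.subgroup_axioms] G.coset_join2[OF that K.subgroup_axioms]
      by (auto simp: FactGroup_def K.subset)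
    have "\<forall>\<^sub>F i in sequentially. f i g = \<one>\<^bsub>free_group X\<^esub> \<longleftrightarrow> g \<in> K" if "g \<in> S" for g
    proof -
      have g: "g \<in> carrier \<Gamma>" using S that by blast
      show ?thesis
      proof (cases "g \<in> K")
        case True
        then have "\<forall>\<^sub>F i in sequentially. g \<in> kernel \<Gamma> (free_group X) (f i)"
          unfolding K_def limit_kernel_def by blast
        then show ?thesis by (rule eventually_mono) (use True in \<open>unfold kernel_def, blast\<close>)
      next
        case False
        then have "\<not> (\<forall>\<^sub>F i in sequentially. g \<in> kernel \<Gamma> (free_group X) (f i))"
          using g unfolding K_def limit_kernel_def by blast
        then have "\<forall>\<^sub>F i in sequentially. g \<notin> kernel \<Gamma> (free_group X) (f i)"
          using f(2) g unfolding stable_sequence_def by blast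
        then show ?thesis by (rule eventually_mono) (use False g in \<open>unfold kernel_def, blast\<close>)
      qed
    qed
    then have "\<forall>\<^sub>F i in sequentially. \<forall>g\<in>S. f i g = \<one>\<^bsub>free_group X\<^esub> \<longleftrightarrow> g \<in> K"
      by (intro eventually_ball_finite[OF S(1)]) blast
    then obtain i where i: "\<forall>g\<in>S. f i g = \<one>\<^bsub>free_group X\<^esub> \<longleftrightarrow> g \<in> K"
      using eventually_happens'[OF sequentially_bot] by blast
    have fi: "f i \<in> hom \<Gamma> (free_group X)" using f(2) by (simp add: stable_sequence_def)
    have "finite (f i ` S)" using S(1) by (rule finite_imageI)
    moreover have "f i ` S \<subseteq> carrier (free_group X)"
      using hom_carrier[OF fi] S(2) by blast
    ultimately obtain \<rho> where \<rho>: "group_hom (free_group X) SL2 \<rho>"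
      "\<And>g. g \<in> f i ` S \<Longrightarrow> id g = \<one>\<^bsub>free_group X\<^esub> \<Longrightarrow> \<rho> g = 1"
      "\<And>g. g \<in> f i ` S \<Longrightarrow> id g \<noteq> \<one>\<^bsub>free_group X\<^esub> \<Longrightarrow> \<bar>tr2 (\<rho> g)\<bar> > 2"
      by (rule hyperbolic_coverE[OF hyperbolic_cover_free_group]) (rule that)
    have \<rho>h: "\<rho> \<in> hom (free_group X) SL2" using \<rho>(1) by (rule group_hom.homh)
    show "\<exists>\<rho>\<in>hom \<Gamma> SL2. \<forall>g\<in>S. if K #>\<^bsub>\<Gamma>\<^esub> g = \<one>\<^bsub>\<Gamma> Mod K\<^esub> then \<rho> g = 1 else \<bar>tr2 (\<rho> g)\<bar> > 2"
    proof (intro bexI ballI)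
      show "\<rho> \<circ> f i \<in> hom \<Gamma> SL2" using hom_compose[OF fi \<rho>h] .
      fix g assume g: "g \<in> S"
      show "if K #>\<^bsub>\<Gamma>\<^esub> g = \<one>\<^bsub>\<Gamma> Mod K\<^esub> then (\<rho> \<circ> f i) g = 1 else \<bar>tr2 ((\<rho> \<circ> f i) g)\<bar> > 2"
        using \<rho>(2,3)[OF imageI[OF g]] i[rule_format, OF g] coset[OF subsetD[OF S(2) g]]
        by (simp only: o_apply id_apply split: if_split) blast
    qed
  next
    show "group \<Gamma>" by (rule grp)
    show "group (\<Gamma> Mod K)" by (rule K.factorgroup_is_group)
  qed
  from hyperbolic_cover_iso[OF this \<psi> L] show ?thesis by (rule that)
qed

section \<open>Compact groups: recurrence, and generic injectivity\<close>

locale compact_top_group =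
  fixes G (structure) and T
  assumes compact_group: "compact_group G T"

sublocale compact_top_group \<subseteq> group G
  using compact_group by (simp add: compact_group_def)

context compact_top_group
begin

lemma topspace_eq [simp]: "topspace T = carrier G"
  and Hausdorff: "Hausdorff_space T" and compact: "compact_space T"
  using compact_group by (simp_all add: compact_group_def)

lemma continuous_mult:
  assumes "continuous_map X T f" "continuous_map X T g"
  shows "continuous_map X T (\<lambda>x. f x \<otimes> g x)"
proof -
  have "continuous_map (prod_topology T T) T (\<lambda>(x, y). x \<otimes> y)"
    using compact_group by (simp add: compact_group_def)
  moreover have "continuous_map X (prod_topology T T) (\<lambda>x. (f x, g x))"
    using assms by (simp add: continuous_map_paired)
  ultimately have "continuous_map X T ((\<lambda>(x, y). x \<otimes> y) \<circ> (\<lambda>x. (f x, g x)))"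
    by (rule continuous_map_compose[rotated])
  then show ?thesis by (simp add: o_def)
qed

lemma continuous_inv:
  assumes "continuous_map X T f"
  shows "continuous_map X T (\<lambda>x. inv f x)"
proof -
  have "continuous_map T T (\<lambda>x. inv x)"
    using compact_group by (simp add: compact_group_def)
  then have "continuous_map X T ((\<lambda>x. inv x) \<circ> f)" using assms by (rule continuous_map_compose[rotated])
  then show ?thesis by (simp add: o_def)
qed

lemma continuous_zeval:
  assumes "continuous_map X T f" "\<forall>(\<alpha>, e, \<beta>) \<in> set ws. \<alpha> \<in> carrier G \<and> \<beta> \<in> carrier G"
  shows "continuous_map X T (\<lambda>x. zeval G (f x) ws)"
  using assms(2)
proof (induction ws)
  case (Cons w ws)
  obtain \<alpha> e \<beta> where w: "w = (\<alpha>, e, \<beta>)" by (metis prod_cases3)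
  have "continuous_map X T (\<lambda>x. zpow G (f x) e)"
    using assms(1) continuous_inv by (cases e) (simp_all add: zpow_def)
  then show ?case using Cons w
    by (simp, intro continuous_mult) simp_all
qed simp

lemma closure_subgroup:
  assumes "subgroup D G"
  shows "subgroup (T closure_of D) G"
proof (rule subgroupI)
  have D: "D \<subseteq> T closure_of D" "D \<subseteq> carrier G"
    using closure_of_subset[of D T] subgroup.subset[OF assms] by auto
  show "T closure_of D \<subseteq> carrier G" using closure_of_subset_topspace[of T D] by simp
  show "T closure_of D \<noteq> {}" using D subgroup.one_closed[OF assms] by blast
  have "continuous_map T T (\<lambda>x. inv x)" using compact_group by (simp add: compact_group_def)
  from continuous_map_image_closure_subset[OF this, of D]
  have "(\<lambda>x. inv x) ` (T closure_of D) \<subseteq> T closure_of ((\<lambda>x. inv x) ` D)" .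
  moreover have "(\<lambda>x. inv x) ` D \<subseteq> D" using subgroup.m_inv_closed[OF assms] by auto
  ultimately show "inv a \<in> T closure_of D" if "a \<in> T closure_of D" for a
    using closure_of_mono[of "(\<lambda>x. inv x) ` D" D T] that by blast
  have "continuous_map (prod_topology T T) T (\<lambda>(x, y). x \<otimes> y)"
    using compact_group by (simp add: compact_group_def)
  from continuous_map_image_closure_subset[OF this, of "D \<times> D"]
  have "(\<lambda>(x, y). x \<otimes> y) ` ((T closure_of D) \<times> (T closure_of D)) \<subseteq> T closure_of ((\<lambda>(x, y). x \<otimes> y) ` (D \<times> D))"
    by (simp only: closure_of_Times)
  moreover have "(\<lambda>(x, y). x \<otimes> y) ` (D \<times> D) \<subseteq> D" using subgroup.m_closed[OF assms] by auto
  ultimately show "a \<otimes> b \<in> T closure_of D" if "a \<in> T closure_of D" "b \<in> T closure_of D" for a b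
    using closure_of_mono[of "(\<lambda>(x, y). x \<otimes> y) ` (D \<times> D)" D T] that by blast
qed

lemma closure_commutes:
  assumes "z \<in> T closure_of D" "d \<in> carrier G" "\<And>x. x \<in> D \<Longrightarrow> x \<otimes> d = d \<otimes> x"
  shows "z \<otimes> d = d \<otimes> z"
proof -
  have id: "continuous_map T T (\<lambda>x. x)" by simp
  have const: "continuous_map T T (\<lambda>x. d)" using assms(2) by simp
  show ?thesis
    by (rule forall_in_closure_of_eq[OF assms(1) Hausdorff continuous_mult[OF id const]
          continuous_mult[OF const id] assms(3)])
qed

text \<open>Cover the group by open sets \<open>V\<close> with \<open>V\<^sup>-\<^sup>1 V \<subseteq> U\<close>. Some member of a finite subcover contains \<open>c\<^sup>n\<close> for
  infinitely many \<open>n\<close>, and differences of these exponents work.\<close>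

lemma powers_recur:
  assumes c: "c \<in> carrier G" and U: "openin T U" "\<one> \<in> U"
  shows "infinite {n::nat. c [^] n \<in> U}"
proof -
  have fst: "continuous_map (prod_topology T T) T (\<lambda>p. fst p)"
    and snd: "continuous_map (prod_topology T T) T (\<lambda>p. snd p)"
    by (simp_all add: continuous_map_fst continuous_map_snd)
  have "openin (prod_topology T T)
      {p \<in> topspace (prod_topology T T). inv (fst p) \<otimes> snd p \<in> U}"
    by (rule openin_continuous_map_preimage[OF continuous_mult[OF continuous_inv[OF fst] snd] U(1)])
  then have op: "\<exists>V W. openin T V \<and> openin T W \<and> p \<in> V \<and> p \<in> W \<and>
      V \<times> W \<subseteq> {p \<in> topspace (prod_topology T T). inv (fst p) \<otimes> snd p \<in> U}"
    if "p \<in> carrier G" for p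
    unfolding openin_prod_topology_alt using that U(2) by simp
  have "\<exists>V. openin T V \<and> p \<in> V \<and> (\<forall>x\<in>V. \<forall>y\<in>V. inv x \<otimes> y \<in> U)" if "p \<in> carrier G" for p
  proof -
    obtain V W where VW: "openin T V" "openin T W" "p \<in> V" "p \<in> W"
      "V \<times> W \<subseteq> {p \<in> topspace (prod_topology T T). inv (fst p) \<otimes> snd p \<in> U}"
      using op[OF \<open>p \<in> carrier G\<close>] by blast
    then have "inv x \<otimes> y \<in> U" if "x \<in> V \<inter> W" "y \<in> V \<inter> W" for x y
      using subsetD[OF VW(5), of "(x, y)"] that by simp
    then show ?thesis using VW by (intro exI[of _ "V \<inter> W"]) auto
  qed
  then obtain V where V: "\<And>p. p \<in> carrier G \<Longrightarrow> openin T (V p)" "\<And>p. p \<in> carrier G \<Longrightarrow> p \<in> V p"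
    "\<And>p x y. p \<in> carrier G \<Longrightarrow> x \<in> V p \<Longrightarrow> y \<in> V p \<Longrightarrow> inv x \<otimes> y \<in> U"
    by metis
  have "(\<forall>U\<in>V ` carrier G. openin T U) \<and> topspace T \<subseteq> \<Union> (V ` carrier G)" using V(1,2) by auto
  then obtain \<F> where F: "finite \<F>" "\<F> \<subseteq> V ` carrier G" "carrier G \<subseteq> \<Union> \<F>"
    using compact unfolding compact_space_alt by (metis topspace_eq)
  have "(UNIV :: nat set) \<subseteq> (\<Union>W\<in>\<F>. {n. c [^] n \<in> W})"
  proof
    fix n :: nat
    have "c [^] n \<in> carrier G" using c by (rule nat_pow_closed)
    then show "n \<in> (\<Union>W\<in>\<F>. {n. c [^] n \<in> W})" using F(3) by blast
  qed
  then have union: "infinite (\<Union>W\<in>\<F>. {n::nat. c [^] n \<in> W})"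
    using infinite_UNIV_nat by (rule infinite_super)
  have "\<exists>W\<in>\<F>. infinite {n::nat. c [^] n \<in> W}"
  proof (rule ccontr)
    assume "\<not> ?thesis"
    then have "finite (\<Union>W\<in>\<F>. {n::nat. c [^] n \<in> W})" by (intro finite_UN_I[OF F(1)]) blast
    with union show False by contradiction
  qed
  then obtain W where W: "W \<in> \<F>" "infinite {n::nat. c [^] n \<in> W}" by (rule bexE)
  obtain p where p: "p \<in> carrier G" "W = V p" using subsetD[OF F(2) W(1)] by auto
  obtain m where m: "c [^] (m::nat) \<in> W" using infinite_imp_nonempty[OF W(2)] by blast
  have inf: "infinite ({n::nat. c [^] n \<in> W} - {..<m})" using W(2) by simp
  have "inj_on (\<lambda>n. n - m) ({n::nat. c [^] n \<in> W} - {..<m})" by (auto simp: inj_on_def)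
  then have "infinite ((\<lambda>n. n - m) ` ({n::nat. c [^] n \<in> W} - {..<m}))"
    using inf finite_imageD by blast
  moreover have "(\<lambda>n. n - m) ` ({n::nat. c [^] n \<in> W} - {..<m}) \<subseteq> {n. c [^] n \<in> U}"
  proof (rule image_subsetI)
    fix n assume "n \<in> {n::nat. c [^] n \<in> W} - {..<m}"
    then have n: "c [^] n \<in> W" "m \<le> n" by auto
    then have "c [^] n = c [^] m \<otimes> c [^] (n - m)" using c by (simp add: nat_pow_mult)
    then have "inv (c [^] m) \<otimes> c [^] n = c [^] (n - m)"
      using c by (simp add: m_assoc[symmetric])
    moreover have "inv (c [^] m) \<otimes> c [^] n \<in> U"
      using V(3)[OF p(1)] m n(1) unfolding p(2) by blast
    ultimately show "n - m \<in> {n. c [^] n \<in> U}" by simp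
  qed
  ultimately show ?thesis by (rule infinite_super[rotated])
qed

text \<open>The set of \<open>z\<close> with \<open>f z x = 1\<close> is closed in the closure of \<open>D\<close>. An interior point could be
  approximated by some \<open>y \<in> D\<close>, and then \<open>y c\<^sup>n\<close> would lie in the set for infinitely many \<open>n\<close>, for every
  \<open>c \<in> D\<close>. So the sets are nowhere dense, and there are countably many of them.\<close>

theorem generic_embedding:
  assumes D: "subgroup D G" and P: "group P" "countable (carrier P)"
    and f: "\<And>z. z \<in> T closure_of D \<Longrightarrow> f z \<in> hom P G"
    and words: "\<And>x. x \<in> carrier P \<Longrightarrow> x \<noteq> \<one>\<^bsub>P\<^esub> \<Longrightarrow> \<exists>h ws. h \<in> carrier G \<and>
       (\<forall>(\<alpha>, e, \<beta>) \<in> set ws. \<alpha> \<in> carrier G \<and> \<beta> \<in> carrier G) \<and>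
       (\<forall>z\<in>T closure_of D. f z x = h \<otimes> zeval G z ws) \<and>
       (\<forall>y\<in>D. \<exists>c\<in>D. finite {n::nat. h \<otimes> zeval G (y \<otimes> c [^] n) ws = \<one>})"
  shows "\<exists>z\<in>T closure_of D. inj_on (f z) (carrier P)"
proof -
  let ?Z = "T closure_of D"
  let ?S = "subtopology T ?Z"
  define K where "K x = {z \<in> ?Z. f z x = \<one>}" for x
  have DZ: "D \<subseteq> ?Z" "D \<subseteq> carrier G"
    using closure_of_subset[of D T] subgroup.subset[OF D] by auto
  have top: "topspace ?S = ?Z" using closure_of_subset_topspace[of T D] by auto
  have S: "compact_space ?S" "Hausdorff_space ?S"
    by (rule compact_space_subtopology[OF closedin_compact_space[OF compact closedin_closure_of]],
        rule Hausdorff_space_subtopology[OF Hausdorff])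
  have K: "closedin ?S (K x) \<and> ?S interior_of (K x) = {}" if x: "x \<in> carrier P - {\<one>\<^bsub>P\<^esub>}" for x
  proof -
    obtain h ws where h: "h \<in> carrier G" and ws: "\<forall>(\<alpha>, e, \<beta>) \<in> set ws. \<alpha> \<in> carrier G \<and> \<beta> \<in> carrier G"
      and fx: "\<forall>z\<in>?Z. f z x = h \<otimes> zeval G z ws"
      and fin: "\<forall>y\<in>D. \<exists>c\<in>D. finite {n::nat. h \<otimes> zeval G (y \<otimes> c [^] n) ws = \<one>}"
      using words[of x] x by auto
    have id: "continuous_map ?S T (\<lambda>x. x)" by (rule continuous_map_from_subtopology) simp
    have const: "continuous_map ?S T (\<lambda>x. h)" using h by simp
    have "closedin ?S {z \<in> topspace ?S. h \<otimes> zeval G z ws \<in> {\<one>}}"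
      by (rule closedin_continuous_map_preimage[OF continuous_mult[OF const continuous_zeval[OF id ws]]])
        (simp add: closedin_Hausdorff_sing_eq[OF Hausdorff])
    moreover have "{z \<in> topspace ?S. h \<otimes> zeval G z ws \<in> {\<one>}} = K x"
      using fx top by (auto simp: K_def)
    ultimately have "closedin ?S (K x)" by simp
    moreover have "?S interior_of (K x) = {}"
    proof (rule ccontr)
      assume "?S interior_of (K x) \<noteq> {}"
      then obtain W z where W: "openin ?S W" "W \<subseteq> K x" "z \<in> W" by (auto simp: interior_of_def)
      then obtain V where V: "openin T V" "W = V \<inter> ?Z" by (auto simp: openin_subtopology)
      then have "z \<in> V" "z \<in> ?Z" using W by auto
      then obtain y where y: "y \<in> D" "y \<in> V" using V(1) by (auto simp: in_closure_of)
      obtain c where c: "c \<in> D" "finite {n::nat. h \<otimes> zeval G (y \<otimes> c [^] n) ws = \<one>}"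
        using fin y by blast
      have yG: "y \<in> carrier G" "c \<in> carrier G" using y c DZ by auto
      have "openin T {g \<in> topspace T. y \<otimes> g \<in> V}"
        by (rule openin_continuous_map_preimage[OF continuous_mult V(1)]) (use yG in auto)
      then have inf: "infinite {n::nat. c [^] n \<in> {g \<in> topspace T. y \<otimes> g \<in> V}}"
        by (rule powers_recur[OF yG(2)]) (use y yG in auto)
      have "{n::nat. c [^] n \<in> {g \<in> topspace T. y \<otimes> g \<in> V}}
          \<subseteq> {n::nat. h \<otimes> zeval G (y \<otimes> c [^] n) ws = \<one>}"
      proof
        fix n assume "n \<in> {n::nat. c [^] n \<in> {g \<in> topspace T. y \<otimes> g \<in> V}}"
        then have n: "y \<otimes> c [^] n \<in> V" by blast
        have "c [^] n \<in> D"
          by (induction n) (simp_all add: subgroup.one_closed[OF D] subgroup.m_closed[OF D _ c(1)])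
        then have Z: "y \<otimes> c [^] n \<in> ?Z" using subgroup.m_closed[OF D y(1)] DZ(1) by blast
        then have "y \<otimes> c [^] n \<in> W" using n V(2) by blast
        then have "f (y \<otimes> c [^] n) x = \<one>" using W(2) unfolding K_def by blast
        then have "h \<otimes> zeval G (y \<otimes> c [^] n) ws = \<one>" using bspec[OF fx Z] by simp
        then show "n \<in> {n::nat. h \<otimes> zeval G (y \<otimes> c [^] n) ws = \<one>}" by simp
      qed
      from finite_subset[OF this c(2)] inf show False by contradiction
    qed
    ultimately show ?thesis by blast
  qed
  have "?S interior_of \<Union> (K ` (carrier P - {\<one>\<^bsub>P\<^esub>})) = {}"
  proof (rule Baire_category_alt)
    show "completely_metrizable_space ?S \<or> locally_compact_space ?S \<and> regular_space ?S"
      using S compact_imp_locally_compact_space compact_Hausdorff_imp_regular_space by blast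
    show "countable (K ` (carrier P - {\<one>\<^bsub>P\<^esub>}))" using P(2) by (intro countable_image countable_Diff)
  qed (use K in blast)
  moreover have "?S interior_of ?Z = ?Z" using interior_of_topspace[of ?S] top by simp
  moreover have "?Z \<noteq> {}" using DZ subgroup.one_closed[OF D] by blast
  ultimately have "\<not> ?Z \<subseteq> \<Union> (K ` (carrier P - {\<one>\<^bsub>P\<^esub>}))"
    using interior_of_mono[of ?Z _ ?S] by (metis subset_empty)
  then obtain z where z: "z \<in> ?Z" "z \<notin> \<Union> (K ` (carrier P - {\<one>\<^bsub>P\<^esub>}))" by blast
  then have ne: "f z x \<noteq> \<one>" if "x \<in> carrier P" "x \<noteq> \<one>\<^bsub>P\<^esub>" for x
    using that unfolding K_def by blast
  interpret h: group_hom P G "f z"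
    using f[OF z(1)] P(1) by (simp add: group_hom_def group_hom_axioms_def)
  have "kernel P G (f z) = {\<one>\<^bsub>P\<^esub>}" using ne by (auto simp: kernel_def)
  then have "inj_on (f z) (carrier P)" by (rule h.trivial_ker_imp_inj)
  then show ?thesis using z(1) by blast
qed

end

lemma (in group) zeval_subgroup:
  assumes "subgroup N G" "z \<in> N" "\<forall>(\<alpha>, e, \<beta>) \<in> set ws. \<alpha> \<in> N \<and> \<beta> \<in> N"
  shows "zeval (G\<lparr>carrier := N\<rparr>) z ws = zeval G z ws"
  using assms(3)
proof (induction ws)
  case (Cons w ws)
  have "zpow (G\<lparr>carrier := N\<rparr>) z e = zpow G z e" for e
    using m_inv_consistent[OF assms(1,2)] by (simp add: zpow_def)
  then show ?case using Cons by (cases w) simp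
qed simp

text \<open>The substitution \<open>z = y c\<^sup>n\<close> turns the word into one at \<open>c\<^sup>n\<close> with other coefficients: \<open>y\<close> is absorbed on
  the left of a positive power, and its inverse on the right of a negative one. That is why only the second
  junction condition involves \<open>y\<close>.\<close>

lemma (in group) shifted_power_word_finite:
  assumes N: "subgroup N G" "power_separated (G\<lparr>carrier := N\<rparr>)"
    and y: "y \<in> N" and c: "c \<in> N" "c \<noteq> \<one>" and h: "h \<in> N"
    and ws: "\<forall>(\<alpha>, e, \<beta>) \<in> set ws. \<alpha> \<in> N \<and> \<beta> \<in> N" "ws \<noteq> []"
    and sep: "successively (\<lambda>(\<alpha>, e, \<beta>) (\<alpha>', e', \<beta>').
        (e \<and> \<not> e' \<longrightarrow> (\<beta> \<otimes> \<alpha>') \<otimes> c \<noteq> c \<otimes> (\<beta> \<otimes> \<alpha>')) \<and>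
        (\<not> e \<and> e' \<longrightarrow> (inv y \<otimes> (\<beta> \<otimes> \<alpha>') \<otimes> y) \<otimes> c \<noteq> c \<otimes> (inv y \<otimes> (\<beta> \<otimes> \<alpha>') \<otimes> y))) ws"
  shows "finite {n::nat. h \<otimes> zeval G (y \<otimes> c [^] n) ws = \<one>}"
proof -
  \<comment> \<open>\<open>(y c\<^sup>n)\<^sup>-\<^sup>1 = c\<^sup>-\<^sup>n y\<^sup>-\<^sup>1\<close>, so \<open>y\<close> enters on different sides for the two signs.\<close>
  define shift where "shift = (\<lambda>(\<alpha>, e, \<beta>). if e then (\<alpha> \<otimes> y, e, \<beta>) else (\<alpha>, e, inv y \<otimes> \<beta>))"
  have NG: "x \<in> carrier G" if "x \<in> N" for x using that subgroup.subset[OF N(1)] by blast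
  have cn: "c [^] n \<in> N" for n :: nat
    using c(1) N(1) by (induction n) (auto simp: subgroup.one_closed subgroup.m_closed)
  have eval: "zeval G (y \<otimes> c [^] n) ws = zeval G (c [^] n) (map shift ws)" for n :: nat
    using ws(1)
  proof (induction ws)
    case (Cons w ws)
    obtain \<alpha> e \<beta> where w: "w = (\<alpha>, e, \<beta>)" by (metis prod_cases3)
    have "zeval G (c [^] n) (map shift ws) \<in> carrier G"
      using Cons.prems NG NG[OF y] NG[OF cn] by (intro zeval_closed) (auto simp: shift_def split: if_splits)
    then show ?case using Cons w NG NG[OF y] NG[OF cn]
      by (auto simp: shift_def zpow_def inv_mult_group m_assoc)
  qed simp
  have mem: "\<forall>(\<alpha>, e, \<beta>) \<in> set (map shift ws). \<alpha> \<in> N \<and> \<beta> \<in> N"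
    using ws(1) y N(1) by (auto simp: shift_def subgroup.m_closed subgroup.m_inv_closed split: if_splits)
  have "successively (\<lambda>(\<alpha>, e, \<beta>) (\<alpha>', e', \<beta>').
        e \<noteq> e' \<longrightarrow> (\<beta> \<otimes> \<alpha>') \<otimes> c \<noteq> c \<otimes> (\<beta> \<otimes> \<alpha>')) (map shift ws)"
    unfolding successively_map
  proof (rule successively_mono[OF sep])
    fix w w' assume "w \<in> set ws" "w' \<in> set ws"
    moreover obtain \<alpha> e \<beta> \<alpha>' e' \<beta>' where w: "w = (\<alpha>, e, \<beta>)" "w' = (\<alpha>', e', \<beta>')" by (metis prod_cases3)
    ultimately have m: "\<beta> \<in> carrier G" "\<alpha>' \<in> carrier G" "y \<in> carrier G" using ws(1) NG y by auto
    then have "inv y \<otimes> \<beta> \<otimes> (\<alpha>' \<otimes> y) = inv y \<otimes> (\<beta> \<otimes> \<alpha>') \<otimes> y" by (simp add: m_assoc)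
    moreover assume "(\<lambda>(\<alpha>, e, \<beta>) (\<alpha>', e', \<beta>').
        (e \<and> \<not> e' \<longrightarrow> (\<beta> \<otimes> \<alpha>') \<otimes> c \<noteq> c \<otimes> (\<beta> \<otimes> \<alpha>')) \<and>
        (\<not> e \<and> e' \<longrightarrow> (inv y \<otimes> (\<beta> \<otimes> \<alpha>') \<otimes> y) \<otimes> c \<noteq> c \<otimes> (inv y \<otimes> (\<beta> \<otimes> \<alpha>') \<otimes> y))) w w'"
    ultimately show "(\<lambda>(\<alpha>, e, \<beta>) (\<alpha>', e', \<beta>').
        e \<noteq> e' \<longrightarrow> (\<beta> \<otimes> \<alpha>') \<otimes> c \<noteq> c \<otimes> (\<beta> \<otimes> \<alpha>')) (shift w) (shift w')"
      by (cases e; cases e') (simp_all add: w shift_def)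
  qed
  note sep' = this
  have fin: "finite {n::nat. zeval (G\<lparr>carrier := N\<rparr>) (c [^]\<^bsub>G\<lparr>carrier := N\<rparr>\<^esub> n) (map shift ws) = inv h}"
  proof (rule power_separatedD[OF N(2)])
    show "map shift ws \<noteq> []" using ws(2) by simp
    show "inv h \<in> carrier (G\<lparr>carrier := N\<rparr>)" using subgroup.m_inv_closed[OF N(1) h] by simp
  qed (use c mem sep' in simp_all)
  have e1: "zeval (G\<lparr>carrier := N\<rparr>) (c [^]\<^bsub>G\<lparr>carrier := N\<rparr>\<^esub> n) (map shift ws)
      = zeval G (y \<otimes> c [^] n) ws" for n :: nat
    unfolding nat_pow_consistent[symmetric] eval by (rule zeval_subgroup[OF N(1) cn mem])
  have e2: "zeval G (y \<otimes> c [^] n) ws = inv h \<longleftrightarrow> h \<otimes> zeval G (y \<otimes> c [^] n) ws = \<one>" for n :: nat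
  proof -
    let ?z = "zeval G (y \<otimes> c [^] n) ws"
    have z: "?z \<in> carrier G"
      by (rule zeval_closed[OF m_closed[OF NG[OF y] NG[OF cn]]]) (use ws(1) NG in auto)
    show ?thesis
    proof
      assume "?z = inv h"
      then show "h \<otimes> ?z = \<one>" using NG[OF h] by (simp only: r_inv)
    next
      assume "h \<otimes> ?z = \<one>"
      then have "inv ?z = h" using z NG[OF h] by (rule inv_equality)
      then show "?z = inv h" using inv_inv[OF z] by (simp only:)
    qed
  qed
  have "{n::nat. h \<otimes> zeval G (y \<otimes> c [^] n) ws = \<one>}
      = {n::nat. zeval (G\<lparr>carrier := N\<rparr>) (c [^]\<^bsub>G\<lparr>carrier := N\<rparr>\<^esub> n) (map shift ws) = inv h}"
    unfolding e1 by (rule Collect_cong) (rule e2[symmetric])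
  then show ?thesis using fin by (rule ssubst)
qed

section \<open>Reduced forms\<close>

lemma (in group) generate_left_induct:
  assumes "x \<in> generate G S" "S \<subseteq> carrier G" "E \<subseteq> carrier G" "\<one> \<in> E"
    and step: "\<And>s y. s \<in> S \<Longrightarrow> y \<in> E \<Longrightarrow> s \<otimes> y \<in> E \<and> inv s \<otimes> y \<in> E"
  shows "x \<in> E"
proof -
  have "\<forall>y\<in>E. x \<otimes> y \<in> E"
    using assms(1)
  proof induction
    case one
    then show ?case using assms(3) by auto
  next
    case (incl h)
    then show ?case using step by blast
  next
    case (inv h)
    then show ?case using step by blast
  next
    case (eng g h)
    have "g \<in> carrier G" "h \<in> carrier G" using eng generate_incl[OF assms(2)] by auto
    then have "g \<otimes> h \<otimes> y = g \<otimes> (h \<otimes> y)" if "y \<in> E" for y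
      using that assms(3) by (intro m_assoc) auto
    then show ?case using eng by simp
  qed
  then have "x \<otimes> \<one> \<in> E" using assms(4) by blast
  moreover have "x \<in> carrier G" using assms(1) generate_incl[OF assms(2)] by blast
  ultimately show ?thesis by simp
qed

lemma successively_tail: "successively R (x # xs) \<Longrightarrow> successively R xs"
  by (cases xs) simp_all

text \<open>The list of pairs \<open>(e, a)\<close> stands for the word \<open>t\<^sup>e a t\<^sup>e\<^sup>' a' \<dots>\<close> in a stable letter \<open>t\<close>.\<close>

definition stable_word :: "('a, 'm) monoid_scheme \<Rightarrow> (bool \<times> 'a) list \<Rightarrow> ('a \<times> bool \<times> 'a) list" where
  "stable_word G ws = map (\<lambda>(e, a). (\<one>\<^bsub>G\<^esub>, e, a)) ws"

lemma stable_word_simps [simp]: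
  "stable_word G [] = []" "stable_word G ((e, a) # ws) = (\<one>\<^bsub>G\<^esub>, e, a) # stable_word G ws"
  by (simp_all add: stable_word_def)

lemma (in group) stable_word_closed:
  assumes "V \<subseteq> carrier G" "\<forall>w\<in>set ws. snd w \<in> V"
  shows "\<forall>(\<alpha>, e, \<beta>) \<in> set (stable_word G ws). \<alpha> \<in> carrier G \<and> \<beta> \<in> carrier G"
  using assms by (auto simp: stable_word_def)

text \<open>The word is reduced from the right. A new letter \<open>t\<^sup>e\<close> in front either keeps it reduced or forms
  a pinch \<open>t\<^sup>e b t\<^sup>-\<^sup>e \<in> V\<close> with the first letter, and removing the pinch leaves a tail of a reduced word.\<close>

lemma (in group) stable_letter_reduce:
  assumes V: "subgroup V G" and t: "t \<in> carrier G"
    and "v \<in> V" "\<forall>w\<in>set ws. snd w \<in> V"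
  shows "\<exists>v' ws'. v' \<in> V \<and> (\<forall>w\<in>set ws'. snd w \<in> V) \<and>
    v' \<otimes> zeval G t (stable_word G ws') = v \<otimes> zeval G t (stable_word G ws) \<and>
    successively (\<lambda>(e, a) (e', a'). e \<noteq> e' \<longrightarrow> zpow G t e \<otimes> a \<otimes> zpow G t e' \<notin> V) ws'"
  using assms(3,4)
proof (induction ws arbitrary: v)
  case Nil
  then show ?case by (intro exI[of _ v] exI[of _ "[]"]) simp
next
  case (Cons w ws)
  have VG: "x \<in> carrier G" if "x \<in> V" for x using that subgroup.subset[OF V] by blast
  have tz: "zpow G t e \<in> carrier G" for e using t by (rule zpow_closed)
  have z: "zeval G t (stable_word G us) \<in> carrier G" if "\<forall>w\<in>set us. snd w \<in> V" for us
    by (rule zeval_closed[OF t stable_word_closed[OF subgroup.subset[OF V] that]])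
  obtain e a where w: "w = (e, a)" by force
  have mem: "a \<in> V" "\<forall>w\<in>set ws. snd w \<in> V" using Cons.prems w by auto
  obtain b us where b: "b \<in> V" and us: "\<forall>w\<in>set us. snd w \<in> V"
    and eq: "b \<otimes> zeval G t (stable_word G us) = a \<otimes> zeval G t (stable_word G ws)"
    and red: "successively (\<lambda>(e, a) (e', a'). e \<noteq> e' \<longrightarrow> zpow G t e \<otimes> a \<otimes> zpow G t e' \<notin> V) us"
    using Cons.IH[OF mem] by (elim exE conjE) (rule that)
  have val: "v \<otimes> zeval G t (stable_word G (w # ws)) = v \<otimes> (zpow G t e \<otimes> (b \<otimes> zeval G t (stable_word G us)))"
    using Cons.prems(1) VG mem tz z[OF mem(2)] by (simp add: eq w m_assoc)
  show ?case
  proof (cases "successively (\<lambda>(e, a) (e', a'). e \<noteq> e' \<longrightarrow> zpow G t e \<otimes> a \<otimes> zpow G t e' \<notin> V) ((e, b) # us)")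
    case True
    have "v \<otimes> zeval G t (stable_word G ((e, b) # us)) = v \<otimes> zeval G t (stable_word G (w # ws))"
      unfolding val using VG[OF b] tz z[OF us] by (simp add: m_assoc)
    then show ?thesis using True Cons.prems(1) b us
      by (intro exI[of _ v] exI[of _ "(e, b) # us"]) simp
  next
    case False
    have "us \<noteq> []" using False by auto
    then obtain p us' where us1: "us = p # us'" by (cases us) auto
    obtain e' d where p: "p = (e', d)" by force
    have "\<not> (e \<noteq> e' \<longrightarrow> zpow G t e \<otimes> b \<otimes> zpow G t e' \<notin> V)"
      using False red unfolding us1 p by simp
    then have us': "us = (e', d) # us'" "e \<noteq> e'" "zpow G t e \<otimes> b \<otimes> zpow G t e' \<in> V"
      using us1 p by auto
    define c where "c = zpow G t e \<otimes> b \<otimes> zpow G t e'"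
    have c: "c \<in> V" "d \<in> V" "\<forall>w\<in>set us'. snd w \<in> V" using us' us by (auto simp: c_def)
    have "v \<otimes> c \<otimes> d \<in> V" using c Cons.prems(1) V by (simp add: subgroup.m_closed)
    moreover have "v \<otimes> c \<otimes> d \<otimes> zeval G t (stable_word G us') = v \<otimes> zeval G t (stable_word G (w # ws))"
      unfolding val us'(1) c_def using VG[OF b] VG[OF c(2)] VG[OF Cons.prems(1)] tz z[OF c(3)]
      by (simp add: m_assoc)
    moreover have "successively (\<lambda>(e, a) (e', a'). e \<noteq> e' \<longrightarrow> zpow G t e \<otimes> a \<otimes> zpow G t e' \<notin> V) us'"
      using red unfolding us'(1) by (rule successively_tail)
    ultimately show ?thesis using c(3) by blast
  qed
qed

lemma (in group) stable_letter_reduced_form: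
  assumes V: "subgroup V G" and t: "t \<in> carrier G" and x: "x \<in> generate G (insert t V)"
  shows "\<exists>v ws. v \<in> V \<and> (\<forall>w\<in>set ws. snd w \<in> V) \<and> x = v \<otimes> zeval G t (stable_word G ws) \<and>
    successively (\<lambda>(e, a) (e', a'). e \<noteq> e' \<longrightarrow> zpow G t e \<otimes> a \<otimes> zpow G t e' \<notin> V) ws"
proof -
  define E where "E = {v \<otimes> zeval G t (stable_word G ws) | v ws. v \<in> V \<and> (\<forall>w\<in>set ws. snd w \<in> V)}"
  have VG: "y \<in> carrier G" if "y \<in> V" for y using that subgroup.subset[OF V] by blast
  have tz: "zpow G t e \<in> carrier G" for e using t by (rule zpow_closed)
  have z: "zeval G t (stable_word G us) \<in> carrier G" if "\<forall>w\<in>set us. snd w \<in> V" for us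
    by (rule zeval_closed[OF t stable_word_closed[OF subgroup.subset[OF V] that]])
  have left_V: "s \<otimes> y \<in> E" if s: "s \<in> V" and y: "y \<in> E" for s y
  proof -
    obtain v ws where v: "v \<in> V" "\<forall>w\<in>set ws. snd w \<in> V" "y = v \<otimes> zeval G t (stable_word G ws)"
      using y unfolding E_def by blast
    have "s \<otimes> y = s \<otimes> v \<otimes> zeval G t (stable_word G ws)"
      unfolding v(3) using VG[OF s] VG[OF v(1)] z[OF v(2)] by (simp add: m_assoc)
    moreover have "s \<otimes> v \<in> V" using V s v(1) by (rule subgroup.m_closed)
    ultimately show ?thesis using v(2) unfolding E_def by blast
  qed
  have left_t: "zpow G t e \<otimes> y \<in> E" if y: "y \<in> E" for e y
  proof -
    obtain v ws where v: "v \<in> V" "\<forall>w\<in>set ws. snd w \<in> V" "y = v \<otimes> zeval G t (stable_word G ws)"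
      using y unfolding E_def by blast
    have "zpow G t e \<otimes> y = \<one> \<otimes> zeval G t (stable_word G ((e, v) # ws))"
      unfolding v(3) using VG[OF v(1)] z[OF v(2)] tz by (simp add: m_assoc)
    moreover have "\<forall>w\<in>set ((e, v) # ws). snd w \<in> V" using v by simp
    ultimately show ?thesis using subgroup.one_closed[OF V] unfolding E_def by blast
  qed
  have "x \<in> E"
  proof (rule generate_left_induct[OF x])
    show "insert t V \<subseteq> carrier G" using t VG by blast
    show "E \<subseteq> carrier G" unfolding E_def using VG z by blast
    show "\<one> \<in> E" unfolding E_def
      by (rule CollectI, intro exI[of _ \<one>] exI[of _ "[]"]) (simp add: subgroup.one_closed[OF V])
    fix s y assume s: "s \<in> insert t V" and y: "y \<in> E"
    show "s \<otimes> y \<in> E \<and> inv s \<otimes> y \<in> E"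
    proof (cases "s \<in> V")
      case True
      then show ?thesis using left_V y subgroup.m_inv_closed[OF V] by blast
    next
      case False
      then have "s = t" using s by blast
      then show ?thesis using left_t[OF y, of True] left_t[OF y, of False] by (simp add: zpow_def)
    qed
  qed
  then obtain v ws where v: "v \<in> V" "\<forall>w\<in>set ws. snd w \<in> V" "x = v \<otimes> zeval G t (stable_word G ws)"
    unfolding E_def by blast
  obtain v' ws' where "v' \<in> V" "\<forall>w\<in>set ws'. snd w \<in> V"
    "v' \<otimes> zeval G t (stable_word G ws') = v \<otimes> zeval G t (stable_word G ws)"
    "successively (\<lambda>(e, a) (e', a'). e \<noteq> e' \<longrightarrow> zpow G t e \<otimes> a \<otimes> zpow G t e' \<notin> V) ws'"
    using stable_letter_reduce[OF V t v(1,2)] by (elim exE conjE) (rule that)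
  then show ?thesis unfolding v(3) by (intro exI[of _ v'] exI[of _ ws'] conjI) (simp_all only:)
qed

text \<open>The list of pairs \<open>(b, a)\<close> stands for the alternating product \<open>b\<^sub>1 a\<^sub>1 b\<^sub>2 a\<^sub>2 \<dots>\<close> of elements of two
  subgroups.\<close>

definition amalgam_word :: "('a, 'm) monoid_scheme \<Rightarrow> ('a \<times> 'a) list \<Rightarrow> 'a" where
  "amalgam_word G ws = foldr (\<lambda>(b, a) y. b \<otimes>\<^bsub>G\<^esub> (a \<otimes>\<^bsub>G\<^esub> y)) ws \<one>\<^bsub>G\<^esub>"

lemma amalgam_word_simps [simp]:
  "amalgam_word G [] = \<one>\<^bsub>G\<^esub>"
  "amalgam_word G ((b, a) # ws) = b \<otimes>\<^bsub>G\<^esub> (a \<otimes>\<^bsub>G\<^esub> amalgam_word G ws)"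
  by (simp_all add: amalgam_word_def)

lemma (in group) amalgam_word_closed:
  "set ws \<subseteq> carrier G \<times> carrier G \<Longrightarrow> amalgam_word G ws \<in> carrier G"
  by (induction ws) auto

text \<open>As for a stable letter, the word is reduced from the right. The new pair \<open>(b, a')\<close> is absorbed if
  \<open>b\<close> lies in both subgroups, and it is merged with the next pair if \<open>a'\<close> does; the merged
  pair may be absorbed in turn.\<close>

lemma (in group) amalgam_reduce:
  assumes A: "subgroup A G" and B: "subgroup B G"
    and "v \<in> A" "set ws \<subseteq> B \<times> A"
  shows "\<exists>v' ws'. v' \<in> A \<and> set ws' \<subseteq> (B - A) \<times> A \<and>
    v' \<otimes> amalgam_word G ws' = v \<otimes> amalgam_word G ws \<and> successively (\<lambda>w w'. snd w \<notin> B) ws'"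
  using assms(3,4)
proof (induction ws arbitrary: v)
  case Nil
  then show ?case by (intro exI[of _ v] exI[of _ "[]"]) simp
next
  case (Cons w ws)
  have AG: "x \<in> carrier G" if "x \<in> A" for x using that subgroup.subset[OF A] by blast
  have BG: "x \<in> carrier G" if "x \<in> B" for x using that subgroup.subset[OF B] by blast
  have z: "amalgam_word G us \<in> carrier G" if "set us \<subseteq> B \<times> A" for us
    by (rule amalgam_word_closed) (use that AG BG in blast)
  obtain b a where w: "w = (b, a)" by force
  have mem: "b \<in> B" "a \<in> A" "set ws \<subseteq> B \<times> A" using Cons.prems w by auto
  note v = Cons.prems(1)
  obtain a' us where a': "a' \<in> A" and us: "set us \<subseteq> (B - A) \<times> A"
    and eq: "a' \<otimes> amalgam_word G us = a \<otimes> amalgam_word G ws"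
    and red: "successively (\<lambda>w w'. snd w \<notin> B) us"
    using Cons.IH[OF mem(2,3)] by (elim exE conjE) (rule that)
  have us': "set us \<subseteq> B \<times> A" using us by blast
  have val: "v \<otimes> amalgam_word G (w # ws) = v \<otimes> (b \<otimes> (a' \<otimes> amalgam_word G us))"
    by (simp add: eq w)
  consider "b \<in> A" | "b \<notin> A" "us = [] \<or> a' \<notin> B" | b' d us'' where "b \<notin> A" "us = (b', d) # us''" "a' \<in> B"
    by (metis list.exhaust surj_pair)
  then show ?case
  proof cases
    case 1
    have "v \<otimes> b \<otimes> a' \<in> A" using 1 v a' A by (simp add: subgroup.m_closed)
    moreover have "v \<otimes> b \<otimes> a' \<otimes> amalgam_word G us = v \<otimes> amalgam_word G (w # ws)"
      unfolding val using AG[OF v] AG[OF a'] AG[OF 1] z[OF us'] by (simp add: m_assoc)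
    ultimately show ?thesis using us red by blast
  next
    case 2
    have "set ((b, a') # us) \<subseteq> (B - A) \<times> A" using 2 mem(1) a' us by simp
    moreover have "successively (\<lambda>w w'. snd w \<notin> B) ((b, a') # us)"
      using 2(2) red by (auto simp: successively_Cons)
    moreover have "v \<otimes> amalgam_word G ((b, a') # us) = v \<otimes> amalgam_word G (w # ws)"
      unfolding val by simp
    ultimately show ?thesis using v by blast
  next
    case 3
    define c where "c = b \<otimes> a' \<otimes> b'"
    have d: "b' \<in> B" "d \<in> A" "set us'' \<subseteq> (B - A) \<times> A" using us 3(2) by auto
    have c: "c \<in> B" using mem(1) 3(3) d(1) B by (simp add: c_def subgroup.m_closed)
    have us''z: "amalgam_word G us'' \<in> carrier G" using d(3) by (intro z) blast
    have val': "v \<otimes> amalgam_word G (w # ws) = v \<otimes> (c \<otimes> (d \<otimes> amalgam_word G us''))"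
      unfolding val 3(2) c_def
      using AG[OF v] BG[OF mem(1)] AG[OF a'] BG[OF d(1)] AG[OF d(2)] us''z by (simp add: m_assoc)
    have red': "successively (\<lambda>w w'. snd w \<notin> B) ((c, d) # us'')"
      using red 3(2) by (auto simp: successively_Cons)
    show ?thesis
    proof (cases "c \<in> A")
      case True
      have "v \<otimes> c \<otimes> d \<in> A" using True v d(2) A by (simp add: subgroup.m_closed)
      moreover have "v \<otimes> c \<otimes> d \<otimes> amalgam_word G us'' = v \<otimes> amalgam_word G (w # ws)"
        unfolding val' using AG[OF v] AG[OF d(2)] AG[OF True] us''z by (simp add: m_assoc)
      moreover have "successively (\<lambda>w w'. snd w \<notin> B) us''" using red' by (rule successively_tail)
      ultimately show ?thesis using d(3) by blast
    next
      case False
      have "set ((c, d) # us'') \<subseteq> (B - A) \<times> A" using False c d by simp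
      moreover have "v \<otimes> amalgam_word G ((c, d) # us'') = v \<otimes> amalgam_word G (w # ws)"
        unfolding val' by simp
      ultimately show ?thesis using v red' by blast
    qed
  qed
qed

lemma (in group) amalgam_reduced_form:
  assumes A: "subgroup A G" and B: "subgroup B G" and x: "x \<in> generate G (A \<union> B)"
  shows "\<exists>v ws. v \<in> A \<and> set ws \<subseteq> (B - A) \<times> A \<and>
    x = v \<otimes> amalgam_word G ws \<and> successively (\<lambda>w w'. snd w \<notin> B) ws"
proof -
  define E where "E = {v \<otimes> amalgam_word G ws | v ws. v \<in> A \<and> set ws \<subseteq> B \<times> A}"
  have AG: "x \<in> carrier G" if "x \<in> A" for x using that subgroup.subset[OF A] by blast
  have BG: "x \<in> carrier G" if "x \<in> B" for x using that subgroup.subset[OF B] by blast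
  have z: "amalgam_word G us \<in> carrier G" if "set us \<subseteq> B \<times> A" for us
    by (rule amalgam_word_closed) (use that AG BG in blast)
  have left_A: "s \<otimes> y \<in> E" if s: "s \<in> A" and y: "y \<in> E" for s y
  proof -
    obtain v ws where v: "v \<in> A" "set ws \<subseteq> B \<times> A" "y = v \<otimes> amalgam_word G ws"
      using y unfolding E_def by blast
    have "s \<otimes> y = s \<otimes> v \<otimes> amalgam_word G ws"
      unfolding v(3) using AG[OF s] AG[OF v(1)] z[OF v(2)] by (simp add: m_assoc)
    moreover have "s \<otimes> v \<in> A" using A s v(1) by (rule subgroup.m_closed)
    ultimately show ?thesis using v(2) unfolding E_def by blast
  qed
  have left_B: "s \<otimes> y \<in> E" if s: "s \<in> B" and y: "y \<in> E" for s y
  proof -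
    obtain v ws where v: "v \<in> A" "set ws \<subseteq> B \<times> A" "y = v \<otimes> amalgam_word G ws"
      using y unfolding E_def by blast
    have "s \<otimes> y = \<one> \<otimes> amalgam_word G ((s, v) # ws)"
      unfolding v(3) using AG[OF v(1)] z[OF v(2)] BG[OF s] by simp
    moreover have "set ((s, v) # ws) \<subseteq> B \<times> A" using v s by simp
    ultimately show ?thesis using subgroup.one_closed[OF A] unfolding E_def by blast
  qed
  have "x \<in> E"
  proof (rule generate_left_induct[OF x])
    show "A \<union> B \<subseteq> carrier G" using AG BG by blast
    show "E \<subseteq> carrier G" unfolding E_def using AG z by blast
    show "\<one> \<in> E" unfolding E_def
      by (rule CollectI, intro exI[of _ \<one>] exI[of _ "[]"]) (simp add: subgroup.one_closed[OF A])
    fix s y assume s: "s \<in> A \<union> B" and y: "y \<in> E"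
    then show "s \<otimes> y \<in> E \<and> inv s \<otimes> y \<in> E"
      using left_A left_B subgroup.m_inv_closed[OF A] subgroup.m_inv_closed[OF B] by blast
  qed
  then obtain v ws where v: "v \<in> A" "set ws \<subseteq> B \<times> A" "x = v \<otimes> amalgam_word G ws"
    unfolding E_def by blast
  obtain v' ws' where "v' \<in> A" "set ws' \<subseteq> (B - A) \<times> A"
    "v' \<otimes> amalgam_word G ws' = v \<otimes> amalgam_word G ws" "successively (\<lambda>w w'. snd w \<notin> B) ws'"
    using amalgam_reduce[OF A B v(1,2)] by (elim exE conjE) (rule that)
  then show ?thesis unfolding v(3) by (intro exI[of _ v'] exI[of _ ws'] conjI) (simp_all only:)
qed

section \<open>Generic twists are injective\<close>

lemma (in group) zeval_stable_word_mult:
  assumes "z \<in> carrier G" "\<tau> \<in> carrier G" "\<forall>w\<in>set ws. snd w \<in> carrier G"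
  shows "zeval G (\<tau> \<otimes> z) (stable_word G ws)
    = zeval G z (map (\<lambda>(e, a). if e then (\<tau>, e, a) else (\<one>, e, inv \<tau> \<otimes> a)) ws)"
  using assms(3)
proof (induction ws)
  case (Cons w ws)
  obtain e a where w: "w = (e, a)" by force
  have "zeval G (\<tau> \<otimes> z) (stable_word G ws) \<in> carrier G"
    using Cons.prems assms(1,2) by (intro zeval_closed[OF _ stable_word_closed[of "carrier G"]]) auto
  moreover have "a \<in> carrier G" using Cons.prems w by simp
  ultimately show ?case using Cons w assms(1,2)
    by (cases e) (simp_all add: zpow_def inv_mult_group m_assoc)
qed simp

context compact_top_group
begin

text \<open>Here \<open>f z\<close> is fixed on \<open>V\<close> and sends \<open>t\<close> to \<open>\<tau> z\<close>. The two clauses of \<open>sep\<close> are the junction conditions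
  at \<open>t a t\<^sup>-\<^sup>1\<close> and at \<open>t\<^sup>-\<^sup>1 a t\<close> in a reduced form. HNN extensions and free products with an infinite
  cyclic group are both instances; for the latter \<open>c\<close> has to depend on the finite set \<open>S\<close> of the
  coefficients that occur.\<close>

theorem stable_letter_embedding:
  fixes P :: "('p, 'k) monoid_scheme"
  assumes P: "group P" "countable (carrier P)" and V: "subgroup V P" and t: "t \<in> carrier P"
    and gen: "carrier P = generate P (insert t V)"
    and N: "subgroup N G" "power_separated (G\<lparr>carrier := N\<rparr>)"
    and D: "subgroup D G" "D \<subseteq> N" and \<tau>: "\<tau> \<in> N"
    and f: "\<And>z. z \<in> T closure_of D \<Longrightarrow> f z \<in> hom P G"
      "\<And>z v. z \<in> T closure_of D \<Longrightarrow> v \<in> V \<Longrightarrow> f z v = \<theta> v"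
      "\<And>z. z \<in> T closure_of D \<Longrightarrow> f z t = \<tau> \<otimes> z"
    and \<theta>: "\<And>v. v \<in> V \<Longrightarrow> \<theta> v \<in> N" "\<And>v. v \<in> V \<Longrightarrow> \<theta> v = \<one> \<Longrightarrow> v = \<one>\<^bsub>P\<^esub>"
    and sep: "\<And>S y. finite S \<Longrightarrow> S \<subseteq> V \<Longrightarrow> y \<in> D \<Longrightarrow> \<exists>c\<in>D. c \<noteq> \<one> \<and>
       (\<forall>a\<in>S. (t \<otimes>\<^bsub>P\<^esub> a \<otimes>\<^bsub>P\<^esub> inv\<^bsub>P\<^esub> t \<notin> V \<longrightarrow> \<theta> a \<otimes> c \<noteq> c \<otimes> \<theta> a) \<and>
          (inv\<^bsub>P\<^esub> t \<otimes>\<^bsub>P\<^esub> a \<otimes>\<^bsub>P\<^esub> t \<notin> V \<longrightarrow> (inv y \<otimes> (inv \<tau> \<otimes> \<theta> a \<otimes> \<tau>) \<otimes> y) \<otimes> c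
              \<noteq> c \<otimes> (inv y \<otimes> (inv \<tau> \<otimes> \<theta> a \<otimes> \<tau>) \<otimes> y)))"
  shows "\<exists>z\<in>T closure_of D. inj_on (f z) (carrier P)"
proof (rule generic_embedding[OF D(1) P f(1)])
  interpret P: group P by fact
  have NG: "x \<in> carrier G" if "x \<in> N" for x using that subgroup.subset[OF N(1)] by blast
  have ZG: "z \<in> carrier G" if "z \<in> T closure_of D" for z
    using that closure_of_subset_topspace[of T D] by auto
  fix x assume x: "x \<in> carrier P" "x \<noteq> \<one>\<^bsub>P\<^esub>"
  have xg: "x \<in> generate P (insert t V)" using x(1) gen by simp
  obtain v ws where v: "v \<in> V" and ws: "\<forall>w\<in>set ws. snd w \<in> V"
    and xv: "x = v \<otimes>\<^bsub>P\<^esub> zeval P t (stable_word P ws)"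
    and red: "successively (\<lambda>(e, a) (e', a'). e \<noteq> e' \<longrightarrow> zpow P t e \<otimes>\<^bsub>P\<^esub> a \<otimes>\<^bsub>P\<^esub> zpow P t e' \<notin> V) ws"
    using P.stable_letter_reduced_form[OF V t xg] by (elim exE conjE) (rule that)
  define us where "us = map (\<lambda>(e, a). if e then (\<tau>, e, \<theta> a) else (\<one>, e, inv \<tau> \<otimes> \<theta> a)) ws"
  have us: "\<forall>(\<alpha>, e, \<beta>) \<in> set us. \<alpha> \<in> N \<and> \<beta> \<in> N"
    using ws \<theta>(1) \<tau> N(1)
    by (auto simp: us_def subgroup.one_closed subgroup.m_closed subgroup.m_inv_closed split: if_splits)
  have val: "f z x = \<theta> v \<otimes> zeval G z us" if z: "z \<in> T closure_of D" for z
  proof -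
    interpret F: group_hom P G "f z"
      using f(1)[OF z] P(1) by (simp add: group_hom_def group_hom_axioms_def)
    have cl: "\<forall>(\<alpha>, e, \<beta>) \<in> set (stable_word P ws). \<alpha> \<in> carrier P \<and> \<beta> \<in> carrier P"
      by (rule P.stable_word_closed[OF subgroup.subset[OF V] ws])
    have mw: "map_word (f z) (stable_word P ws) = stable_word G (map (\<lambda>(e, a). (e, \<theta> a)) ws)"
      using ws by (induction ws) (auto simp: f(2)[OF z])
    have "f z x = f z v \<otimes> f z (zeval P t (stable_word P ws))"
      unfolding xv using subgroup.mem_carrier[OF V v] P.zeval_closed[OF t cl] by (rule F.hom_mult)
    also have "f z (zeval P t (stable_word P ws)) = zeval G (\<tau> \<otimes> z) (stable_word G (map (\<lambda>(e, a). (e, \<theta> a)) ws))"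
      unfolding F.hom_zeval[OF t cl] mw f(3)[OF z] ..
    also have "\<dots> = zeval G z (map (\<lambda>(e, a). if e then (\<tau>, e, a) else (\<one>, e, inv \<tau> \<otimes> a)) (map (\<lambda>(e, a). (e, \<theta> a)) ws))"
      by (rule zeval_stable_word_mult) (use ZG[OF z] NG[OF \<tau>] ws \<theta>(1) NG in auto)
    also have "map (\<lambda>(e, a). if e then (\<tau>, e, a) else (\<one>, e, inv \<tau> \<otimes> a)) (map (\<lambda>(e, a). (e, \<theta> a)) ws) = us"
      by (simp add: us_def case_prod_unfold)
    finally show ?thesis using f(2)[OF z v] by simp
  qed
  have fin: "\<exists>c\<in>D. finite {n::nat. \<theta> v \<otimes> zeval G (y \<otimes> c [^] n) us = \<one>}" if y: "y \<in> D" for y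
  proof -
    obtain c where c: "c \<in> D" "c \<noteq> \<one>" and csep:
      "\<forall>a\<in>snd ` set ws. (t \<otimes>\<^bsub>P\<^esub> a \<otimes>\<^bsub>P\<^esub> inv\<^bsub>P\<^esub> t \<notin> V \<longrightarrow> \<theta> a \<otimes> c \<noteq> c \<otimes> \<theta> a) \<and>
          (inv\<^bsub>P\<^esub> t \<otimes>\<^bsub>P\<^esub> a \<otimes>\<^bsub>P\<^esub> t \<notin> V \<longrightarrow> (inv y \<otimes> (inv \<tau> \<otimes> \<theta> a \<otimes> \<tau>) \<otimes> y) \<otimes> c
              \<noteq> c \<otimes> (inv y \<otimes> (inv \<tau> \<otimes> \<theta> a \<otimes> \<tau>) \<otimes> y))"
      using sep[of "snd ` set ws" y] ws y by auto
    show ?thesis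
    proof (cases "ws = []")
      case True
      then have "x = v" using xv subgroup.mem_carrier[OF V v] by simp
      then have "\<theta> v \<noteq> \<one>" using \<theta>(2)[OF v] x(2) by blast
      then show ?thesis using c(1) NG[OF \<theta>(1)[OF v]] True by (intro bexI[of _ c]) (simp_all add: us_def)
    next
      case False
      have "successively (\<lambda>(\<alpha>, e, \<beta>) (\<alpha>', e', \<beta>').
        (e \<and> \<not> e' \<longrightarrow> (\<beta> \<otimes> \<alpha>') \<otimes> c \<noteq> c \<otimes> (\<beta> \<otimes> \<alpha>')) \<and>
        (\<not> e \<and> e' \<longrightarrow> (inv y \<otimes> (\<beta> \<otimes> \<alpha>') \<otimes> y) \<otimes> c \<noteq> c \<otimes> (inv y \<otimes> (\<beta> \<otimes> \<alpha>') \<otimes> y))) us"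
        unfolding us_def successively_map
      proof (rule successively_mono[OF red])
        fix w w' assume m: "w \<in> set ws" "w' \<in> set ws"
        obtain e a e' a' where w: "w = (e, a)" "w' = (e', a')" by force
        have a: "\<theta> a \<in> carrier G" using m(1) ws \<theta>(1) NG w by force
        note cs = bspec[OF csep imageI[OF m(1)]]
        assume "(\<lambda>(e, a) (e', a'). e \<noteq> e' \<longrightarrow> zpow P t e \<otimes>\<^bsub>P\<^esub> a \<otimes>\<^bsub>P\<^esub> zpow P t e' \<notin> V) w w'"
        then show "(\<lambda>(\<alpha>, e, \<beta>) (\<alpha>', e', \<beta>').
        (e \<and> \<not> e' \<longrightarrow> (\<beta> \<otimes> \<alpha>') \<otimes> c \<noteq> c \<otimes> (\<beta> \<otimes> \<alpha>')) \<and>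
        (\<not> e \<and> e' \<longrightarrow> (inv y \<otimes> (\<beta> \<otimes> \<alpha>') \<otimes> y) \<otimes> c \<noteq> c \<otimes> (inv y \<otimes> (\<beta> \<otimes> \<alpha>') \<otimes> y)))
          ((\<lambda>(e, a). if e then (\<tau>, e, \<theta> a) else (\<one>, e, inv \<tau> \<otimes> \<theta> a)) w)
          ((\<lambda>(e, a). if e then (\<tau>, e, \<theta> a) else (\<one>, e, inv \<tau> \<otimes> \<theta> a)) w')"
          using cs a by (cases e; cases e') (simp_all add: w zpow_def)
      qed
      then have "finite {n::nat. \<theta> v \<otimes> zeval G (y \<otimes> c [^] n) us = \<one>}"
        using False D(2) y c \<theta>(1)[OF v] us
        by (intro shifted_power_word_finite[OF N]) (auto simp: us_def)
      then show ?thesis using c(1) by blast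
    qed
  qed
  show "\<exists>h ws. h \<in> carrier G \<and>
       (\<forall>(\<alpha>, e, \<beta>) \<in> set ws. \<alpha> \<in> carrier G \<and> \<beta> \<in> carrier G) \<and>
       (\<forall>z\<in>T closure_of D. f z x = h \<otimes> zeval G z ws) \<and>
       (\<forall>y\<in>D. \<exists>c\<in>D. finite {n::nat. h \<otimes> zeval G (y \<otimes> c [^] n) ws = \<one>})"
    using NG[OF \<theta>(1)[OF v]] us NG val fin
    by (intro exI[of _ "\<theta> v"] exI[of _ us] conjI ballI) auto
qed

text \<open>Here \<open>f z\<close> is fixed on \<open>A\<close> and conjugated by \<open>z\<close> on \<open>B\<close>. So an alternating product becomes
  a word in \<open>z\<close> with alternating signs, with junction conditions on both kinds of coefficients.\<close>

theorem amalgam_factor_embedding: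
  fixes P :: "('p, 'k) monoid_scheme"
  assumes P: "group P" "countable (carrier P)" and A: "subgroup A P" and B: "subgroup B P"
    and gen: "carrier P = generate P (A \<union> B)"
    and N: "subgroup N G" "power_separated (G\<lparr>carrier := N\<rparr>)"
    and D: "subgroup D G" "D \<subseteq> N"
    and f: "\<And>z. z \<in> T closure_of D \<Longrightarrow> f z \<in> hom P G"
      "\<And>z a. z \<in> T closure_of D \<Longrightarrow> a \<in> A \<Longrightarrow> f z a = \<theta> a"
      "\<And>z b. z \<in> T closure_of D \<Longrightarrow> b \<in> B \<Longrightarrow> f z b = z \<otimes> \<theta> b \<otimes> inv z"
    and \<theta>: "\<And>v. v \<in> A \<union> B \<Longrightarrow> \<theta> v \<in> N" "\<And>v. v \<in> A \<Longrightarrow> \<theta> v = \<one> \<Longrightarrow> v = \<one>\<^bsub>P\<^esub>"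
    and sep: "\<And>y. y \<in> D \<Longrightarrow> \<exists>c\<in>D. c \<noteq> \<one> \<and> (\<forall>b\<in>B - A. \<theta> b \<otimes> c \<noteq> c \<otimes> \<theta> b) \<and>
       (\<forall>a\<in>A - B. (inv y \<otimes> \<theta> a \<otimes> y) \<otimes> c \<noteq> c \<otimes> (inv y \<otimes> \<theta> a \<otimes> y))"
  shows "\<exists>z\<in>T closure_of D. inj_on (f z) (carrier P)"
proof (rule generic_embedding[OF D(1) P f(1)])
  interpret P: group P by fact
  have NG: "x \<in> carrier G" if "x \<in> N" for x using that subgroup.subset[OF N(1)] by blast
  have ZG: "z \<in> carrier G" if "z \<in> T closure_of D" for z
    using that closure_of_subset_topspace[of T D] by auto
  fix x assume x: "x \<in> carrier P" "x \<noteq> \<one>\<^bsub>P\<^esub>"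
  have xg: "x \<in> generate P (A \<union> B)" using x(1) gen by simp
  obtain v ws where v: "v \<in> A" and ws: "set ws \<subseteq> (B - A) \<times> A"
    and xv: "x = v \<otimes>\<^bsub>P\<^esub> amalgam_word P ws"
    and red: "successively (\<lambda>w w'. snd w \<notin> B) ws"
    using P.amalgam_reduced_form[OF A B xg] by (elim exE conjE) (rule that)
  define conv where "conv = (\<lambda>ws. concat (map (\<lambda>(b, a). [(\<one>, True, \<theta> b), (\<one>, False, \<theta> a)]) ws))"
  have conv: "conv [] = []" "conv ((b, a) # us) = (\<one>, True, \<theta> b) # (\<one>, False, \<theta> a) # conv us" for b a us
    by (simp_all add: conv_def)
  have us: "\<forall>(\<alpha>, e, \<beta>) \<in> set (conv ws). \<alpha> \<in> N \<and> \<beta> \<in> N"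
    using ws \<theta>(1) N(1) by (fastforce simp: conv_def subgroup.one_closed)
  have val: "f z x = \<theta> v \<otimes> zeval G z (conv ws)" if z: "z \<in> T closure_of D" for z
  proof -
    interpret F: group_hom P G "f z"
      using f(1)[OF z] P(1) by (simp add: group_hom_def group_hom_axioms_def)
    have PA: "y \<in> carrier P" if "y \<in> A" for y using that by (rule subgroup.mem_carrier[OF A])
    have PB: "y \<in> carrier P" if "y \<in> B" for y using that by (rule subgroup.mem_carrier[OF B])
    have cl: "amalgam_word P ws \<in> carrier P" if "set ws \<subseteq> (B - A) \<times> A" for ws
      by (rule P.amalgam_word_closed) (use that PA PB in blast)
    have "f z (amalgam_word P ws) = zeval G z (conv ws)"
      using ws
    proof (induction ws)
      case (Cons w ws)
      obtain b a where w: "w = (b, a)" by force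
      have ba: "b \<in> B" "a \<in> A" "set ws \<subseteq> (B - A) \<times> A" using Cons.prems w by auto
      have zc: "zeval G z (conv ws) \<in> carrier G" unfolding Cons.IH[OF ba(3), symmetric] by (rule F.hom_closed[OF cl[OF ba(3)]])
      have "f z (amalgam_word P (w # ws)) = f z b \<otimes> (f z a \<otimes> f z (amalgam_word P ws))"
        using PA[OF ba(2)] PB[OF ba(1)] cl[OF ba(3)] by (simp add: w)
      also have "\<dots> = z \<otimes> \<theta> b \<otimes> inv z \<otimes> (\<theta> a \<otimes> zeval G z (conv ws))"
        unfolding Cons.IH[OF ba(3)] f(2)[OF z ba(2)] f(3)[OF z ba(1)] ..
      also have "\<dots> = zeval G z (conv (w # ws))"
        using ZG[OF z] NG[OF \<theta>(1)] ba zc by (simp add: w conv zpow_def m_assoc)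
      finally show ?case .
    qed (simp add: conv)
    then show ?thesis unfolding xv F.hom_mult[OF PA[OF v] cl[OF ws]] f(2)[OF z v] by simp
  qed
  have fin: "\<exists>c\<in>D. finite {n::nat. \<theta> v \<otimes> zeval G (y \<otimes> c [^] n) (conv ws) = \<one>}" if y: "y \<in> D" for y
  proof -
    obtain c where c: "c \<in> D" "c \<noteq> \<one>" and cB: "\<forall>b\<in>B - A. \<theta> b \<otimes> c \<noteq> c \<otimes> \<theta> b"
      and cA: "\<forall>a\<in>A - B. (inv y \<otimes> \<theta> a \<otimes> y) \<otimes> c \<noteq> c \<otimes> (inv y \<otimes> \<theta> a \<otimes> y)"
      using sep[OF y] by (elim bexE conjE) (rule that)
    show ?thesis
    proof (cases "ws = []")
      case True
      then have "x = v" using xv subgroup.mem_carrier[OF A v] by simp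
      then have "\<theta> v \<noteq> \<one>" using \<theta>(2)[OF v] x(2) by blast
      then show ?thesis using c(1) NG[OF \<theta>(1)] v True by (intro bexI[of _ c]) (simp_all add: conv)
    next
      case False
      define R :: "'a \<times> bool \<times> 'a \<Rightarrow> 'a \<times> bool \<times> 'a \<Rightarrow> bool" where "R = (\<lambda>(\<alpha>, e, \<beta>) (\<alpha>', e', \<beta>').
        (e \<and> \<not> e' \<longrightarrow> (\<beta> \<otimes> \<alpha>') \<otimes> c \<noteq> c \<otimes> (\<beta> \<otimes> \<alpha>')) \<and>
        (\<not> e \<and> e' \<longrightarrow> (inv y \<otimes> (\<beta> \<otimes> \<alpha>') \<otimes> y) \<otimes> c \<noteq> c \<otimes> (inv y \<otimes> (\<beta> \<otimes> \<alpha>') \<otimes> y)))"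
      have "successively R (conv ws)" using ws red
      proof (induction ws)
        case (Cons w ws)
        obtain b a where w: "w = (b, a)" by force
        have ba: "b \<in> B - A" "a \<in> A" "set ws \<subseteq> (B - A) \<times> A" using Cons.prems w by auto
        have G: "\<theta> b \<in> carrier G" "\<theta> a \<in> carrier G" using NG[OF \<theta>(1)] ba by auto
        note prems2 = Cons.prems(2)
        have "successively (\<lambda>w w'. snd w \<notin> B) ws" using prems2 by (rule successively_tail)
        note IH = Cons.IH[OF ba(3) this]
        have 1: "R (\<one>, True, \<theta> b) (\<one>, False, \<theta> a)" using cB ba(1) G by (simp add: R_def)
        show ?case
        proof (cases ws)
          case Nil
          then show ?thesis using 1 by (simp add: w conv)
        next
          case (Cons w' ws')
          obtain b' a' where w': "w' = (b', a')" by force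
          have "a \<notin> B" using prems2 w unfolding Cons by simp
          then have "R (\<one>, False, \<theta> a) (\<one>, True, \<theta> b')" using cA ba(2) G by (simp add: R_def)
          then show ?thesis using 1 IH unfolding Cons by (simp add: w w' conv)
        qed
      qed (simp add: conv)
      moreover have "conv ws \<noteq> []" using False by (cases ws) (auto simp: conv)
      ultimately have "finite {n::nat. \<theta> v \<otimes> zeval G (y \<otimes> c [^] n) (conv ws) = \<one>}"
        using D(2) y c \<theta>(1) v us unfolding R_def
        by (intro shifted_power_word_finite[OF N]) auto
      then show ?thesis using c(1) by blast
    qed
  qed
  show "\<exists>h ws. h \<in> carrier G \<and>
       (\<forall>(\<alpha>, e, \<beta>) \<in> set ws. \<alpha> \<in> carrier G \<and> \<beta> \<in> carrier G) \<and>
       (\<forall>z\<in>T closure_of D. f z x = h \<otimes> zeval G z ws) \<and>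
       (\<forall>y\<in>D. \<exists>c\<in>D. finite {n::nat. h \<otimes> zeval G (y \<otimes> c [^] n) ws = \<one>})"
  proof (intro exI conjI)
    show "\<theta> v \<in> carrier G" using NG[OF \<theta>(1)] v by blast
    show "\<forall>(\<alpha>, e, \<beta>) \<in> set (conv ws). \<alpha> \<in> carrier G \<and> \<beta> \<in> carrier G" using us NG by auto
    show "\<forall>z\<in>T closure_of D. f z x = \<theta> v \<otimes> zeval G z (conv ws)" by (rule ballI) (rule val)
    show "\<forall>y\<in>D. \<exists>c\<in>D. finite {n::nat. \<theta> v \<otimes> zeval G (y \<otimes> c [^] n) (conv ws) = \<one>}"
      by (rule ballI) (rule fin)
  qed
qed

end

section \<open>Presentations and maximal abelian subgroups\<close>

lemma pres_class_word_eval: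
  assumes "u \<in> words X"
  shows "pres_cong X R `` {u} = word_eval (presented_group X R) (pres_gen X R) u"
proof -
  have "(\<lambda>x. x) \<in> hom (presented_group X R) (presented_group X R)" by (simp add: hom_def)
  from hom_pres_class[OF group_presented_group this assms] show ?thesis .
qed

lemma relator_trivial:
  assumes "r \<in> R" "r \<in> words X"
  shows "word_eval (presented_group X R) (pres_gen X R) r = \<one>\<^bsub>presented_group X R\<^esub>"
  unfolding pres_class_word_eval[OF assms(2), symmetric] one_presented_group
  using pres_class_eq[OF assms(2), of "[]" R] pres_cong.relator[OF assms] by simp

lemma generate_pres_gen:
  "carrier (presented_group X R) = generate (presented_group X R) (pres_gen X R ` X)"
proof
  let ?P = "presented_group X R" and ?S = "pres_gen X R ` X"
  interpret P: group ?P by (rule group_presented_group)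
  have sub: "?S \<subseteq> carrier ?P" by (rule image_subsetI) (rule pres_gen_closed)
  then show "generate ?P ?S \<subseteq> carrier ?P" by (rule P.generate_incl)
  have "word_eval ?P (pres_gen X R) u \<in> generate ?P ?S" if "u \<in> words X" for u
    using that
  proof (induction u)
    case Nil then show ?case by (simp add: generate.one)
  next
    case (Cons p u)
    obtain b x where p: "p = (b, x)" by force
    have x: "pres_gen X R x \<in> ?S" using Cons.prems p by simp
    have "letter_eval ?P (pres_gen X R) p \<in> generate ?P ?S"
      using generate.incl[OF x, of ?P] generate.inv[OF x, of ?P] by (simp add: letter_eval_def p)
    moreover have "word_eval ?P (pres_gen X R) u \<in> generate ?P ?S" using Cons by simp
    ultimately show ?case by (simp add: generate.eng)
  qed
  then show "carrier ?P \<subseteq> generate ?P ?S"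
    unfolding carrier_presented_group using pres_class_word_eval[of _ X R] by auto
qed

lemma countable_presented_group:
  assumes "countable X"
  shows "countable (carrier (presented_group X R))"
proof -
  have "countable (words X)" unfolding words_def using assms by (intro countable_lists countable_SIGMA) auto
  then show ?thesis unfolding carrier_presented_group by (rule countable_image)
qed

lemma mult_relators_hom:
  assumes "group H" "mult_relators e H \<subseteq> R" "e ` carrier H \<subseteq> X"
  shows "(\<lambda>g. pres_gen X R (e g)) \<in> hom H (presented_group X R)"
proof (rule homI)
  interpret H: group H by fact
  interpret P: group "presented_group X R" by (rule group_presented_group)
  have cl: "pres_gen X R (e g) \<in> carrier (presented_group X R)" if "g \<in> carrier H" for g
    using that assms(3) by (intro pres_gen_closed) blast
  fix g h assume gh: "g \<in> carrier H" "h \<in> carrier H"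
  show "pres_gen X R (e g) \<in> carrier (presented_group X R)" by (rule cl[OF gh(1)])
  have k: "pres_gen X R (e (g \<otimes>\<^bsub>H\<^esub> h)) \<in> carrier (presented_group X R)" using cl gh by simp
  let ?r = "[(True, e g), (True, e h), (False, e (g \<otimes>\<^bsub>H\<^esub> h))]"
  have "?r \<in> R" using assms(2) gh unfolding mult_relators_def by blast
  moreover have "?r \<in> words X" using assms(3) gh H.m_closed[OF gh] by auto
  ultimately have "word_eval (presented_group X R) (pres_gen X R) ?r = \<one>\<^bsub>presented_group X R\<^esub>"
    by (rule relator_trivial)
  then have "(pres_gen X R (e g) \<otimes>\<^bsub>presented_group X R\<^esub> pres_gen X R (e h))
      \<otimes>\<^bsub>presented_group X R\<^esub> inv\<^bsub>presented_group X R\<^esub> pres_gen X R (e (g \<otimes>\<^bsub>H\<^esub> h)) = \<one>\<^bsub>presented_group X R\<^esub>"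
    using cl[OF gh(1)] cl[OF gh(2)] k by (simp add: letter_eval_def P.m_assoc)
  then show "pres_gen X R (e (g \<otimes>\<^bsub>H\<^esub> h)) = pres_gen X R (e g) \<otimes>\<^bsub>presented_group X R\<^esub> pres_gen X R (e h)"
    using P.inv_equality[of _ "inv\<^bsub>presented_group X R\<^esub> pres_gen X R (e (g \<otimes>\<^bsub>H\<^esub> h))"] k
      P.m_closed[OF cl[OF gh(1)] cl[OF gh(2)]] by (simp add: P.inv_inv)
qed

lemma mult_relators_eval:
  assumes "group H" "group K" "k \<in> hom H K" "\<And>g. g \<in> carrier H \<Longrightarrow> h (e g) = k g" "r \<in> mult_relators e H"
  shows "word_eval K h r = \<one>\<^bsub>K\<^esub>"
proof -
  interpret k: group_hom H K k using assms by (simp add: group_hom_def group_hom_axioms_def)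
  obtain x y where r: "r = [(True, e x), (True, e y), (False, e (x \<otimes>\<^bsub>H\<^esub> y))]"
    and xy: "x \<in> carrier H" "y \<in> carrier H"
    using assms(5) unfolding mult_relators_def by blast
  have "word_eval K h r = k x \<otimes>\<^bsub>K\<^esub> (k y \<otimes>\<^bsub>K\<^esub> inv\<^bsub>K\<^esub> (k x \<otimes>\<^bsub>K\<^esub> k y))"
    using xy assms(4)[OF xy(1)] assms(4)[OF xy(2)] assms(4)[of "x \<otimes>\<^bsub>H\<^esub> y"]
    by (simp add: r letter_eval_def)
  also have "\<dots> = \<one>\<^bsub>K\<^esub>"
    using k.hom_closed[OF xy(1)] k.hom_closed[OF xy(2)]
    by (simp add: k.H.inv_mult_group k.H.m_assoc[symmetric])
  finally show ?thesis .
qed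

text \<open>By commutative transitivity of \<open>N\<close>, the elements of \<open>A\<close> whose images commute with \<open>d\<close> form an abelian
  subgroup. It contains \<open>E\<close>, hence equals \<open>E\<close>.\<close>

lemma (in group) maximal_abelian_separates:
  assumes A: "group A" and N: "subgroup N G" "commutative_transitive (G\<lparr>carrier := N\<rparr>)"
    and \<theta>: "\<theta> \<in> hom A G" "inj_on \<theta> (carrier A)" "\<theta> ` carrier A \<subseteq> N"
    and E: "maximal_abelian_subgroup E A" and d: "d \<in> \<theta> ` E" "d \<noteq> \<one>" and a: "a \<in> carrier A" "a \<notin> E"
  shows "\<theta> a \<otimes> d \<noteq> d \<otimes> \<theta> a"
proof
  assume com: "\<theta> a \<otimes> d = d \<otimes> \<theta> a"
  interpret T: group_hom A G \<theta> using A \<theta>(1) by (simp add: group_hom_def group_hom_axioms_def)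
  define K where "K = {x \<in> carrier A. \<theta> x \<otimes> d = d \<otimes> \<theta> x}"
  have sE: "subgroup E A" and cE: "comm_group (A\<lparr>carrier := E\<rparr>)"
    and max: "\<And>K. subgroup K A \<Longrightarrow> comm_group (A\<lparr>carrier := K\<rparr>) \<Longrightarrow> E \<subseteq> K \<Longrightarrow> K = E"
    using E unfolding maximal_abelian_subgroup_def by blast+
  have EA: "x \<in> carrier A" if "x \<in> E" for x using that by (rule subgroup.mem_carrier[OF sE])
  have NG: "x \<in> carrier G" if "x \<in> N" for x using that by (rule subgroup.mem_carrier[OF N(1)])
  obtain e where e: "e \<in> E" "d = \<theta> e" using d(1) by blast
  have dN: "d \<in> N" using \<theta>(3) EA[OF e(1)] e(2) by blast
  have dG: "d \<in> carrier G" using NG[OF dN] .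
  have K: "subgroup K A"
  proof (rule T.G.subgroupI)
    show "K \<subseteq> carrier A" by (auto simp: K_def)
    have "\<one>\<^bsub>A\<^esub> \<in> K" using dG by (simp add: K_def)
    then show "K \<noteq> {}" by blast
  next
    fix x assume "x \<in> K"
    then have x: "x \<in> carrier A" "\<theta> x \<otimes> d = d \<otimes> \<theta> x" by (auto simp: K_def)
    then show "inv\<^bsub>A\<^esub> x \<in> K" using commute_inv_imp[OF T.hom_closed[OF x(1)] dG x(2)] by (simp add: K_def)
  next
    fix x y assume "x \<in> K" "y \<in> K"
    then have x: "x \<in> carrier A" "\<theta> x \<otimes> d = d \<otimes> \<theta> x" and y: "y \<in> carrier A" "\<theta> y \<otimes> d = d \<otimes> \<theta> y"
      by (auto simp: K_def)
    have "\<theta> x \<otimes> \<theta> y \<otimes> d = \<theta> x \<otimes> (d \<otimes> \<theta> y)"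
      using x y dG by (simp add: m_assoc)
    also have "\<dots> = d \<otimes> \<theta> x \<otimes> \<theta> y" using x y dG by (simp add: m_assoc[symmetric])
    also have "\<dots> = d \<otimes> (\<theta> x \<otimes> \<theta> y)" using x y dG by (simp add: m_assoc)
    finally show "x \<otimes>\<^bsub>A\<^esub> y \<in> K" using x y by (simp add: K_def)
  qed
  have com2: "x \<otimes>\<^bsub>A\<^esub> y = y \<otimes>\<^bsub>A\<^esub> x" if "x \<in> K" "y \<in> K" for x y
  proof -
    have x: "x \<in> carrier A" "\<theta> x \<otimes> d = d \<otimes> \<theta> x" and y: "y \<in> carrier A" "\<theta> y \<otimes> d = d \<otimes> \<theta> y"
      using that by (auto simp: K_def)
    have "\<theta> x \<in> N" "\<theta> y \<in> N" using \<theta>(3) x(1) y(1) by auto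
    then have "\<theta> x \<otimes> \<theta> y = \<theta> y \<otimes> \<theta> x"
      using N(2) dN d(2) x(2) y(2) unfolding commutative_transitive_def by simp
    then have "\<theta> (x \<otimes>\<^bsub>A\<^esub> y) = \<theta> (y \<otimes>\<^bsub>A\<^esub> x)" using x(1) y(1) by simp
    then show ?thesis using inj_onD[OF \<theta>(2)] x(1) y(1) by simp
  qed
  have "comm_group (A\<lparr>carrier := K\<rparr>)"
    by (rule group.group_comm_groupI[OF subgroup.subgroup_is_group[OF K A]]) (simp add: com2)
  moreover have "E \<subseteq> K"
  proof
    fix x assume x: "x \<in> E"
    have "x \<otimes>\<^bsub>A\<^esub> e = e \<otimes>\<^bsub>A\<^esub> x"
      using comm_groupE(4)[OF cE, of x e] x e(1) by simp
    then have "\<theta> (x \<otimes>\<^bsub>A\<^esub> e) = \<theta> (e \<otimes>\<^bsub>A\<^esub> x)" by simp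
    then show "x \<in> K" using EA[OF x] EA[OF e(1)] e(2) by (simp add: K_def)
  qed
  ultimately have "K = E" using K by (intro max)
  moreover have "a \<in> K" using a(1) com by (simp add: K_def)
  ultimately show False using a(2) by blast
qed

lemma (in group) abelian_image:
  assumes C: "comm_group C" and "k \<in> hom C G"
  shows "subgroup (k ` carrier C) G" "\<And>x y. x \<in> k ` carrier C \<Longrightarrow> y \<in> k ` carrier C \<Longrightarrow> x \<otimes> y = y \<otimes> x"
proof -
  interpret C: comm_group C by fact
  interpret k: group_hom C G k using assms(2) by (simp add: group_hom_def group_hom_axioms_def)
  show "subgroup (k ` carrier C) G" by (rule k.img_is_subgroup)
  show "x \<otimes> y = y \<otimes> x" if xy: "x \<in> k ` carrier C" "y \<in> k ` carrier C" for x y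
  proof -
    obtain a b where "a \<in> carrier C" "b \<in> carrier C" "x = k a" "y = k b" using xy by blast
    then show ?thesis using C.m_comm[of a b] by (simp flip: k.hom_mult)
  qed
qed

lemma (in group) cancel_left:
  assumes "x \<in> carrier G" "y \<in> carrier G"
  shows "x \<otimes> (inv x \<otimes> y) = y" "inv x \<otimes> (x \<otimes> y) = y"
  using assms by (simp_all flip: m_assoc)

lemma (in group) commute_conjugate_iff:
  assumes "x \<in> carrier G" "a \<in> carrier G" "d \<in> carrier G"
  shows "(inv x \<otimes> a \<otimes> x) \<otimes> d = d \<otimes> (inv x \<otimes> a \<otimes> x) \<longleftrightarrow> a \<otimes> (x \<otimes> d \<otimes> inv x) = (x \<otimes> d \<otimes> inv x) \<otimes> a"
proof -
  have 1: "x \<otimes> ((inv x \<otimes> a \<otimes> x) \<otimes> d) \<otimes> inv x = a \<otimes> (x \<otimes> d \<otimes> inv x)"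
    and 2: "x \<otimes> (d \<otimes> (inv x \<otimes> a \<otimes> x)) \<otimes> inv x = (x \<otimes> d \<otimes> inv x) \<otimes> a"
    using assms by (simp_all add: m_assoc cancel_left)
  show ?thesis
  proof
    assume "(inv x \<otimes> a \<otimes> x) \<otimes> d = d \<otimes> (inv x \<otimes> a \<otimes> x)"
    then show "a \<otimes> (x \<otimes> d \<otimes> inv x) = (x \<otimes> d \<otimes> inv x) \<otimes> a" unfolding 1[symmetric] 2[symmetric] by simp
  next
    assume "a \<otimes> (x \<otimes> d \<otimes> inv x) = (x \<otimes> d \<otimes> inv x) \<otimes> a"
    then have "x \<otimes> ((inv x \<otimes> a \<otimes> x) \<otimes> d) \<otimes> inv x = x \<otimes> (d \<otimes> (inv x \<otimes> a \<otimes> x)) \<otimes> inv x"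
      unfolding 1 2 .
    then show "(inv x \<otimes> a \<otimes> x) \<otimes> d = d \<otimes> (inv x \<otimes> a \<otimes> x)" using assms by simp
  qed
qed

section \<open>HNN extensions\<close>

context compact_top_group
begin

text \<open>The map \<open>\<Phi>\<close> is twisted by \<open>z\<close> in the closure of the image \<open>D\<close> of the edge group, sending the stable
  letter to \<open>\<tau> z\<close> with \<open>\<tau> = \<Phi> t\<close>. The edge relations survive because \<open>z\<close> centralizes \<open>D\<close>. The closure of
  the twisted image contains \<open>D\<close>, so \<open>z\<close>, so \<open>\<tau>\<close>, and therefore the whole image of \<open>\<Phi>\<close>.\<close>

theorem HNN_embedding:
  fixes A :: "('v, 'm) monoid_scheme" and C :: "('c, 'k) monoid_scheme" and i j :: "'c \<Rightarrow> 'v"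
  defines "P \<equiv> HNN A C i j"
  assumes A: "group A" "countable (carrier A)"
    and C: "comm_group C" "carrier C \<noteq> {\<one>\<^bsub>C\<^esub>}"
    and ij: "double_edge C A i" "double_edge C A j"
    and \<Phi>: "\<Phi> \<in> hom P G" "inj_on (\<Phi> \<circ> HNN_vertex A C i j) (carrier A)"
    and N: "commutative_transitive (G\<lparr>carrier := \<Phi> ` carrier P\<rparr>)"
      "power_separated (G\<lparr>carrier := \<Phi> ` carrier P\<rparr>)"
  shows "\<exists>f\<in>hom P G. inj_on f (carrier P) \<and> \<Phi> ` carrier P \<subseteq> T closure_of (f ` carrier P)"
proof -
  let ?X = "HNN_gens A" and ?R = "HNN_rels A C i j"
  have Pdef: "P = presented_group ?X ?R" by (simp add: P_def HNN_def)
  have grpP: "group P" unfolding Pdef by (rule group_presented_group)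
  interpret P: group P by (rule grpP)
  interpret A: group A by (rule A(1))
  interpret C: comm_group C by (rule C(1))
  interpret F: group_hom P G \<Phi> using grpP \<Phi>(1) by (simp add: group_hom_def group_hom_axioms_def)
  define N where "N = \<Phi> ` carrier P"
  have subN: "subgroup N G" unfolding N_def by (rule F.img_is_subgroup)
  note NN = N[folded N_def]
  define v where "v = HNN_vertex A C i j"
  have v_eq: "v = (\<lambda>a. pres_gen ?X ?R (Some a))" by (simp add: v_def HNN_vertex_def fun_eq_iff)
  define t where "t = pres_gen ?X ?R None"
  have hv: "v \<in> hom A P"
    unfolding v_eq Pdef by (rule mult_relators_hom[OF A(1)]) (auto simp: HNN_rels_def HNN_gens_def)
  interpret v: group_hom A P v using A(1) grpP hv by (simp add: group_hom_def group_hom_axioms_def)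
  have t: "t \<in> carrier P" unfolding t_def Pdef by (rule pres_gen_closed) (simp add: HNN_gens_def)
  have hi: "i \<in> hom C A" "inj_on i (carrier C)" "maximal_abelian_subgroup (i ` carrier C) A"
    and hj: "j \<in> hom C A" "inj_on j (carrier C)" "maximal_abelian_subgroup (j ` carrier C) A"
    using ij by (auto simp: double_edge_def mon_def)
  have iA: "i c \<in> carrier A" and jA: "j c \<in> carrier A" if "c \<in> carrier C" for c
    using that hi(1) hj(1) by (auto simp: hom_def)
  have edge: "t \<otimes>\<^bsub>P\<^esub> v (i c) \<otimes>\<^bsub>P\<^esub> inv\<^bsub>P\<^esub> t = v (j c)" if c: "c \<in> carrier C" for c
  proof -
    let ?r = "[(True, None), (True, Some (i c)), (False, None), (False, Some (j c))]"
    have "?r \<in> ?R" unfolding HNN_rels_def using c by blast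
    moreover have "?r \<in> words ?X" using iA[OF c] jA[OF c] by (simp add: HNN_gens_def)
    ultimately have "word_eval P (pres_gen ?X ?R) ?r = \<one>\<^bsub>P\<^esub>"
      unfolding Pdef by (rule relator_trivial)
    then have "(t \<otimes>\<^bsub>P\<^esub> v (i c) \<otimes>\<^bsub>P\<^esub> inv\<^bsub>P\<^esub> t) \<otimes>\<^bsub>P\<^esub> inv\<^bsub>P\<^esub> v (j c) = \<one>\<^bsub>P\<^esub>"
      using t v.hom_closed[OF iA[OF c]] v.hom_closed[OF jA[OF c]]
      by (simp add: letter_eval_def P.m_assoc flip: t_def) (simp add: v_eq P.m_assoc)
    from P.inv_equality[OF this] show ?thesis
      using t v.hom_closed[OF iA[OF c]] v.hom_closed[OF jA[OF c]] by simp
  qed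
  define V where "V = v ` carrier A"
  have V: "subgroup V P" unfolding V_def by (rule v.img_is_subgroup)
  have gens: "pres_gen ?X ?R ` ?X = insert t V" by (auto simp: HNN_gens_def t_def V_def v_eq)
  have genP: "carrier P = generate P (insert t V)"
    unfolding gens[symmetric] Pdef by (rule generate_pres_gen)
  have countP: "countable (carrier P)"
    unfolding Pdef by (rule countable_presented_group) (use A(2) in \<open>simp add: HNN_gens_def\<close>)
  define \<tau> where "\<tau> = \<Phi> t"
  have \<tau>: "\<tau> \<in> N" "\<tau> \<in> carrier G" using t by (auto simp: \<tau>_def N_def)
  define \<theta> where "\<theta> = \<Phi> \<circ> v"
  have h\<theta>: "\<theta> \<in> hom A G" "inj_on \<theta> (carrier A)"
    using Group.hom_compose[OF hv \<Phi>(1)] \<Phi>(2) by (simp_all add: \<theta>_def v_def)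
  have \<theta>N: "\<theta> a \<in> N" and \<theta>G: "\<theta> a \<in> carrier G" if "a \<in> carrier A" for a
    using that by (auto simp: \<theta>_def N_def)
  define D where "D = (\<theta> \<circ> i) ` carrier C"
  have D: "subgroup D G" "\<And>x y. x \<in> D \<Longrightarrow> y \<in> D \<Longrightarrow> x \<otimes> y = y \<otimes> x"
    unfolding D_def using abelian_image[OF C(1) Group.hom_compose[OF hi(1) h\<theta>(1)]] by blast+
  have DN: "D \<subseteq> N" unfolding D_def using \<theta>N iA by auto
  have DG: "d \<in> carrier G" if "d \<in> D" for d using that by (rule subgroup.mem_carrier[OF D(1)])
  have ZG: "z \<in> carrier G" if "z \<in> T closure_of D" for z
    using that closure_of_subset_topspace[of T D] by auto
  have zcom: "z \<otimes> d = d \<otimes> z" if "z \<in> T closure_of D" "d \<in> D" for z d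
    by (rule closure_commutes[OF that(1) DG[OF that(2)] D(2)[OF _ that(2)]])
  have edgeG: "\<tau> \<otimes> \<theta> (i c) \<otimes> inv \<tau> = \<theta> (j c)" if c: "c \<in> carrier C" for c
  proof -
    have "\<Phi> (t \<otimes>\<^bsub>P\<^esub> v (i c) \<otimes>\<^bsub>P\<^esub> inv\<^bsub>P\<^esub> t) = \<Phi> (v (j c))" by (simp only: edge[OF c])
    then show ?thesis using t v.hom_closed[OF iA[OF c]] by (simp add: \<tau>_def \<theta>_def)
  qed
  have "\<exists>k. k \<in> hom P G \<and> (\<forall>a\<in>carrier A. k (v a) = \<theta> a) \<and> k t = \<tau> \<otimes> z" if z: "z \<in> T closure_of D" for z
  proof -
    define h where "h x = (case x of None \<Rightarrow> \<tau> \<otimes> z | Some a \<Rightarrow> \<theta> a)" for x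
    have h: "h \<in> ?X \<rightarrow> carrier G"
      using \<tau>(2) ZG[OF z] \<theta>G by (auto simp: h_def HNN_gens_def)
    have rel: "word_eval G h r = \<one>" if "r \<in> ?R" for r
    proof -
      have "r \<in> mult_relators Some A \<or> (\<exists>c. r = [(True, None), (True, Some (i c)), (False, None),
          (False, Some (j c))] \<and> c \<in> carrier C)"
        using that unfolding HNN_rels_def Un_iff mem_Collect_eq .
      then consider "r \<in> mult_relators Some A" | c where "c \<in> carrier C"
        "r = [(True, None), (True, Some (i c)), (False, None), (False, Some (j c))]"
        by (elim disjE exE conjE)
      then show ?thesis
      proof cases
        case 1
        show ?thesis by (rule mult_relators_eval[OF A(1) group_axioms h\<theta>(1) _ 1]) (simp add: h_def)
      next
        case (2 c)
        have d: "\<theta> (i c) \<in> D" unfolding D_def using 2(1) by simp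
        have cG: "\<theta> (i c) \<in> carrier G" "\<theta> (j c) \<in> carrier G" using \<theta>G iA jA 2(1) by auto
        note zG = ZG[OF z]
        have "word_eval G h r = (\<tau> \<otimes> z) \<otimes> (\<theta> (i c) \<otimes> (inv (\<tau> \<otimes> z) \<otimes> inv \<theta> (j c)))"
          unfolding 2(2) using cG by (simp add: letter_eval_def h_def)
        also have "\<dots> = \<tau> \<otimes> ((z \<otimes> \<theta> (i c)) \<otimes> inv z) \<otimes> inv \<tau> \<otimes> inv \<theta> (j c)"
          using cG zG \<tau>(2) by (simp add: inv_mult_group m_assoc)
        also have "(z \<otimes> \<theta> (i c)) \<otimes> inv z = \<theta> (i c)"
          unfolding zcom[OF z d] using cG zG by (simp add: m_assoc)
        also have "\<tau> \<otimes> \<theta> (i c) \<otimes> inv \<tau> \<otimes> inv \<theta> (j c) = \<one>"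
          unfolding edgeG[OF 2(1)] using cG by simp
        finally show ?thesis .
      qed
    qed
    obtain k where k: "k \<in> hom (presented_group ?X ?R) G" "\<And>x. x \<in> ?X \<Longrightarrow> k (pres_gen ?X ?R x) = h x"
      by (rule pres_universal_class[OF group_axioms h rel]) (assumption, rule that)
    have "k (v a) = \<theta> a" if "a \<in> carrier A" for a
      unfolding v_eq using k(2)[of "Some a"] that by (simp add: HNN_gens_def h_def)
    moreover have "k t = \<tau> \<otimes> z" unfolding t_def using k(2)[of None] by (simp add: HNN_gens_def h_def)
    ultimately show ?thesis using k(1) unfolding Pdef by blast
  qed
  then obtain f where f: "\<And>z. z \<in> T closure_of D \<Longrightarrow> f z \<in> hom P G"
    "\<And>z a. z \<in> T closure_of D \<Longrightarrow> a \<in> carrier A \<Longrightarrow> f z (v a) = \<theta> a"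
    "\<And>z. z \<in> T closure_of D \<Longrightarrow> f z t = \<tau> \<otimes> z"
    by metis
  obtain c0 where c0: "c0 \<in> carrier C" "c0 \<noteq> \<one>\<^bsub>C\<^esub>" using C(2) C.one_closed by blast
  define c where "c = \<theta> (i c0)"
  have inj_one: "\<theta> (k c0) \<noteq> \<one>" if k: "k \<in> hom C A" "inj_on k (carrier C)" for k
  proof
    interpret k: group_hom C A k using k(1) by (simp add: group_hom_def group_hom_axioms_def)
    interpret th: group_hom A G \<theta> using h\<theta>(1) by (simp add: group_hom_def group_hom_axioms_def)
    assume "\<theta> (k c0) = \<one>"
    then have "\<theta> (k c0) = \<theta> (k \<one>\<^bsub>C\<^esub>)" by simp
    then have "k c0 = k \<one>\<^bsub>C\<^esub>"
      by (rule inj_onD[OF h\<theta>(2)]) (use c0(1) in simp_all)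
    then have "c0 = \<one>\<^bsub>C\<^esub>" by (rule inj_onD[OF k(2)]) (use c0(1) in simp_all)
    with c0(2) show False by contradiction
  qed
  have c: "c \<in> D" "c \<noteq> \<one>" unfolding c_def D_def using c0(1) inj_one[OF hi(1,2)] by simp_all
  note separates = maximal_abelian_separates[OF A(1) subN NN(1) h\<theta>(1,2)]
  have \<theta>sub: "\<theta> ` carrier A \<subseteq> N" using \<theta>N by blast
  have "\<exists>z\<in>T closure_of D. inj_on (f z) (carrier P)"
  proof (rule stable_letter_embedding[OF grpP countP V t genP subN NN(2) D(1) DN \<tau>(1) f(1) _ f(3)])
    fix z x assume "z \<in> T closure_of D" "x \<in> V"
    then show "f z x = \<Phi> x" using f(2) by (auto simp: V_def \<theta>_def)
  next
    fix x assume x: "x \<in> V"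
    then obtain a where a: "a \<in> carrier A" "x = v a" by (auto simp: V_def)
    show "\<Phi> x \<in> N" using \<theta>N[OF a(1)] by (simp add: \<theta>_def a(2))
    assume "\<Phi> x = \<one>"
    interpret th: group_hom A G \<theta> using h\<theta>(1) by (simp add: group_hom_def group_hom_axioms_def)
    have "\<theta> a = \<theta> \<one>\<^bsub>A\<^esub>" using \<open>\<Phi> x = \<one>\<close> by (simp add: \<theta>_def a(2))
    then have "a = \<one>\<^bsub>A\<^esub>" by (rule inj_onD[OF h\<theta>(2)]) (use a(1) in simp_all)
    then show "x = \<one>\<^bsub>P\<^esub>" by (simp add: a(2))
  next
    fix S y assume S: "S \<subseteq> V" and y: "y \<in> D"
    have "\<Phi> x \<otimes> c \<noteq> c \<otimes> \<Phi> x"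
      if x: "x \<in> S" "t \<otimes>\<^bsub>P\<^esub> x \<otimes>\<^bsub>P\<^esub> inv\<^bsub>P\<^esub> t \<notin> V" for x
    proof -
      obtain a where a: "a \<in> carrier A" "x = v a" using S x(1) by (auto simp: V_def)
      have "a \<notin> i ` carrier C" using x(2) edge jA by (auto simp: a(2) V_def)
      then have "\<theta> a \<otimes> c \<noteq> c \<otimes> \<theta> a"
        by (intro separates[OF \<theta>sub hi(3) _ c(2) a(1)]) (use c0(1) in \<open>auto simp: c_def\<close>)
      then show ?thesis by (simp add: \<theta>_def a(2))
    qed
    moreover have "(inv y \<otimes> (inv \<tau> \<otimes> \<Phi> x \<otimes> \<tau>) \<otimes> y) \<otimes> c \<noteq> c \<otimes> (inv y \<otimes> (inv \<tau> \<otimes> \<Phi> x \<otimes> \<tau>) \<otimes> y)"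
      if x: "x \<in> S" "inv\<^bsub>P\<^esub> t \<otimes>\<^bsub>P\<^esub> x \<otimes>\<^bsub>P\<^esub> t \<notin> V" for x
    proof -
      obtain a where a: "a \<in> carrier A" "x = v a" using S x(1) by (auto simp: V_def)
      have "inv\<^bsub>P\<^esub> t \<otimes>\<^bsub>P\<^esub> v (j b) \<otimes>\<^bsub>P\<^esub> t = v (i b)" if b: "b \<in> carrier C" for b
        unfolding edge[OF b, symmetric]
        using t v.hom_closed[OF iA[OF b]] by (simp add: P.m_assoc P.cancel_left)
      then have "a \<notin> j ` carrier C" using x(2) iA by (auto simp: a(2) V_def)
      then have ne: "\<theta> a \<otimes> \<theta> (j c0) \<noteq> \<theta> (j c0) \<otimes> \<theta> a"
        by (intro separates[OF \<theta>sub hj(3) _ inj_one[OF hj(1,2)] a(1)]) (use c0(1) in auto)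
      have yG: "y \<in> carrier G" and cG: "c \<in> carrier G" using DG y c(1) by auto
      have aG: "\<theta> a \<in> carrier G" using \<theta>G a(1) by simp
      have yc: "y \<otimes> c \<otimes> inv y = c" unfolding D(2)[OF y c(1)] using yG cG by (simp add: m_assoc)
      \<comment> \<open>Conjugation by \<open>\<tau>\<close> turns the question about \<open>c\<close>, the image of \<open>i c0\<close>, into one about the image of
        \<open>j c0\<close>, which the second edge embedding answers. Conjugation by \<open>y\<close> changes nothing, as \<open>D\<close> is abelian.\<close>
      have 1: "(inv \<tau> \<otimes> \<theta> a \<otimes> \<tau>) \<otimes> c \<noteq> c \<otimes> (inv \<tau> \<otimes> \<theta> a \<otimes> \<tau>)"
        unfolding commute_conjugate_iff[OF \<tau>(2) aG cG] using ne edgeG[OF c0(1)] by (simp add: c_def)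
      have xa: "\<Phi> x = \<theta> a" by (simp add: \<theta>_def a(2))
      have "inv \<tau> \<otimes> \<theta> a \<otimes> \<tau> \<in> carrier G" using aG \<tau>(2) by simp
      from commute_conjugate_iff[OF yG this cG] 1 show ?thesis unfolding yc xa by blast
    qed
    ultimately show "\<exists>c\<in>D. c \<noteq> \<one> \<and>
       (\<forall>a\<in>S. (t \<otimes>\<^bsub>P\<^esub> a \<otimes>\<^bsub>P\<^esub> inv\<^bsub>P\<^esub> t \<notin> V \<longrightarrow> \<Phi> a \<otimes> c \<noteq> c \<otimes> \<Phi> a) \<and>
          (inv\<^bsub>P\<^esub> t \<otimes>\<^bsub>P\<^esub> a \<otimes>\<^bsub>P\<^esub> t \<notin> V \<longrightarrow> (inv y \<otimes> (inv \<tau> \<otimes> \<Phi> a \<otimes> \<tau>) \<otimes> y) \<otimes> c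
              \<noteq> c \<otimes> (inv y \<otimes> (inv \<tau> \<otimes> \<Phi> a \<otimes> \<tau>) \<otimes> y)))"
      using c by (intro bexI[of _ c] conjI ballI impI) simp_all
  qed
  then obtain z where z: "z \<in> T closure_of D" "inj_on (f z) (carrier P)" by (rule bexE)
  interpret fz: group_hom P G "f z" using f(1)[OF z(1)] grpP by (simp add: group_hom_def group_hom_axioms_def)
  define H where "H = f z ` carrier P"
  have HG: "subgroup H G" unfolding H_def by (rule fz.img_is_subgroup)
  have K: "subgroup (T closure_of H) G" by (rule closure_subgroup[OF HG])
  have HK: "H \<subseteq> T closure_of H" by (rule closure_of_subset) (use subgroup.subset[OF HG] in simp)
  have \<theta>H: "\<theta> a \<in> H" if "a \<in> carrier A" for a
    unfolding H_def using that f(2)[OF z(1) that] v.hom_closed[OF that] by (metis imageI)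
  have "D \<subseteq> H" unfolding D_def using \<theta>H iA by auto
  then have zK: "z \<in> T closure_of H" using z(1) closure_of_mono by blast
  have "\<tau> \<otimes> z \<in> H" unfolding H_def f(3)[OF z(1), symmetric] using t by (rule imageI)
  then have "(\<tau> \<otimes> z) \<otimes> inv z \<in> T closure_of H"
    using HK zK K by (blast intro: subgroup.m_closed subgroup.m_inv_closed)
  then have \<tau>K: "\<tau> \<in> T closure_of H" using \<tau>(2) ZG[OF z(1)] by (simp add: m_assoc)
  have "\<Phi> x \<in> T closure_of H" if "x \<in> generate P (insert t V)" for x
    using that
  proof induction
    case one
    then show ?case using subgroup.one_closed[OF K] by simp
  next
    case (incl h)
    then show ?case using \<tau>K \<theta>H HK by (auto simp: \<tau>_def V_def \<theta>_def)
  next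
    case (inv h)
    then have "h \<in> carrier P" "\<Phi> h \<in> T closure_of H"
      using t subgroup.mem_carrier[OF V] \<tau>K \<theta>H HK by (auto simp: \<tau>_def V_def \<theta>_def)
    then show ?case using subgroup.m_inv_closed[OF K] by simp
  next
    case (eng g h)
    then have "g \<in> carrier P" "h \<in> carrier P" unfolding genP by simp_all
    then show ?case using eng subgroup.m_closed[OF K] by simp
  qed
  then have "\<Phi> ` carrier P \<subseteq> T closure_of H" unfolding genP by blast
  then show ?thesis using f(1)[OF z(1)] z(2) unfolding H_def by blast
qed

end

section \<open>Amalgamated products\<close>

context compact_top_group
begin

text \<open>The map \<open>\<Phi>\<close> is twisted by \<open>z\<close> in the closure of the image \<open>D\<close> of the edge group, conjugating the second
  factor. The two factors still agree on \<open>C\<close> because \<open>z\<close> centralizes \<open>D\<close>. The closure of the twisted image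
  contains \<open>z\<close>, so the conjugation can be undone there.\<close>

theorem amalgam_embedding:
  fixes A :: "('v, 'm) monoid_scheme" and B :: "('w, 'l) monoid_scheme" and C :: "('c, 'k) monoid_scheme"
    and i :: "'c \<Rightarrow> 'v" and j :: "'c \<Rightarrow> 'w"
  defines "P \<equiv> amalgam A B C i j"
  assumes A: "group A" "countable (carrier A)" and B: "group B" "countable (carrier B)"
    and C: "comm_group C" "carrier C \<noteq> {\<one>\<^bsub>C\<^esub>}"
    and ij: "double_edge C A i" "double_edge C B j"
    and \<Phi>: "\<Phi> \<in> hom P G" "inj_on (\<Phi> \<circ> amalgam_inl A B C i j) (carrier A)"
      "inj_on (\<Phi> \<circ> amalgam_inr A B C i j) (carrier B)"
    and N: "commutative_transitive (G\<lparr>carrier := \<Phi> ` carrier P\<rparr>)"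
      "power_separated (G\<lparr>carrier := \<Phi> ` carrier P\<rparr>)"
  shows "\<exists>f\<in>hom P G. inj_on f (carrier P) \<and> \<Phi> ` carrier P \<subseteq> T closure_of (f ` carrier P)"
proof -
  let ?X = "amalgam_gens A B" and ?R = "amalgam_rels A B C i j"
  have Pdef: "P = presented_group ?X ?R" by (simp add: P_def amalgam_def)
  have grpP: "group P" unfolding Pdef by (rule group_presented_group)
  interpret P: group P by (rule grpP)
  interpret A: group A by (rule A(1))
  interpret B: group B by (rule B(1))
  interpret C: comm_group C by (rule C(1))
  interpret F: group_hom P G \<Phi> using grpP \<Phi>(1) by (simp add: group_hom_def group_hom_axioms_def)
  define N where "N = \<Phi> ` carrier P"
  have subN: "subgroup N G" unfolding N_def by (rule F.img_is_subgroup)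
  note NN = N[folded N_def]
  define v where "v = amalgam_inl A B C i j"
  have v_eq: "v = (\<lambda>a. pres_gen ?X ?R (Inl a))" by (simp add: v_def amalgam_inl_def fun_eq_iff)
  define w where "w = amalgam_inr A B C i j"
  have w_eq: "w = (\<lambda>a. pres_gen ?X ?R (Inr a))" by (simp add: w_def amalgam_inr_def fun_eq_iff)
  have hv: "v \<in> hom A P"
    unfolding v_eq Pdef by (rule mult_relators_hom[OF A(1)]) (auto simp: amalgam_rels_def amalgam_gens_def)
  have hw: "w \<in> hom B P"
    unfolding w_eq Pdef by (rule mult_relators_hom[OF B(1)]) (auto simp: amalgam_rels_def amalgam_gens_def)
  interpret v: group_hom A P v using A(1) grpP hv by (simp add: group_hom_def group_hom_axioms_def)
  interpret w: group_hom B P w using B(1) grpP hw by (simp add: group_hom_def group_hom_axioms_def)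
  have hi: "i \<in> hom C A" "inj_on i (carrier C)" "maximal_abelian_subgroup (i ` carrier C) A"
    and hj: "j \<in> hom C B" "inj_on j (carrier C)" "maximal_abelian_subgroup (j ` carrier C) B"
    using ij by (auto simp: double_edge_def mon_def)
  have iA: "i c \<in> carrier A" and jB: "j c \<in> carrier B" if "c \<in> carrier C" for c
    using that hi(1) hj(1) by (auto simp: hom_def)
  have edge: "v (i c) = w (j c)" if c: "c \<in> carrier C" for c
  proof -
    let ?r = "[(True, Inl (i c)), (False, Inr (j c))]"
    have "?r \<in> ?R" unfolding amalgam_rels_def using c by blast
    moreover have "?r \<in> words ?X" using iA[OF c] jB[OF c] by (auto simp: amalgam_gens_def)
    ultimately have "word_eval P (pres_gen ?X ?R) ?r = \<one>\<^bsub>P\<^esub>"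
      unfolding Pdef by (rule relator_trivial)
    then have "v (i c) \<otimes>\<^bsub>P\<^esub> inv\<^bsub>P\<^esub> w (j c) = \<one>\<^bsub>P\<^esub>"
      using w.hom_closed[OF jB[OF c]] by (simp add: letter_eval_def v_eq w_eq)
    from P.inv_equality[OF this] show ?thesis
      using v.hom_closed[OF iA[OF c]] w.hom_closed[OF jB[OF c]] by simp
  qed
  define V where "V = v ` carrier A"
  define W where "W = w ` carrier B"
  have V: "subgroup V P" unfolding V_def by (rule v.img_is_subgroup)
  have W: "subgroup W P" unfolding W_def by (rule w.img_is_subgroup)
  have gens: "pres_gen ?X ?R ` ?X = V \<union> W" by (auto simp: amalgam_gens_def V_def v_eq W_def w_eq)
  have genP: "carrier P = generate P (V \<union> W)"
    unfolding gens[symmetric] Pdef by (rule generate_pres_gen)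
  have countP: "countable (carrier P)"
    unfolding Pdef by (rule countable_presented_group) (use A(2) B(2) in \<open>simp add: amalgam_gens_def Plus_def\<close>)
  define \<theta> where "\<theta> = \<Phi> \<circ> v"
  define \<eta> where "\<eta> = \<Phi> \<circ> w"
  have h\<theta>: "\<theta> \<in> hom A G" "inj_on \<theta> (carrier A)"
    using Group.hom_compose[OF hv \<Phi>(1)] \<Phi>(2) by (simp_all add: \<theta>_def v_def)
  have h\<eta>: "\<eta> \<in> hom B G" "inj_on \<eta> (carrier B)"
    using Group.hom_compose[OF hw \<Phi>(1)] \<Phi>(3) by (simp_all add: \<eta>_def w_def)
  interpret th: group_hom A G \<theta> using h\<theta>(1) by (simp add: group_hom_def group_hom_axioms_def)
  interpret et: group_hom B G \<eta> using h\<eta>(1) by (simp add: group_hom_def group_hom_axioms_def)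
  have \<theta>N: "\<theta> a \<in> N" and \<theta>G: "\<theta> a \<in> carrier G" if "a \<in> carrier A" for a
    using that by (auto simp: \<theta>_def N_def)
  have \<eta>N: "\<eta> a \<in> N" and \<eta>G: "\<eta> a \<in> carrier G" if "a \<in> carrier B" for a
    using that by (auto simp: \<eta>_def N_def)
  define D where "D = (\<theta> \<circ> i) ` carrier C"
  have D: "subgroup D G" "\<And>x y. x \<in> D \<Longrightarrow> y \<in> D \<Longrightarrow> x \<otimes> y = y \<otimes> x"
    unfolding D_def using abelian_image[OF C(1) Group.hom_compose[OF hi(1) h\<theta>(1)]] by blast+
  have DN: "D \<subseteq> N" unfolding D_def using \<theta>N iA by auto
  have DG: "d \<in> carrier G" if "d \<in> D" for d using that by (rule subgroup.mem_carrier[OF D(1)])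
  have ZG: "z \<in> carrier G" if "z \<in> T closure_of D" for z
    using that closure_of_subset_topspace[of T D] by auto
  have zcom: "z \<otimes> d = d \<otimes> z" if "z \<in> T closure_of D" "d \<in> D" for z d
    by (rule closure_commutes[OF that(1) DG[OF that(2)] D(2)[OF _ that(2)]])
  have edgeG: "\<theta> (i c) = \<eta> (j c)" if c: "c \<in> carrier C" for c
    by (simp add: \<theta>_def \<eta>_def edge[OF c])
  have "\<exists>k. k \<in> hom P G \<and> (\<forall>a\<in>carrier A. k (v a) = \<theta> a) \<and> (\<forall>b\<in>carrier B. k (w b) = z \<otimes> \<eta> b \<otimes> inv z)"
    if z: "z \<in> T closure_of D" for z
  proof -
    note zG = ZG[OF z]
    define h where "h x = (case x of Inl a \<Rightarrow> \<theta> a | Inr b \<Rightarrow> z \<otimes> \<eta> b \<otimes> inv z)" for x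
    have h: "h \<in> ?X \<rightarrow> carrier G"
      using zG \<theta>G \<eta>G by (auto simp: h_def amalgam_gens_def)
    have conj: "(\<lambda>b. z \<otimes> \<eta> b \<otimes> inv z) \<in> hom B G"
    proof (rule homI)
      fix a b assume ab: "a \<in> carrier B" "b \<in> carrier B"
      show "z \<otimes> \<eta> a \<otimes> inv z \<in> carrier G" using zG \<eta>G[OF ab(1)] by simp
      show "z \<otimes> \<eta> (a \<otimes>\<^bsub>B\<^esub> b) \<otimes> inv z = z \<otimes> \<eta> a \<otimes> inv z \<otimes> (z \<otimes> \<eta> b \<otimes> inv z)"
        using zG \<eta>G[OF ab(1)] \<eta>G[OF ab(2)] ab by (simp add: m_assoc cancel_left)
    qed
    have rel: "word_eval G h r = \<one>" if "r \<in> ?R" for r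
    proof -
      have "r \<in> mult_relators Inl A \<or> r \<in> mult_relators Inr B \<or>
          (\<exists>c. r = [(True, Inl (i c)), (False, Inr (j c))] \<and> c \<in> carrier C)"
        using that unfolding amalgam_rels_def Un_iff mem_Collect_eq by (simp only: disj_assoc)
      then consider "r \<in> mult_relators Inl A" | "r \<in> mult_relators Inr B" | c where "c \<in> carrier C"
        "r = [(True, Inl (i c)), (False, Inr (j c))]"
        by (elim disjE exE conjE)
      then show ?thesis
      proof cases
        case 1
        show ?thesis by (rule mult_relators_eval[OF A(1) group_axioms h\<theta>(1) _ 1]) (simp add: h_def)
      next
        case 2
        show ?thesis by (rule mult_relators_eval[OF B(1) group_axioms conj _ 2]) (simp add: h_def)
      next
        case (3 c)
        have d: "\<theta> (i c) \<in> D" unfolding D_def using 3(1) by simp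
        have cG: "\<theta> (i c) \<in> carrier G" using \<theta>G iA 3(1) by auto
        have "word_eval G h r = \<theta> (i c) \<otimes> inv (z \<otimes> \<eta> (j c) \<otimes> inv z)"
          unfolding 3(2) using cG zG \<eta>G[OF jB[OF 3(1)]] by (simp add: letter_eval_def h_def)
        also have "z \<otimes> \<eta> (j c) \<otimes> inv z = \<theta> (i c)"
          unfolding edgeG[OF 3(1), symmetric] zcom[OF z d] using cG zG by (simp add: m_assoc)
        also have "\<theta> (i c) \<otimes> inv \<theta> (i c) = \<one>" using cG by simp
        finally show ?thesis .
      qed
    qed
    obtain k where k: "k \<in> hom (presented_group ?X ?R) G" "\<And>x. x \<in> ?X \<Longrightarrow> k (pres_gen ?X ?R x) = h x"
      by (rule pres_universal_class[OF group_axioms h rel]) (assumption, rule that)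
    have "k (v a) = \<theta> a" if "a \<in> carrier A" for a
    proof -
      have "Inl a \<in> ?X" using that by (auto simp: amalgam_gens_def)
      then show ?thesis unfolding v_eq by (subst k(2)) (simp_all add: h_def)
    qed
    moreover have "k (w b) = z \<otimes> \<eta> b \<otimes> inv z" if "b \<in> carrier B" for b
    proof -
      have "Inr b \<in> ?X" using that by (auto simp: amalgam_gens_def)
      then show ?thesis unfolding w_eq by (subst k(2)) (simp_all add: h_def)
    qed
    ultimately show ?thesis using k(1) unfolding Pdef by blast
  qed
  then obtain f where f: "\<And>z. z \<in> T closure_of D \<Longrightarrow> f z \<in> hom P G"
    "\<And>z a. z \<in> T closure_of D \<Longrightarrow> a \<in> carrier A \<Longrightarrow> f z (v a) = \<theta> a"
    "\<And>z b. z \<in> T closure_of D \<Longrightarrow> b \<in> carrier B \<Longrightarrow> f z (w b) = z \<otimes> \<eta> b \<otimes> inv z"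
    by metis
  obtain c0 where c0: "c0 \<in> carrier C" "c0 \<noteq> \<one>\<^bsub>C\<^esub>" using C(2) C.one_closed by blast
  define c where "c = \<theta> (i c0)"
  have c: "c \<in> D" "c \<noteq> \<one>"
  proof -
    show "c \<in> D" unfolding c_def D_def using c0(1) by simp
    interpret k: group_hom C A i using hi(1) by (simp add: group_hom_def group_hom_axioms_def)
    show "c \<noteq> \<one>"
    proof
      assume "c = \<one>"
      then have "\<theta> (i c0) = \<theta> (i \<one>\<^bsub>C\<^esub>)" by (simp add: c_def)
      then have "i c0 = i \<one>\<^bsub>C\<^esub>"
        by (rule inj_onD[OF h\<theta>(2)]) (use c0(1) in simp_all)
      then have "c0 = \<one>\<^bsub>C\<^esub>" by (rule inj_onD[OF hi(2)]) (use c0(1) in simp_all)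
      with c0(2) show False by contradiction
    qed
  qed
  have \<theta>sub: "\<theta> ` carrier A \<subseteq> N" using \<theta>N by blast
  have \<eta>sub: "\<eta> ` carrier B \<subseteq> N" using \<eta>N by blast
  have "\<exists>z\<in>T closure_of D. inj_on (f z) (carrier P)"
  proof (rule amalgam_factor_embedding[OF grpP countP V W genP subN NN(2) D(1) DN f(1)])
    fix z x assume z: "z \<in> T closure_of D"
    show "f z x = \<Phi> x" if "x \<in> V" using that f(2)[OF z] by (auto simp: V_def \<theta>_def)
    show "f z x = z \<otimes> \<Phi> x \<otimes> inv z" if "x \<in> W" using that f(3)[OF z] by (auto simp: W_def \<eta>_def)
  next
    fix x assume "x \<in> V \<union> W"
    then show "\<Phi> x \<in> N" using \<theta>N \<eta>N by (auto simp: V_def W_def \<theta>_def \<eta>_def)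
  next
    fix x assume x: "x \<in> V" "\<Phi> x = \<one>"
    then obtain a where a: "a \<in> carrier A" "x = v a" by (auto simp: V_def)
    have "\<theta> a = \<theta> \<one>\<^bsub>A\<^esub>" using x(2) by (simp add: \<theta>_def a(2))
    then have "a = \<one>\<^bsub>A\<^esub>" by (rule inj_onD[OF h\<theta>(2)]) (use a(1) in simp_all)
    then show "x = \<one>\<^bsub>P\<^esub>" by (simp add: a(2))
  next
    fix y assume y: "y \<in> D"
    have yG: "y \<in> carrier G" and cG: "c \<in> carrier G" using DG y c(1) by auto
    have yc: "y \<otimes> c \<otimes> inv y = c" unfolding D(2)[OF y c(1)] using yG cG by (simp add: m_assoc)
    have "\<Phi> x \<otimes> c \<noteq> c \<otimes> \<Phi> x" if x: "x \<in> W - V" for x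
    proof -
      obtain b where b: "b \<in> carrier B" "x = w b" using x by (auto simp: W_def)
      have "b \<notin> j ` carrier C" using x edge[symmetric] iA by (auto simp: b(2) V_def)
      then have "\<eta> b \<otimes> c \<noteq> c \<otimes> \<eta> b"
        by (intro maximal_abelian_separates[OF B(1) subN NN(1) h\<eta> \<eta>sub hj(3) _ c(2) b(1)])
          (use c0(1) edgeG[OF c0(1)] in \<open>auto simp: c_def\<close>)
      then show ?thesis by (simp add: \<eta>_def b(2))
    qed
    moreover have "(inv y \<otimes> \<Phi> x \<otimes> y) \<otimes> c \<noteq> c \<otimes> (inv y \<otimes> \<Phi> x \<otimes> y)" if x: "x \<in> V - W" for x
    proof -
      obtain a where a: "a \<in> carrier A" "x = v a" using x by (auto simp: V_def)
      have "a \<notin> i ` carrier C" using x edge jB by (auto simp: a(2) W_def)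
      then have "\<theta> a \<otimes> c \<noteq> c \<otimes> \<theta> a"
        by (intro maximal_abelian_separates[OF A(1) subN NN(1) h\<theta> \<theta>sub hi(3) _ c(2) a(1)])
          (use c0(1) in \<open>auto simp: c_def\<close>)
      moreover have xa: "\<Phi> x = \<theta> a" by (simp add: \<theta>_def a(2))
      ultimately show ?thesis
        using commute_conjugate_iff[OF yG \<theta>G[OF a(1)] cG] unfolding yc xa by blast
    qed
    ultimately show "\<exists>c\<in>D. c \<noteq> \<one> \<and> (\<forall>b\<in>W - V. \<Phi> b \<otimes> c \<noteq> c \<otimes> \<Phi> b) \<and>
       (\<forall>a\<in>V - W. (inv y \<otimes> \<Phi> a \<otimes> y) \<otimes> c \<noteq> c \<otimes> (inv y \<otimes> \<Phi> a \<otimes> y))"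
      using c by (intro bexI[of _ c] conjI ballI) simp_all
  qed
  then obtain z where z: "z \<in> T closure_of D" "inj_on (f z) (carrier P)" by (rule bexE)
  interpret fz: group_hom P G "f z" using f(1)[OF z(1)] grpP by (simp add: group_hom_def group_hom_axioms_def)
  define H where "H = f z ` carrier P"
  have HG: "subgroup H G" unfolding H_def by (rule fz.img_is_subgroup)
  have K: "subgroup (T closure_of H) G" by (rule closure_subgroup[OF HG])
  have HK: "H \<subseteq> T closure_of H" by (rule closure_of_subset) (use subgroup.subset[OF HG] in simp)
  have \<theta>H: "\<theta> a \<in> H" if "a \<in> carrier A" for a
    unfolding H_def using that f(2)[OF z(1) that] v.hom_closed[OF that] by (metis imageI)
  have "D \<subseteq> H" unfolding D_def using \<theta>H iA by auto
  then have zK: "z \<in> T closure_of H" using z(1) closure_of_mono by blast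
  have \<eta>K: "\<eta> b \<in> T closure_of H" if b: "b \<in> carrier B" for b
  proof -
    have "z \<otimes> \<eta> b \<otimes> inv z \<in> H" unfolding H_def f(3)[OF z(1) b, symmetric]
      by (rule imageI) (rule w.hom_closed[OF b])
    then have "inv z \<otimes> (z \<otimes> \<eta> b \<otimes> inv z) \<otimes> z \<in> T closure_of H"
      using HK zK K by (blast intro: subgroup.m_closed subgroup.m_inv_closed)
    then show ?thesis using \<eta>G[OF b] ZG[OF z(1)] by (simp add: m_assoc cancel_left)
  qed
  have VW: "\<Phi> h \<in> T closure_of H" "h \<in> carrier P" if "h \<in> V \<union> W" for h
    using that \<theta>H HK \<eta>K by (auto simp: V_def \<theta>_def W_def \<eta>_def)
  have "\<Phi> x \<in> T closure_of H" if "x \<in> generate P (V \<union> W)" for x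
    using that
  proof induction
    case one
    then show ?case using subgroup.one_closed[OF K] by simp
  next
    case (incl h)
    then show ?case by (rule VW(1))
  next
    case (inv h)
    then show ?case using subgroup.m_inv_closed[OF K VW(1)[OF inv]] VW(2)[OF inv] by simp
  next
    case (eng g h)
    then have "g \<in> carrier P" "h \<in> carrier P" unfolding genP by simp_all
    then show ?case using eng subgroup.m_closed[OF K] by simp
  qed
  then have "\<Phi> ` carrier P \<subseteq> T closure_of H" unfolding genP by blast
  then show ?thesis using f(1)[OF z(1)] z(2) unfolding H_def by blast
qed

end

section \<open>Raising the rank of a free group\<close>

lemma power_separated_torsion_free:
  assumes "group M" "power_separated M" "y \<in> carrier M" "y \<noteq> \<one>\<^bsub>M\<^esub>" "0 < (k::nat)"
  shows "y [^]\<^bsub>M\<^esub> k \<noteq> \<one>\<^bsub>M\<^esub>"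
proof
  interpret M: group M by fact
  assume k: "y [^]\<^bsub>M\<^esub> k = \<one>\<^bsub>M\<^esub>"
  have "finite {n::nat. zeval M (y [^]\<^bsub>M\<^esub> n) [(\<one>\<^bsub>M\<^esub>, True, \<one>\<^bsub>M\<^esub>)] = \<one>\<^bsub>M\<^esub>}"
    by (rule power_separatedD[OF assms(2,3,4)]) auto
  then have fin: "finite {n::nat. y [^]\<^bsub>M\<^esub> n = \<one>\<^bsub>M\<^esub>}"
    using assms(3) by (simp add: zpow_def)
  have "range (\<lambda>m. k * m) \<subseteq> {n::nat. y [^]\<^bsub>M\<^esub> n = \<one>\<^bsub>M\<^esub>}"
    using assms(3) k by (auto simp flip: M.nat_pow_pow)
  moreover have "infinite (range (\<lambda>m. k * m))"
    using assms(5) by (intro range_inj_infinite) (simp add: inj_on_def)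
  ultimately show False using fin finite_subset by blast
qed

text \<open>Among the elements \<open>x y\<^sup>n\<close>, each \<open>b \<in> B\<close> commutes with at most one. If it commuted with two, these two would
  commute with each other and hence with a nontrivial power of \<open>y\<close>; by transitivity \<open>x\<close> would commute
  with \<open>y\<close>.\<close>

lemma exists_non_commuting:
  assumes M: "group M" "commutative_transitive M" "power_separated M"
    and xy: "x \<in> carrier M" "y \<in> carrier M" "x \<otimes>\<^bsub>M\<^esub> y \<noteq> y \<otimes>\<^bsub>M\<^esub> x"
    and B: "finite B" "B \<subseteq> carrier M" "\<one>\<^bsub>M\<^esub> \<notin> B"
  shows "\<exists>c\<in>carrier M. c \<noteq> \<one>\<^bsub>M\<^esub> \<and> (\<forall>b\<in>B. b \<otimes>\<^bsub>M\<^esub> c \<noteq> c \<otimes>\<^bsub>M\<^esub> b)"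
proof -
  interpret M: group M by (rule M(1))
  have ct: "a \<otimes>\<^bsub>M\<^esub> b = b \<otimes>\<^bsub>M\<^esub> a" if "a \<in> carrier M" "b \<in> carrier M" "c \<in> carrier M" "c \<noteq> \<one>\<^bsub>M\<^esub>"
    "a \<otimes>\<^bsub>M\<^esub> c = c \<otimes>\<^bsub>M\<^esub> a" "b \<otimes>\<^bsub>M\<^esub> c = c \<otimes>\<^bsub>M\<^esub> b" for a b c
    using M(2)[unfolded commutative_transitive_def] that by blast
  \<comment> \<open>The candidates are \<open>x y\<^sup>n\<close>; they are nontrivial as they do not commute with \<open>y\<close>.\<close>
  define p where "p n = y [^]\<^bsub>M\<^esub> n" for n :: nat
  have p: "p n \<in> carrier M" for n using xy(2) by (simp add: p_def)
  have py: "p n \<otimes>\<^bsub>M\<^esub> y = y \<otimes>\<^bsub>M\<^esub> p n" for n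
    using xy(2) M.nat_pow_Suc2[of y n] by (simp add: p_def)
  have padd: "p (n + k) = p n \<otimes>\<^bsub>M\<^esub> p k" for n k using xy(2) by (simp add: p_def M.nat_pow_mult)
  define c where "c n = x \<otimes>\<^bsub>M\<^esub> p n" for n
  have c: "c n \<in> carrier M" for n using xy(1) p by (simp add: c_def)
  have cy: "c n \<otimes>\<^bsub>M\<^esub> y \<noteq> y \<otimes>\<^bsub>M\<^esub> c n" for n
  proof
    assume "c n \<otimes>\<^bsub>M\<^esub> y = y \<otimes>\<^bsub>M\<^esub> c n"
    then have "(x \<otimes>\<^bsub>M\<^esub> y) \<otimes>\<^bsub>M\<^esub> p n = (y \<otimes>\<^bsub>M\<^esub> x) \<otimes>\<^bsub>M\<^esub> p n"
      using xy(1,2) p[of n] py[of n] by (simp add: c_def M.m_assoc)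
    then have "x \<otimes>\<^bsub>M\<^esub> y = y \<otimes>\<^bsub>M\<^esub> x" using xy(1,2) p[of n] by (simp add: M.m_assoc[symmetric])
    with xy(3) show False by contradiction
  qed
  have y1: "y \<noteq> \<one>\<^bsub>M\<^esub>" using xy by auto
  have one: "\<not> (n < m \<and> b \<otimes>\<^bsub>M\<^esub> c n = c n \<otimes>\<^bsub>M\<^esub> b \<and> b \<otimes>\<^bsub>M\<^esub> c m = c m \<otimes>\<^bsub>M\<^esub> b)"
    if b: "b \<in> B" for b n m
  proof
    assume nm: "n < m \<and> b \<otimes>\<^bsub>M\<^esub> c n = c n \<otimes>\<^bsub>M\<^esub> b \<and> b \<otimes>\<^bsub>M\<^esub> c m = c m \<otimes>\<^bsub>M\<^esub> b"
    have bM: "b \<in> carrier M" "b \<noteq> \<one>\<^bsub>M\<^esub>" using b B(2,3) by auto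
    define k where "k = m - n"
    have k: "0 < k" "m = n + k" using nm by (auto simp: k_def)
    have cm: "c m = c n \<otimes>\<^bsub>M\<^esub> p k" using xy(1) p by (simp add: k(2) c_def padd M.m_assoc)
    have "c n \<otimes>\<^bsub>M\<^esub> c m = c m \<otimes>\<^bsub>M\<^esub> c n" by (rule ct[OF c c bM]) (use nm in simp_all)
    then have "c n \<otimes>\<^bsub>M\<^esub> (c n \<otimes>\<^bsub>M\<^esub> p k) = c n \<otimes>\<^bsub>M\<^esub> (p k \<otimes>\<^bsub>M\<^esub> c n)"
      using c[of n] p[of k] by (simp add: cm M.m_assoc)
    then have 1: "c n \<otimes>\<^bsub>M\<^esub> p k = p k \<otimes>\<^bsub>M\<^esub> c n" using c[of n] p[of k] by simp
    have pk: "p k \<noteq> \<one>\<^bsub>M\<^esub>"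
      unfolding p_def by (rule power_separated_torsion_free[OF M(1,3) xy(2) y1 k(1)])
    have "c n \<otimes>\<^bsub>M\<^esub> y = y \<otimes>\<^bsub>M\<^esub> c n" by (rule ct[OF c xy(2) p pk 1 py[symmetric]])
    with cy show False by contradiction
  qed
  have "finite {n. b \<otimes>\<^bsub>M\<^esub> c n = c n \<otimes>\<^bsub>M\<^esub> b}" if b: "b \<in> B" for b
  proof (rule ccontr)
    assume inf: "infinite {n. b \<otimes>\<^bsub>M\<^esub> c n = c n \<otimes>\<^bsub>M\<^esub> b}"
    obtain n where n: "b \<otimes>\<^bsub>M\<^esub> c n = c n \<otimes>\<^bsub>M\<^esub> b" using infinite_imp_nonempty[OF inf] by blast
    obtain m where "m > n" "b \<otimes>\<^bsub>M\<^esub> c m = c m \<otimes>\<^bsub>M\<^esub> b"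
      using inf unfolding infinite_nat_iff_unbounded by blast
    then show False using one[OF b, of n m] n by simp
  qed
  then have "finite (\<Union>b\<in>B. {n. b \<otimes>\<^bsub>M\<^esub> c n = c n \<otimes>\<^bsub>M\<^esub> b})" by (rule finite_UN_I[OF B(1)])
  then obtain n where n: "n \<notin> (\<Union>b\<in>B. {n. b \<otimes>\<^bsub>M\<^esub> c n = c n \<otimes>\<^bsub>M\<^esub> b})"
    using ex_new_if_finite[OF infinite_UNIV_nat] by blast
  have "c n \<noteq> \<one>\<^bsub>M\<^esub>" using cy[of n] xy(2) by auto
  then show ?thesis using n c[of n] by (intro bexI[of _ "c n"]) auto
qed

lemma free_group_non_commuting:
  assumes "2 \<le> m"
  shows "\<exists>x\<in>carrier (free_group {..<m::nat}). \<exists>y\<in>carrier (free_group {..<m}).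
    x \<otimes>\<^bsub>free_group {..<m}\<^esub> y \<noteq> y \<otimes>\<^bsub>free_group {..<m}\<^esub> x"
proof -
  let ?F = "free_group {..<m}" and ?g = "pres_gen {..<m} {}"
  define h where "h x = (if x = 0 then M2 1 1 0 1 else M2 1 0 1 1)" for x :: nat
  have h: "h \<in> {..<m} \<rightarrow> carrier SL2" by (auto simp: h_def det2_def)
  obtain k where k: "k \<in> hom (presented_group {..<m} {}) SL2" "\<And>x. x \<in> {..<m} \<Longrightarrow> k (?g x) = h x"
    by (rule pres_universal_class[OF group_SL2 h, of "{}"]) auto
  have g: "?g x \<in> carrier ?F" if "x < m" for x unfolding free_group_def by (rule pres_gen_closed) (use that in simp)
  have k': "k (?g x \<otimes>\<^bsub>?F\<^esub> ?g y) = h x * h y" if "x < m" "y < m" for x y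
    using hom_mult[OF k(1)] g[OF that(1)] g[OF that(2)] k(2)[of x] k(2)[of y] that by (simp add: free_group_def)
  have "h 0 * h 1 \<noteq> h 1 * h 0" by (simp add: h_def times_m2_def)
  then have "?g 0 \<otimes>\<^bsub>?F\<^esub> ?g 1 \<noteq> ?g 1 \<otimes>\<^bsub>?F\<^esub> ?g 0"
    using k'[of 0 1] k'[of 1 0] assms by auto
  then show ?thesis using g[of 0] g[of 1] assms by (intro bexI[of _ "?g 0"] bexI[of _ "?g 1"]) auto
qed

lemma inj_hom_is_iso:
  assumes "f \<in> hom P G" "inj_on f (carrier P)"
  shows "f \<in> iso P (G\<lparr>carrier := f ` carrier P\<rparr>)"
  using assms by (auto simp: iso_def hom_def bij_betw_def)

context compact_top_group
begin

text \<open>The new generator is a generic element of the closure of \<open>N\<close>. This is \<open>stable_letter_embedding\<close> with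
  \<open>D = N\<close> and \<open>\<tau> = 1\<close>. A coefficient at a junction is now merely nontrivial, and the element \<open>c\<close> that
  commutes with none of the finitely many coefficients is provided by \<open>exists_non_commuting\<close>; the
  assumption \<open>m \<ge> 2\<close> makes \<open>N\<close> nonabelian.\<close>

theorem free_rank_step:
  fixes m :: nat
  assumes N: "subgroup N G" and \<kappa>: "\<kappa> \<in> iso (free_group {..<m}) (G\<lparr>carrier := N\<rparr>)" and m: "2 \<le> m"
  shows "\<exists>N'. subgroup N' G \<and> free_group {..<Suc m} \<cong> G\<lparr>carrier := N'\<rparr> \<and> N \<subseteq> T closure_of N'"
proof -
  let ?F = "free_group {..<m}" and ?GN = "G\<lparr>carrier := N\<rparr>"
  define P where "P = free_group {..<Suc m}"
  have Pdef: "P = presented_group {..<Suc m} {}" by (simp add: P_def free_group_def)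
  have grpP: "group P" unfolding Pdef by (rule group_presented_group)
  have grpF: "group ?F" unfolding free_group_def by (rule group_presented_group)
  interpret P: group P by (rule grpP)
  interpret F: group ?F by (rule grpF)
  have grpN: "group ?GN" by (rule subgroup.subgroup_is_group[OF N group_axioms])
  have \<kappa>N: "\<kappa> \<in> hom ?F ?GN" "inj_on \<kappa> (carrier ?F)" "\<kappa> ` carrier ?F = N"
    using \<kappa> by (auto simp: iso_def bij_betw_def)
  have NG: "x \<in> carrier G" if "x \<in> N" for x using that by (rule subgroup.mem_carrier[OF N])
  have \<kappa>G: "\<kappa> \<in> hom ?F G" using \<kappa>N(1) NG by (auto simp: hom_def)
  interpret k: group_hom ?F G \<kappa> using grpF \<kappa>G by (simp add: group_hom_def group_hom_axioms_def)
  have cover: "hyperbolic_cover ?F ?GN (\<kappa> \<circ> id)"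
    by (rule hyperbolic_cover_iso[OF hyperbolic_cover_free_group \<kappa> grpN])
  have CT: "commutative_transitive ?GN" by (rule hyperbolic_cover_commutative_transitive[OF cover])
  have PS: "power_separated ?GN" by (rule hyperbolic_cover_power_separated[OF cover])
  define g where "g = pres_gen {..<m} {}"
  define g' where "g' = pres_gen {..<Suc m} {}"
  have g': "g' x \<in> carrier P" if "x < Suc m" for x
    unfolding g'_def Pdef by (rule pres_gen_closed) (use that in simp)
  have g: "g x \<in> carrier ?F" if "x < m" for x
    unfolding g_def free_group_def by (rule pres_gen_closed) (use that in simp)
  have g'P: "g' \<in> {..<m} \<rightarrow> carrier P" using g' by auto
  obtain \<iota> where \<iota>: "\<iota> \<in> hom (presented_group {..<m} {}) P"
    "\<And>x. x \<in> {..<m} \<Longrightarrow> \<iota> (pres_gen {..<m} {} x) = g' x"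
    by (rule pres_universal_class[OF grpP g'P, of "{}"]) auto
  have \<iota>': "\<iota> \<in> hom ?F P" "\<And>x. x < m \<Longrightarrow> \<iota> (g x) = g' x"
    using \<iota> by (auto simp: free_group_def g_def)
  interpret i: group_hom ?F P \<iota> using grpF grpP \<iota>'(1) by (simp add: group_hom_def group_hom_axioms_def)
  define V where "V = \<iota> ` carrier ?F"
  have V: "subgroup V P" unfolding V_def by (rule i.img_is_subgroup)
  define t where "t = g' m"
  have t: "t \<in> carrier P" unfolding t_def by (rule g') simp
  have genP: "carrier P = generate P (insert t V)"
  proof
    have "g' ` {..<Suc m} \<subseteq> insert t V"
    proof (rule image_subsetI)
      fix x assume "x \<in> {..<Suc m}"
      then consider "x = m" | "x < m" by fastforce
      then show "g' x \<in> insert t V"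
        by cases (use \<iota>'(2) g in \<open>auto simp: t_def V_def simp flip: \<iota>'(2)\<close>)
    qed
    then have "generate P (g' ` {..<Suc m}) \<subseteq> generate P (insert t V)" by (rule P.mono_generate)
    then show "carrier P \<subseteq> generate P (insert t V)"
      unfolding Pdef g'_def generate_pres_gen[symmetric] .
    show "generate P (insert t V) \<subseteq> carrier P"
      by (rule P.generate_incl) (use t subgroup.subset[OF V] in blast)
  qed
  have countP: "countable (carrier P)" unfolding Pdef by (rule countable_presented_group) simp
  have ZG: "z \<in> carrier G" if "z \<in> T closure_of N" for z
    using that closure_of_subset_topspace[of T N] by auto
  have "\<exists>f. f \<in> hom P G \<and> (\<forall>w\<in>carrier ?F. f (\<iota> w) = \<kappa> w) \<and> f t = z" if z: "z \<in> T closure_of N" for z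
  proof -
    define h where "h x = (if x < m then \<kappa> (g x) else z)" for x
    have h: "h \<in> {..<Suc m} \<rightarrow> carrier G" using ZG[OF z] k.hom_closed g by (auto simp: h_def)
    obtain f where f: "f \<in> hom (presented_group {..<Suc m} {}) G"
      "\<And>x. x \<in> {..<Suc m} \<Longrightarrow> f (pres_gen {..<Suc m} {} x) = h x"
      by (rule pres_universal_class[OF group_axioms h, of "{}"]) auto
    have fP: "f \<in> hom P G" using f(1) by (simp add: Pdef)
    have fg: "f (g' x) = h x" if "x < Suc m" for x unfolding g'_def by (rule f(2)) (use that in simp)
    have hom1: "f \<circ> \<iota> \<in> hom (presented_group {..<m} {}) G"
      by (rule Group.hom_compose[OF \<iota>(1) fP])
    have hom2: "\<kappa> \<in> hom (presented_group {..<m} {}) G" using \<kappa>G by (simp add: free_group_def)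
    have "f (\<iota> w) = \<kappa> w" if w: "w \<in> carrier ?F" for w
    proof -
      obtain u where u: "u \<in> words {..<m}" "w = pres_cong {..<m} {} `` {u}"
        using w by (auto simp: free_group_def carrier_presented_group)
      have "(f \<circ> \<iota>) w = word_eval G (\<lambda>x. (f \<circ> \<iota>) (pres_gen {..<m} {} x)) u"
        unfolding u(2) by (rule hom_pres_class[OF group_axioms hom1 u(1)])
      also have "\<dots> = word_eval G (\<lambda>x. \<kappa> (pres_gen {..<m} {} x)) u"
        by (rule word_eval_cong[OF _ u(1)]) (use \<iota>(2) fg in \<open>auto simp: h_def g_def\<close>)
      also have "\<dots> = \<kappa> w"
        unfolding u(2) by (rule hom_pres_class[OF group_axioms hom2 u(1), symmetric])
      finally show ?thesis by simp
    qed
    moreover have "f t = z" unfolding t_def using fg[of m] by (simp add: h_def)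
    ultimately show ?thesis using fP by blast
  qed
  then obtain f where f: "\<And>z. z \<in> T closure_of N \<Longrightarrow> f z \<in> hom P G"
    "\<And>z w. z \<in> T closure_of N \<Longrightarrow> w \<in> carrier ?F \<Longrightarrow> f z (\<iota> w) = \<kappa> w"
    "\<And>z. z \<in> T closure_of N \<Longrightarrow> f z t = z"
    by metis
  have NZ: "N \<subseteq> T closure_of N" by (rule closure_of_subset) (use NG in auto)
  have oneZ: "\<one> \<in> T closure_of N" using NZ subgroup.one_closed[OF N] by blast
  define \<theta> where "\<theta> = f \<one>"
  have \<theta>: "\<theta> (\<iota> w) = \<kappa> w" if "w \<in> carrier ?F" for w unfolding \<theta>_def by (rule f(2)[OF oneZ that])
  have f_V: "f z v = \<theta> v" if "z \<in> T closure_of N" "v \<in> V" for z v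
    using that f(2) \<theta> by (auto simp: V_def)
  have \<theta>N: "\<theta> v \<in> N" if "v \<in> V" for v using that \<theta> \<kappa>N(3) by (auto simp: V_def)
  have \<theta>1: "v = \<one>\<^bsub>P\<^esub>" if v: "v \<in> V" "\<theta> v = \<one>" for v
  proof -
    obtain w where w: "w \<in> carrier ?F" "v = \<iota> w" using v(1) by (auto simp: V_def)
    then have "\<kappa> w = \<kappa> \<one>\<^bsub>?F\<^esub>" using v(2) \<theta> by simp
    then have "w = \<one>\<^bsub>?F\<^esub>" by (rule inj_onD[OF \<kappa>N(2)]) (use w(1) in simp_all)
    then show ?thesis using w(2) by simp
  qed
  obtain x y' where xy: "x \<in> carrier ?F" "y' \<in> carrier ?F" "x \<otimes>\<^bsub>?F\<^esub> y' \<noteq> y' \<otimes>\<^bsub>?F\<^esub> x"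
    using free_group_non_commuting[OF m] by (elim bexE) (rule that)
  have nc: "\<kappa> x \<otimes> \<kappa> y' \<noteq> \<kappa> y' \<otimes> \<kappa> x"
  proof
    assume "\<kappa> x \<otimes> \<kappa> y' = \<kappa> y' \<otimes> \<kappa> x"
    then have "\<kappa> (x \<otimes>\<^bsub>?F\<^esub> y') = \<kappa> (y' \<otimes>\<^bsub>?F\<^esub> x)"
      unfolding k.hom_mult[OF xy(1,2)] k.hom_mult[OF xy(2,1)] .
    then have "x \<otimes>\<^bsub>?F\<^esub> y' = y' \<otimes>\<^bsub>?F\<^esub> x" by (rule inj_onD[OF \<kappa>N(2)]) (use F.m_closed xy(1,2) in blast)+
    with xy(3) show False by contradiction
  qed
  have \<kappa>xy: "\<kappa> x \<in> N" "\<kappa> y' \<in> N" using xy \<kappa>N(3) by auto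
  have "\<exists>z\<in>T closure_of N. inj_on (f z) (carrier P)"
  proof (rule stable_letter_embedding[OF grpP countP V t genP N PS N subset_refl subgroup.one_closed[OF N] f(1) f_V _ \<theta>N \<theta>1])
    show "f z t = \<one> \<otimes> z" if "z \<in> T closure_of N" for z using f(3)[OF that] ZG[OF that] by simp
    fix S y assume S: "finite S" "S \<subseteq> V" and y: "y \<in> N"
    have yG: "y \<in> carrier G" using NG y .
    define B where "B = (\<theta> ` S \<union> (\<lambda>a. inv y \<otimes> \<theta> a \<otimes> y) ` S) - {\<one>}"
    have SN: "\<theta> a \<in> N" if "a \<in> S" for a using that S(2) \<theta>N by blast
    have yN: "inv y \<otimes> \<theta> a \<otimes> y \<in> N" if "a \<in> S" for a
      by (intro subgroup.m_closed[OF N] subgroup.m_inv_closed[OF N] y SN that)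
    have B: "finite B" "B \<subseteq> N" "\<one> \<notin> B"
      unfolding B_def using S(1) SN yN by blast+
    have "\<exists>c\<in>carrier ?GN. c \<noteq> \<one>\<^bsub>?GN\<^esub> \<and> (\<forall>b\<in>B. b \<otimes>\<^bsub>?GN\<^esub> c \<noteq> c \<otimes>\<^bsub>?GN\<^esub> b)"
      by (rule exists_non_commuting[OF grpN CT PS, of "\<kappa> x" "\<kappa> y'" B]) (use \<kappa>xy nc B in simp_all)
    then obtain c where c: "c \<in> N" "c \<noteq> \<one>" "\<forall>b\<in>B. b \<otimes> c \<noteq> c \<otimes> b" by auto
    have ne: "\<theta> a \<noteq> \<one>" "inv y \<otimes> \<theta> a \<otimes> y \<noteq> \<one>" if a: "a \<in> S" "a \<noteq> \<one>\<^bsub>P\<^esub>" for a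
    proof -
      show 1: "\<theta> a \<noteq> \<one>" using \<theta>1[of a] a S(2) by blast
      have aG: "\<theta> a \<in> carrier G" using NG[OF SN[OF a(1)]] .
      show "inv y \<otimes> \<theta> a \<otimes> y \<noteq> \<one>"
      proof
        assume "inv y \<otimes> \<theta> a \<otimes> y = \<one>"
        then have "y \<otimes> (inv y \<otimes> \<theta> a \<otimes> y) \<otimes> inv y = \<one>" using yG by simp
        moreover have "y \<otimes> (inv y \<otimes> \<theta> a \<otimes> y) \<otimes> inv y = \<theta> a" using yG aG by (simp add: m_assoc cancel_left)
        ultimately show False using 1 by simp
      qed
    qed
    have "\<theta> a \<otimes> c \<noteq> c \<otimes> \<theta> a \<and> (inv y \<otimes> \<theta> a \<otimes> y) \<otimes> c \<noteq> c \<otimes> (inv y \<otimes> \<theta> a \<otimes> y)"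
      if "a \<in> S" "a \<noteq> \<one>\<^bsub>P\<^esub>" for a
      using bspec[OF c(3), of "\<theta> a"] bspec[OF c(3), of "inv y \<otimes> \<theta> a \<otimes> y"] ne[OF that] that(1)
      by (simp add: B_def)
    moreover have "a \<noteq> \<one>\<^bsub>P\<^esub>" if "t \<otimes>\<^bsub>P\<^esub> a \<otimes>\<^bsub>P\<^esub> inv\<^bsub>P\<^esub> t \<notin> V \<or> inv\<^bsub>P\<^esub> t \<otimes>\<^bsub>P\<^esub> a \<otimes>\<^bsub>P\<^esub> t \<notin> V" for a
      using that t subgroup.one_closed[OF V] by auto
    moreover have "inv \<one> \<otimes> \<theta> a \<otimes> \<one> = \<theta> a" if "a \<in> S" for a using NG[OF SN[OF that]] by simp
    ultimately show "\<exists>c\<in>N. c \<noteq> \<one> \<and>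
       (\<forall>a\<in>S. (t \<otimes>\<^bsub>P\<^esub> a \<otimes>\<^bsub>P\<^esub> inv\<^bsub>P\<^esub> t \<notin> V \<longrightarrow> \<theta> a \<otimes> c \<noteq> c \<otimes> \<theta> a) \<and>
          (inv\<^bsub>P\<^esub> t \<otimes>\<^bsub>P\<^esub> a \<otimes>\<^bsub>P\<^esub> t \<notin> V \<longrightarrow> (inv y \<otimes> (inv \<one> \<otimes> \<theta> a \<otimes> \<one>) \<otimes> y) \<otimes> c
              \<noteq> c \<otimes> (inv y \<otimes> (inv \<one> \<otimes> \<theta> a \<otimes> \<one>) \<otimes> y)))"
      using c(1,2) by (intro bexI[of _ c] conjI ballI impI) simp_all
  qed
  then obtain z where z: "z \<in> T closure_of N" "inj_on (f z) (carrier P)" by (rule bexE)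
  interpret fz: group_hom P G "f z" using f(1)[OF z(1)] grpP by (simp add: group_hom_def group_hom_axioms_def)
  define H where "H = f z ` carrier P"
  have HG: "subgroup H G" unfolding H_def by (rule fz.img_is_subgroup)
  have HK: "H \<subseteq> T closure_of H" by (rule closure_of_subset) (use subgroup.subset[OF HG] in simp)
  have "N \<subseteq> H"
  proof
    fix n assume "n \<in> N"
    then obtain w where w: "w \<in> carrier ?F" "n = \<kappa> w" using \<kappa>N(3) by blast
    have "f z (\<iota> w) \<in> H" unfolding H_def by (rule imageI) (rule i.hom_closed[OF w(1)])
    then show "n \<in> H" using f(2)[OF z(1) w(1)] w(2) by simp
  qed
  moreover have "P \<cong> G\<lparr>carrier := H\<rparr>"
    unfolding H_def using inj_hom_is_iso[OF f(1)[OF z(1)] z(2)] by (rule is_isoI)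
  ultimately show ?thesis using HG HK unfolding P_def by blast
qed

end

section \<open>Sequences of generalized doubles\<close>

definition xor_group :: "bool monoid" where
  "xor_group = \<lparr>carrier = UNIV, mult = (\<noteq>), one = False\<rparr>"

lemma group_xor_group: "group xor_group"
  by (rule groupI) (auto simp: xor_group_def)

text \<open>A homomorphism from the free group to the group of order two is given by a subset of the basis, and it is
  determined by its values on the images of the generators. So \<open>2 ^ r \<le> 2 ^ card S\<close>.\<close>

lemma free_group_rank_le_generators:
  fixes r :: nat
  assumes L: "group L" and S: "finite S" "S \<subseteq> carrier L" "generate L S = carrier L"
    and k: "k \<in> hom L (free_group {..<r})" "k ` carrier L = carrier (free_group {..<r})"
  shows "r \<le> card S"
proof -
  let ?F = "free_group {..<r}" and ?g = "pres_gen {..<r} {}"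
  have grpF: "group ?F" unfolding free_group_def by (rule group_presented_group)
  have "\<forall>A. \<exists>\<xi>. \<xi> \<in> hom ?F xor_group \<and> (\<forall>x\<in>{..<r}. \<xi> (?g x) \<longleftrightarrow> x \<in> A)"
  proof
    fix A :: "nat set"
    have h: "(\<lambda>x. x \<in> A) \<in> {..<r} \<rightarrow> carrier xor_group" by (simp add: xor_group_def)
    obtain \<xi> where "\<xi> \<in> hom (presented_group {..<r} {}) xor_group"
      "\<And>x. x \<in> {..<r} \<Longrightarrow> \<xi> (?g x) = (x \<in> A)"
      by (rule pres_universal_class[OF group_xor_group h, of "{}"]) auto
    then show "\<exists>\<xi>. \<xi> \<in> hom ?F xor_group \<and> (\<forall>x\<in>{..<r}. \<xi> (?g x) \<longleftrightarrow> x \<in> A)"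
      unfolding free_group_def by blast
  qed
  then obtain \<xi> where \<xi>: "\<And>A. \<xi> A \<in> hom ?F xor_group" "\<And>A x. x < r \<Longrightarrow> \<xi> A (?g x) \<longleftrightarrow> x \<in> A"
    by (metis lessThan_iff)
  define m where "m A = {s \<in> S. \<xi> A (k s)}" for A
  have "inj_on m (Pow {..<r})"
  proof (rule inj_onI)
    fix A B assume AB: "A \<in> Pow {..<r}" "B \<in> Pow {..<r}" "m A = m B"
    interpret a: group_hom L xor_group "\<xi> A \<circ> k"
      using L group_xor_group Group.hom_compose[OF k(1) \<xi>(1)] by (simp add: group_hom_def group_hom_axioms_def)
    interpret b: group_hom L xor_group "\<xi> B \<circ> k"
      using L group_xor_group Group.hom_compose[OF k(1) \<xi>(1)] by (simp add: group_hom_def group_hom_axioms_def)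
    have SL: "h \<in> carrier L" if "h \<in> S" for h using S(2) that by blast
    have onS: "(\<xi> A \<circ> k) h = (\<xi> B \<circ> k) h" if "h \<in> S" for h
      using AB(3) that unfolding m_def by auto
    have agree: "(\<xi> A \<circ> k) y = (\<xi> B \<circ> k) y" if "y \<in> generate L S" for y
      using that
    proof induction
      case one
      show ?case unfolding a.hom_one b.hom_one ..
    next
      case (incl h)
      then show ?case by (rule onS)
    next
      case (inv h)
      show ?case unfolding a.hom_inv[OF SL[OF inv]] b.hom_inv[OF SL[OF inv]] onS[OF inv] ..
    next
      case (eng g h)
      then have "g \<in> carrier L" "h \<in> carrier L" using S(3) by auto
      then show ?case using eng.IH by (simp only: a.hom_mult b.hom_mult)
    qed
    have "x \<in> A \<longleftrightarrow> x \<in> B" if x: "x < r" for x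
    proof -
      have "?g x \<in> carrier ?F" unfolding free_group_def by (rule pres_gen_closed) (use x in simp)
      then obtain y where y: "y \<in> carrier L" "?g x = k y" using k(2) by (metis imageE)
      have "y \<in> generate L S" using y(1) S(3) by simp
      from agree[OF this] have "\<xi> A (?g x) = \<xi> B (?g x)" unfolding y(2) by simp
      then show ?thesis using \<xi>(2)[OF x] by simp
    qed
    then show "A = B" using AB(1,2) by auto
  qed
  moreover have "m ` Pow {..<r} \<subseteq> Pow S" unfolding m_def by auto
  ultimately have "card (Pow {..<r}) \<le> card (Pow S)"
    using S(1) by (intro card_inj_on_le) auto
  then have "(2::nat) ^ r \<le> 2 ^ card S" using S(1) by (simp add: card_Pow)
  then show ?thesis by simp
qed

lemma double_arrows_epi:
  assumes "double_arrow\<^sup>*\<^sup>* L M" "group L"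
  shows "group M \<and> (\<exists>\<phi>\<in>hom L M. \<phi> ` carrier L = carrier M)"
  using assms(1)
proof induction
  case base
  have "(\<lambda>x. x) \<in> hom L L" by (simp add: hom_def)
  then show ?case using assms(2) by (intro conjI bexI[of _ "\<lambda>x. x"]) simp_all
next
  case (step M N)
  obtain \<phi> where \<phi>: "\<phi> \<in> hom L M" "\<phi> ` carrier L = carrier M" using step.IH by blast
  obtain \<psi> where "generalized_double M N \<psi>" and N: "limit_group N"
    using step.hyps(2) unfolding double_arrow_def by blast
  then have "\<psi> \<in> epi M N" unfolding generalized_double_def by (elim conjE)
  then have \<psi>: "\<psi> \<in> hom M N" "\<psi> ` carrier M = carrier N" by (simp_all add: epi_def)
  have "\<psi> \<circ> \<phi> \<in> hom L N" by (rule Group.hom_compose[OF \<phi>(1) \<psi>(1)])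
  moreover have "(\<psi> \<circ> \<phi>) ` carrier L = carrier N" unfolding image_comp[symmetric] \<phi>(2) \<psi>(2) ..
  moreover have "group N" using N by (simp add: limit_group_def finitely_generated_def)
  ultimately show ?case by blast
qed

lemma double_ranks_bounded:
  assumes "limit_group L"
  shows "\<exists>n. \<forall>r\<in>double_ranks L. r \<le> n"
proof -
  have L: "group L" using assms by (simp add: limit_group_def finitely_generated_def)
  obtain S where S: "finite S" "S \<subseteq> carrier L" "generate L S = carrier L"
    using assms unfolding limit_group_def finitely_generated_def by blast
  have "r \<le> card S" if "r \<in> double_ranks L" for r
  proof -
    obtain L' F where LF: "group L'" "L \<cong> L'" "double_arrow\<^sup>*\<^sup>* L' F" "free_of_rank F r"
      using \<open>r \<in> double_ranks L\<close> unfolding double_ranks_def mem_Collect_eq by (elim exE conjE) (rule that)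
    obtain \<alpha> where "\<alpha> \<in> iso L L'" using LF(2) unfolding is_iso_def by blast
    then have \<alpha>: "\<alpha> \<in> hom L L'" "\<alpha> ` carrier L = carrier L'" by (auto simp: iso_def bij_betw_def)
    obtain \<phi> where \<phi>: "\<phi> \<in> hom L' F" "\<phi> ` carrier L' = carrier F"
      using double_arrows_epi[OF LF(3,1)] by blast
    obtain \<beta> where "\<beta> \<in> iso F (free_group {..<r})"
      using LF(4) unfolding free_of_rank_def is_iso_def by blast
    then have \<beta>: "\<beta> \<in> hom F (free_group {..<r})" "\<beta> ` carrier F = carrier (free_group {..<r})"
      by (auto simp: iso_def bij_betw_def)
    show ?thesis
    proof (rule free_group_rank_le_generators[OF L S])
      show "\<beta> \<circ> (\<phi> \<circ> \<alpha>) \<in> hom L (free_group {..<r})"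
        by (rule Group.hom_compose[OF Group.hom_compose[OF \<alpha>(1) \<phi>(1)] \<beta>(1)])
      show "(\<beta> \<circ> (\<phi> \<circ> \<alpha>)) ` carrier L = carrier (free_group {..<r})"
        unfolding image_comp[symmetric] \<alpha>(2) \<phi>(2) \<beta>(2) ..
    qed
  qed
  then show ?thesis by (intro exI[of _ "card S"] ballI)
qed

text \<open>On natural numbers the supremum of a nonempty bounded set is its maximum. Positivity excludes the
  empty set, whose supremum is \<open>0\<close> by convention.\<close>

lemma double_rank_attained:
  assumes "limit_group L" "0 < double_rank L"
  shows "double_rank L \<in> double_ranks L"
proof -
  obtain n where n: "\<forall>r\<in>double_ranks L. r \<le> n" using double_ranks_bounded[OF assms(1)] by (rule exE)
  have fin: "finite (double_ranks L)" by (rule finite_subset[of _ "{..n}"]) (use n in auto)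
  have ne: "double_ranks L \<noteq> {}"
  proof
    assume "double_ranks L = {}"
    then have "double_rank L = 0" by (simp add: double_rank_def Sup_nat_def)
    with assms(2) show False by simp
  qed
  have "double_rank L = Max (double_ranks L)"
    unfolding double_rank_def using ne by (simp add: Sup_nat_def)
  then show ?thesis using Max_in[OF fin ne] by simp
qed

lemma limit_group_separation:
  assumes "limit_group M" "M \<cong> M'" "group M'"
  shows "commutative_transitive M'" "power_separated M'"
proof -
  obtain \<Gamma> :: "nat monoid" and \<pi> where c: "hyperbolic_cover \<Gamma> M \<pi>"
    using limit_group_hyperbolic_cover[OF assms(1)] .
  obtain \<alpha> where \<alpha>: "\<alpha> \<in> iso M M'" using assms(2) unfolding is_iso_def by blast
  note cover = hyperbolic_cover_iso[OF c \<alpha> assms(3)]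
  show "commutative_transitive M'" by (rule hyperbolic_cover_commutative_transitive[OF cover])
  show "power_separated M'" by (rule hyperbolic_cover_power_separated[OF cover])
qed

context compact_top_group
begin

definition densely_embeds :: "('p, 'k) monoid_scheme \<Rightarrow> 'a set \<Rightarrow> bool" where
  "densely_embeds M F \<longleftrightarrow> (\<exists>N. subgroup N G \<and> M \<cong> G\<lparr>carrier := N\<rparr> \<and> F \<subseteq> T closure_of N)"

lemma closure_trans: "F \<subseteq> T closure_of N \<Longrightarrow> N \<subseteq> T closure_of N' \<Longrightarrow> F \<subseteq> T closure_of N'"
  using closure_of_mono[of N "T closure_of N'" T] by (simp add: closure_of_closure_of)

lemma densely_embeds_iso:
  assumes "M \<cong> M'" "densely_embeds M' F"
  shows "densely_embeds M F"
  using assms iso_trans[OF assms(1)] unfolding densely_embeds_def by blast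

lemma densely_embedsI:
  assumes "group P" "f \<in> hom P G" "inj_on f (carrier P)"
    and "F \<subseteq> T closure_of N" "N \<subseteq> T closure_of (f ` carrier P)"
  shows "densely_embeds P F"
proof -
  interpret f: group_hom P G f using assms(1,2) by (simp add: group_hom_def group_hom_axioms_def)
  have "subgroup (f ` carrier P) G" by (rule f.img_is_subgroup)
  moreover have "P \<cong> G\<lparr>carrier := f ` carrier P\<rparr>"
    using inj_hom_is_iso[OF assms(2,3)] by (rule is_isoI)
  moreover note closure_trans[OF assms(4,5)]
  ultimately show ?thesis unfolding densely_embeds_def by (intro exI[of _ "f ` carrier P"] conjI)
qed

text \<open>Realize \<open>M\<close> as a subgroup whose closure contains \<open>F\<close>, compose with \<open>M' \<rightarrow> M\<close> and twist the resulting map to \<open>G\<close>, by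
  \<open>amalgam_embedding\<close> or \<open>HNN_embedding\<close>.\<close>

theorem double_densely_embeds:
  assumes "generalized_double M' M \<phi>" "densely_embeds M F"
  shows "densely_embeds M' F"
proof -
  obtain N where N: "subgroup N G" "M \<cong> G\<lparr>carrier := N\<rparr>" "F \<subseteq> T closure_of N"
    using assms(2) unfolding densely_embeds_def by (elim exE conjE) (rule that)
  note gd = assms(1)[unfolded generalized_double_def]
  have M: "limit_group M" by (rule gd[THEN conjunct2, THEN conjunct1])
  have "\<phi> \<in> epi M' M" by (rule gd[THEN conjunct2, THEN conjunct2, THEN conjunct1])
  then have \<phi>: "\<phi> \<in> hom M' M" "\<phi> ` carrier M' = carrier M" by (simp_all add: epi_def)
  have grpN: "group (G\<lparr>carrier := N\<rparr>)" by (rule subgroup.subgroup_is_group[OF N(1) group_axioms])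
  note sep = limit_group_separation[OF M N(2) grpN]
  obtain \<sigma> where "\<sigma> \<in> iso M (G\<lparr>carrier := N\<rparr>)" using N(2) unfolding is_iso_def by blast
  then have \<sigma>: "\<sigma> \<in> hom M (G\<lparr>carrier := N\<rparr>)" "\<sigma> ` carrier M = N" "inj_on \<sigma> (carrier M)"
    by (auto simp: iso_def bij_betw_def)
  have \<sigma>G: "\<sigma> \<in> hom M G" using \<sigma>(1) subgroup.mem_carrier[OF N(1)] by (auto simp: hom_def)
  have \<Phi>: "\<sigma> \<circ> \<phi> \<circ> \<psi> \<in> hom P G" "(\<sigma> \<circ> \<phi> \<circ> \<psi>) ` carrier P = N" if \<psi>: "\<psi> \<in> iso P M'"
    for P :: "'z set monoid" and \<psi>
  proof -
    have h: "\<psi> \<in> hom P M'" "\<psi> ` carrier P = carrier M'" using \<psi> by (auto simp: iso_def bij_betw_def)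
    show "\<sigma> \<circ> \<phi> \<circ> \<psi> \<in> hom P G"
      by (rule Group.hom_compose[OF h(1) Group.hom_compose[OF \<phi>(1) \<sigma>G]])
    show "(\<sigma> \<circ> \<phi> \<circ> \<psi>) ` carrier P = N" unfolding image_comp[symmetric] h(2) \<phi>(2) \<sigma>(2) ..
  qed
  have inj: "inj_on (\<sigma> \<circ> \<phi> \<circ> \<psi> \<circ> v) (carrier A)"
    if v: "inj_on (\<phi> \<circ> \<psi> \<circ> v) (carrier A)" "\<And>a. a \<in> carrier A \<Longrightarrow> v a \<in> carrier P" and \<psi>: "\<psi> \<in> iso P M'"
    for A :: "nat monoid" and v and P :: "'z set monoid" and \<psi>
  proof (rule inj_onI)
    fix a b assume ab: "a \<in> carrier A" "b \<in> carrier A" "(\<sigma> \<circ> \<phi> \<circ> \<psi> \<circ> v) a = (\<sigma> \<circ> \<phi> \<circ> \<psi> \<circ> v) b"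
    have h: "\<psi> \<in> hom P M'" using \<psi> by (auto simp: iso_def)
    have m: "(\<phi> \<circ> \<psi> \<circ> v) x \<in> carrier M" if x: "x \<in> carrier A" for x
      using hom_in_carrier[OF \<phi>(1) hom_in_carrier[OF h v(2)[OF x]]] by simp
    have "(\<phi> \<circ> \<psi> \<circ> v) a = (\<phi> \<circ> \<psi> \<circ> v) b"
      by (rule inj_onD[OF \<sigma>(3) _ m[OF ab(1)] m[OF ab(2)]]) (use ab(3) in simp)
    then show "a = b" by (rule inj_onD[OF v(1) _ ab(1,2)])
  qed
  have conclude: "densely_embeds M' F"
    if P: "group P" and \<psi>: "\<psi> \<in> iso P M'" and f: "f \<in> hom P G" "inj_on f (carrier P)" "N \<subseteq> T closure_of (f ` carrier P)"
    for P :: "'z set monoid" and \<psi> f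
  proof (rule densely_embeds_iso)
    show "M' \<cong> P" using group.iso_sym[OF P] \<psi> unfolding is_iso_def by blast
    show "densely_embeds P F" by (rule densely_embedsI[OF P f(1,2) N(3) f(3)])
  qed
  from gd[THEN conjunct2, THEN conjunct2, THEN conjunct2] show ?thesis
  proof (elim disjE exE conjE bexE)
    fix A B C :: "nat monoid" and i j \<psi>
    let ?P = "amalgam A B C i j"
    assume A: "finitely_generated A" and B: "finitely_generated B"
      and C: "comm_group C" "carrier C \<noteq> {\<one>\<^bsub>C\<^esub>}"
      and ij: "double_edge C A i" "double_edge C B j" and \<psi>: "\<psi> \<in> iso ?P M'"
      and vi: "inj_on (\<phi> \<circ> \<psi> \<circ> amalgam_inl A B C i j) (carrier A)"
      and wi: "inj_on (\<phi> \<circ> \<psi> \<circ> amalgam_inr A B C i j) (carrier B)"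
    have grp: "group A" "group B" using A B by (simp_all add: finitely_generated_def)
    have v: "amalgam_inl A B C i j a \<in> carrier ?P" if "a \<in> carrier A" for a
      unfolding amalgam_inl_def amalgam_def by (rule pres_gen_closed) (use that in \<open>auto simp: amalgam_gens_def\<close>)
    have w: "amalgam_inr A B C i j a \<in> carrier ?P" if "a \<in> carrier B" for a
      unfolding amalgam_inr_def amalgam_def by (rule pres_gen_closed) (use that in \<open>auto simp: amalgam_gens_def\<close>)
    obtain f where f: "f \<in> hom ?P G" "inj_on f (carrier ?P)"
      "(\<sigma> \<circ> \<phi> \<circ> \<psi>) ` carrier ?P \<subseteq> T closure_of (f ` carrier ?P)"
      using amalgam_embedding[OF grp(1) _ grp(2) _ C ij \<Phi>(1)[OF \<psi>] inj[OF vi v \<psi>] inj[OF wi w \<psi>]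
          sep[folded \<Phi>(2)[OF \<psi>]]] by auto
    show ?thesis
      by (rule conclude[OF _ \<psi> f(1,2)]) (use f(3) \<Phi>(2)[OF \<psi>] group_presented_group in \<open>simp_all add: amalgam_def\<close>)
  next
    fix A C :: "nat monoid" and i j \<psi>
    let ?P = "HNN A C i j"
    assume A: "finitely_generated A"
      and C: "comm_group C" "carrier C \<noteq> {\<one>\<^bsub>C\<^esub>}"
      and ij: "double_edge C A i" "double_edge C A j" and \<psi>: "\<psi> \<in> iso ?P M'"
      and vi: "inj_on (\<phi> \<circ> \<psi> \<circ> HNN_vertex A C i j) (carrier A)"
    have grp: "group A" using A by (simp add: finitely_generated_def)
    have v: "HNN_vertex A C i j a \<in> carrier ?P" if "a \<in> carrier A" for a
      unfolding HNN_vertex_def HNN_def by (rule pres_gen_closed) (use that in \<open>auto simp: HNN_gens_def\<close>)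
    obtain f where f: "f \<in> hom ?P G" "inj_on f (carrier ?P)"
      "(\<sigma> \<circ> \<phi> \<circ> \<psi>) ` carrier ?P \<subseteq> T closure_of (f ` carrier ?P)"
      using HNN_embedding[OF grp _ C ij \<Phi>(1)[OF \<psi>] inj[OF vi v \<psi>] sep[folded \<Phi>(2)[OF \<psi>]]] by auto
    show ?thesis
      by (rule conclude[OF _ \<psi> f(1,2)]) (use f(3) \<Phi>(2)[OF \<psi>] group_presented_group in \<open>simp_all add: HNN_def\<close>)
  qed
qed

theorem free_group_densely_embeds:
  assumes F: "subgroup F G" "free_of_rank (G\<lparr>carrier := F\<rparr>) r" and "2 \<le> r" "r \<le> n"
  shows "densely_embeds (free_group {..<n}) F"
  using assms(4)
proof (induction rule: dec_induct)
  case base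
  have grpF: "group (G\<lparr>carrier := F\<rparr>)" "G\<lparr>carrier := F\<rparr> \<cong> free_group {..<r}"
    using F(2) by (simp_all add: free_of_rank_def)
  have "free_group {..<r} \<cong> G\<lparr>carrier := F\<rparr>" by (rule group.iso_sym[OF grpF])
  moreover have "F \<subseteq> T closure_of F" by (rule closure_of_subset) (use subgroup.subset[OF F(1)] in simp)
  ultimately show ?case using F(1) unfolding densely_embeds_def by (intro exI[of _ F] conjI)
next
  case (step m)
  obtain N where N: "subgroup N G" "free_group {..<m} \<cong> G\<lparr>carrier := N\<rparr>" "F \<subseteq> T closure_of N"
    using step.IH unfolding densely_embeds_def by (elim exE conjE) (rule that)
  obtain \<kappa> where \<kappa>: "\<kappa> \<in> iso (free_group {..<m}) (G\<lparr>carrier := N\<rparr>)" using N(2) unfolding is_iso_def by blast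
  have m: "2 \<le> m" using step.hyps(1) assms(3) by simp
  obtain N' where N': "subgroup N' G" "free_group {..<Suc m} \<cong> G\<lparr>carrier := N'\<rparr>" "N \<subseteq> T closure_of N'"
    using free_rank_step[OF N(1) \<kappa> m] by (elim exE conjE) (rule that)
  show ?case unfolding densely_embeds_def
    using N'(1,2) closure_trans[OF N(3) N'(3)] by (intro exI[of _ N'] conjI)
qed

end

theorem theorem1p2:
  fixes L :: "('l, 'm) monoid_scheme"
    and G :: "('g, 'n) monoid_scheme"
    and T :: "'g topology"
    and F :: "'g set"
    and r :: nat
  assumes "limit_group L" and "\<not> comm_group L"
    and "compact_group G T"
    and "subgroup F G" and "free_of_rank (G\<lparr>carrier := F\<rparr>) r"
    and "2 \<le> r" and "r \<le> double_rank L"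
  shows "\<exists>H. subgroup H G \<and> G\<lparr>carrier := H\<rparr> \<cong> L \<and> F \<subseteq> T closure_of H"
proof -
  interpret compact_top_group G T by standard (rule assms(3))
  have "double_rank L \<in> double_ranks L"
    by (rule double_rank_attained[OF assms(1)]) (use assms(6,7) in simp)
  then obtain L' E where L': "group L'" "L \<cong> L'" "double_arrow\<^sup>*\<^sup>* L' E" and E: "free_of_rank E (double_rank L)"
    unfolding double_ranks_def mem_Collect_eq by (elim exE conjE) (rule that)
  have "E \<cong> free_group {..<double_rank L}" using E by (simp add: free_of_rank_def)
  then have base: "densely_embeds E F"
    by (rule densely_embeds_iso) (rule free_group_densely_embeds[OF assms(4,5,6,7)])
  from L'(3) have "densely_embeds L' F"
  proof (induction rule: converse_rtranclp_induct)
    case base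
    show ?case by (rule \<open>densely_embeds E F\<close>)
  next
    case (step M' M)
    obtain \<phi> where "generalized_double M' M \<phi>" using step.hyps(1) unfolding double_arrow_def by blast
    then show ?case by (rule double_densely_embeds[OF _ step.IH])
  qed
  with L'(2) have "densely_embeds L F" by (rule densely_embeds_iso)
  then obtain H where H: "subgroup H G" "L \<cong> G\<lparr>carrier := H\<rparr>" "F \<subseteq> T closure_of H"
    unfolding densely_embeds_def by (elim exE conjE) (rule that)
  have "group L" using assms(1) by (simp add: limit_group_def finitely_generated_def)
  then have "G\<lparr>carrier := H\<rparr> \<cong> L" using H(2) by (rule group.iso_sym)
  with H(1,3) show ?thesis by (intro exI[of _ H] conjI)
qed

end
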